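(* Let $n_1 \geq 3$ and $m_2 \geq 1$ be integers such that, with $j=j_{n_1,m_2}$, $k=k_{n_1,m_2}$ and $r=r_{n_1,m_2}$ as in the context, $k=0$ and $j = \lfloor (m_2-1)/2 \rfloor$. Let $\epsilon = 2^{m_2-1}$ if $m_2$ is even and $m_2 \geq 4$, and $\epsilon = 2^{m_2-1}-1$ if $m_2$ is odd or $m_2 = 2$. Then for all sufficiently large $m_1$ and all positive integers $n_2$, the graph $K_{m_1(n_1), m_2(n_2)}$ has a distinguishing partition if and only if $n_2 \leq r m_1 + \epsilon$.
   Context: $K_{m_1(n_1),m_2(n_2)}$ denotes the complete multipartite graph whose parts are $m_1$ sets of size $n_1$ and $m_2$ sets of size $n_2$. For a graph $X$ with automorphism group $\mathrm{aut}(X)$ and a partition $P=\{P_1,\dots,P_t\}$ of $V(X)$, put $\gamma(P)=\{\gamma(P_1),\dots,\gamma(P_t)\}$; $P$ is a distinguishing partition if $\gamma(P)\neq P$ for every nontrivial $\gamma\in\mathrm{aut}(X)$. For $n_1 \geq 3$, $j=j_{n_1,m_2}\ge0$ and $k=k_{n_1,m_2}\ge0$ are the integers with $n_1 = 2 + \sum_{i=0}^{j}\binom{m_2}{i} + k$ and either ($j < \lfloor (m_2-1)/2 \rfloor$ and $0 \leq k < \binom{m_2}{j+1}$) or ($j = \lfloor (m_2-1)/2 \rfloor$ and $k \geq 0$). If $j < \lfloor (m_2-1)/2 \rfloor$, $r = 1 + \sum_{i=0}^{j}\frac{m_2-i}{m_2}\binom{m_2}{i} + \frac{m_2 - j - 1}{m_2}k$;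 otherwise $r = 1 + \sum_{i=0}^{j}\frac{m_2-i}{m_2}\binom{m_2}{i} + \frac{k}{2}$. *)

theory Defs
  imports Complex_Main "HOL-Library.Disjoint_Sets" "HOL-Combinatorics.Permutations"
begin

text \<open>A simple graph is a pair of a vertex set and a set of edges, the edges being
  two-element sets of vertices.\<close>

type_synonym 'a graph = "'a set \<times> 'a set set"

text \<open>Automorphisms are represented as permutations of the vertex set, i.e. as functions on the
  whole type that fix everything outside the vertex set; thus the only trivial one is \<open>id\<close>.\<close>

definition aut :: "'a graph \<Rightarrow> ('a \<Rightarrow> 'a) set" where
  "aut X = {\<gamma>. \<gamma> permutes fst X \<and>
     (\<forall>u\<in>fst X. \<forall>v\<in>fst X. {\<gamma> u, \<gamma> v} \<in> snd X \<longleftrightarrow> {u, v} \<in> snd X)}"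

definition distinguishing_partition :: "'a graph \<Rightarrow> 'a set set \<Rightarrow> bool" where
  "distinguishing_partition X P \<longleftrightarrow>
     partition_on (fst X) P \<and> (\<forall>\<gamma>\<in>aut X. \<gamma> \<noteq> id \<longrightarrow> (`) \<gamma> ` P \<noteq> P)"

text \<open>The complete multipartite graph whose parts have the sizes listed in \<open>ns\<close>; the vertex
  \<open>(i, a)\<close> is the \<open>a\<close>-th vertex of the \<open>i\<close>-th part.\<close>

definition multipartite_verts :: "nat list \<Rightarrow> (nat \<times> nat) set" where
  "multipartite_verts ns = {(i, a). i < length ns \<and> a < ns ! i}"

definition complete_multipartite :: "nat list \<Rightarrow> (nat \<times> nat) graph" where
  "complete_multipartite ns =
     (multipartite_verts ns,
      {{u, v} | u v. u \<in> multipartite_verts ns \<and> v \<in> multipartite_verts ns \<and> fst u \<noteq> fst v})"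

text \<open>\<open>K m\<^sub>1 n\<^sub>1 m\<^sub>2 n\<^sub>2\<close> is the graph usually written \<open>K\<close> with subscript
  \<open>m\<^sub>1(n\<^sub>1), m\<^sub>2(n\<^sub>2)\<close>.\<close>

definition K :: "nat \<Rightarrow> nat \<Rightarrow> nat \<Rightarrow> nat \<Rightarrow> (nat \<times> nat) graph" where
  "K m1 n1 m2 n2 = complete_multipartite (replicate m1 n1 @ replicate m2 n2)"

definition is_jk :: "nat \<Rightarrow> nat \<Rightarrow> nat \<Rightarrow> nat \<Rightarrow> bool" where
  "is_jk n1 m2 j k \<longleftrightarrow>
     n1 = 2 + (\<Sum>i=0..j. m2 choose i) + k \<and>
     (j < (m2 - 1) div 2 \<and> k < m2 choose (j + 1) \<or> j = (m2 - 1) div 2)"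

text \<open>The parameters \<open>j\<close> and \<open>k\<close> are determined by \<open>n\<^sub>1\<close> and \<open>m\<^sub>2\<close>.\<close>

lemma is_jk_exists:
  assumes "n1 \<ge> 3"
  shows "\<exists>j k. is_jk n1 m2 j k"
proof (cases "2 + (\<Sum>i=0..(m2 - 1) div 2. m2 choose i) \<le> n1")
  case True
  then have "is_jk n1 m2 ((m2 - 1) div 2) (n1 - (2 + (\<Sum>i=0..(m2 - 1) div 2. m2 choose i)))"
    by (simp add: is_jk_def)
  then show ?thesis by blast
next
  case False
  define S where "S j = 2 + (\<Sum>i=0..j. m2 choose i)" for j
  define l where "l = (LEAST j. n1 < S j)"
  have J: "n1 < S ((m2 - 1) div 2)" using False by (simp add: S_def)
  have l: "n1 < S l" "l \<le> (m2 - 1) div 2"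
    unfolding l_def using J by (auto intro: LeastI Least_le)
  have "l \<noteq> 0" using l(1) assms by (intro notI) (simp add: S_def)
  then obtain j where j: "l = Suc j" by (cases l) auto
  have "S j \<le> n1" using not_less_Least[of j "\<lambda>j. n1 < S j"] j l_def by auto
  moreover have "S l = S j + (m2 choose (j + 1))" by (simp add: S_def j)
  ultimately have "is_jk n1 m2 j (n1 - S j)" using l j by (auto simp: is_jk_def S_def)
  then show ?thesis by blast
qed

lemma is_jk_unique:
  assumes "is_jk n1 m2 j k" "is_jk n1 m2 j' k'"
  shows "j = j' \<and> k = k'"
proof -
  have *: "\<not> a < b" if "is_jk n1 m2 a c" "is_jk n1 m2 b d" for a b c d
  proof
    assume "a < b"
    then have "(\<Sum>i=0..Suc a. m2 choose i) \<le> (\<Sum>i=0..b. m2 choose i)"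
      by (intro sum_mono2) auto
    with that \<open>a < b\<close> show False by (auto simp: is_jk_def)
  qed
  have "j = j'" using *[OF assms] *[OF assms(2,1)] by linarith
  with assms show ?thesis by (simp add: is_jk_def)
qed

definition r_param :: "nat \<Rightarrow> nat \<Rightarrow> nat \<Rightarrow> real" where
  "r_param m2 j k =
     1 + (\<Sum>i=0..j. (real m2 - real i) / real m2 * real (m2 choose i)) +
     (if j < (m2 - 1) div 2 then (real m2 - real j - 1) / real m2 * real k else real k / 2)"

definition epsilon :: "nat \<Rightarrow> real" where
  "epsilon m2 = (if even m2 \<and> m2 \<ge> 4 then 2 ^ (m2 - 1) else 2 ^ (m2 - 1) - 1)"

end

theory Submission imports Defs begin

text \<open>Replacing every block of a partition by the set of parts that it meets turns distinguishing
  partitions into rigid families: sets of nonempty sets of parts, preserved by no nontrivial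
  permutation of the parts, in which every part lies in as many sets as it has vertices. Let \<open>B\<close> consist
  of the \<open>m2\<close> parts of size \<open>n2\<close>, and call a subset of \<open>B\<close> large if it contains more than half of \<open>B\<close>.
  The hypothesis on \<open>n1\<close> says that there are exactly \<open>n1 - 2\<close> large sets.

  For the upper bound, let every set that meets other parts than those in \<open>B\<close> share its elements of
  \<open>B\<close> evenly among these. A part of size \<open>n1\<close> receives at most the sizes of all large sets, plus half
  of \<open>m2\<close> for each of its two remaining sets, which is \<open>r * m2\<close> in total; the sets inside \<open>B\<close>
  contribute at most \<open>m2 * 2 ^ (m2 - 1)\<close>. If equality holds and \<open>m2\<close> is odd or \<open>2\<close>, then the remaining
  sets form disjoint cycles and, for \<open>m2 = 2\<close>, also paths whose ends are labelled by an element of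
  \<open>B\<close>. Rotating a cycle, reversing a path with equal labels, or reversing all paths while exchanging
  the two labels is a nontrivial symmetry.

  For the lower bound, arrange the parts of size \<open>n1\<close> on \<open>m2\<close> paths of different lengths, and attach
  the \<open>i\<close>-th and the \<open>(i + 1)\<close>-th cyclic window of length \<open>m2 div 2\<close> in \<open>B\<close> to the ends of the \<open>i\<close>-th
  path. Such a family is rigid whatever subsets of \<open>B\<close> are attached to the links, so that
  smaller values of \<open>n2\<close> are reached by emptying links and by letting several parts share the sets
  of large type. For very small \<open>n2\<close> the parts of size \<open>n1\<close> are made rigid on their own, which is
  also the way to treat \<open>m2 = 1\<close>; for \<open>m2 = 2\<close> a single path suffices, because omitting one of the two
  singletons inside \<open>B\<close> distinguishes its two elements.\<close>

section \<open>Distinguishing partitions as rigid set families\<close>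

definition rigid_family :: "'i set \<Rightarrow> 'i set set \<Rightarrow> bool" where
  "rigid_family I F \<longleftrightarrow> F \<subseteq> Pow I - {{}} \<and> (\<forall>\<sigma>. \<sigma> permutes I \<and> (`) \<sigma> ` F = F \<longrightarrow> \<sigma> = id)"

lemma fst_complete_multipartite [simp]: "fst (complete_multipartite ns) = multipartite_verts ns"
  by (simp add: complete_multipartite_def)

lemma finite_multipartite_verts [simp]: "finite (multipartite_verts ns)"
proof -
  have "multipartite_verts ns = (SIGMA i:{..<length ns}. {..<ns ! i})"
    by (auto simp: multipartite_verts_def)
  then show ?thesis by simp
qed

lemma edge_complete_multipartite_iff:
  assumes "u \<in> multipartite_verts ns" "v \<in> multipartite_verts ns"
  shows "{u, v} \<in> snd (complete_multipartite ns) \<longleftrightarrow> fst u \<noteq> fst v"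
proof
  assume "{u, v} \<in> snd (complete_multipartite ns)"
  then obtain u' v' where "{u, v} = {u', v'}" "fst u' \<noteq> fst v'"
    by (auto simp: complete_multipartite_def)
  then show "fst u \<noteq> fst v" by (auto simp: doubleton_eq_iff)
next
  assume "fst u \<noteq> fst v"
  then show "{u, v} \<in> snd (complete_multipartite ns)"
    using assms unfolding complete_multipartite_def snd_conv by blast
qed

lemma aut_complete_multipartite_iff:
  "\<gamma> \<in> aut (complete_multipartite ns) \<longleftrightarrow> \<gamma> permutes multipartite_verts ns \<and>
     (\<forall>u\<in>multipartite_verts ns. \<forall>v\<in>multipartite_verts ns. fst (\<gamma> u) = fst (\<gamma> v) \<longleftrightarrow> fst u = fst v)"
proof -
  have "\<gamma> u \<in> multipartite_verts ns" if "\<gamma> permutes multipartite_verts ns" "u \<in> multipartite_verts ns" for u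
    using that by (simp add: permutes_in_image)
  then have "({\<gamma> u, \<gamma> v} \<in> snd (complete_multipartite ns) \<longleftrightarrow> {u, v} \<in> snd (complete_multipartite ns))
      \<longleftrightarrow> (fst (\<gamma> u) = fst (\<gamma> v) \<longleftrightarrow> fst u = fst v)"
    if "\<gamma> permutes multipartite_verts ns" "u \<in> multipartite_verts ns" "v \<in> multipartite_verts ns" for u v
    using that by (simp add: edge_complete_multipartite_iff)
  then show ?thesis unfolding aut_def mem_Collect_eq fst_complete_multipartite by blast
qed

text \<open>Transposing two vertices of the same part is an automorphism; if both lay in one block,
  it would fix every block.\<close>

lemma distinguishing_partition_inj_on_block:
  assumes "distinguishing_partition (complete_multipartite ns) P" "p \<in> P"
  shows "inj_on fst p"
proof (rule inj_onI, rule ccontr)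
  fix u v assume uv: "u \<in> p" "v \<in> p" "fst u = fst v" "u \<noteq> v"
  let ?V = "multipartite_verts ns" and ?\<gamma> = "transpose u v"
  have part: "partition_on ?V P" using assms by (simp add: distinguishing_partition_def)
  then have V: "u \<in> ?V" "v \<in> ?V" using uv assms(2) by (auto simp: partition_on_def)
  have fst: "fst (?\<gamma> w) = fst w" for w using uv by (simp add: transpose_def)
  have "?\<gamma> \<in> aut (complete_multipartite ns)"
    using V by (simp add: aut_complete_multipartite_iff permutes_swap_id fst)
  moreover have "?\<gamma> \<noteq> id" using uv by (metis id_apply transpose_apply_first)
  moreover have "?\<gamma> ` q = q" if "q \<in> P" for q
  proof (cases "q = p")
    case True
    then show ?thesis using uv transpose_image_eq[of u q v] by simp
  next
    case False
    then have "q \<inter> p = {}" using part that assms(2) by (auto simp: partition_on_def disjoint_def)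
    then have "u \<notin> q" "v \<notin> q" using uv by auto
    then show ?thesis using transpose_image_eq[of u q v] by simp
  qed
  ultimately show False using assms(1) by (auto simp: distinguishing_partition_def)
qed

text \<open>Since a block has at most one vertex in each part, a permutation \<open>\<sigma>\<close>
  of the parts and a compatible permutation \<open>\<tau>\<close> of the blocks lift to an
  automorphism that preserves the partition. It is trivial, hence so is \<open>\<tau>\<close>, and
  \<open>\<sigma>\<close> too because no part is empty.\<close>

lemma distinguishing_partition_rigid:
  assumes dp: "distinguishing_partition (complete_multipartite ns) P"
    and pos: "\<forall>i<length ns. ns ! i > 0"
    and \<sigma>: "\<sigma> permutes {..<length ns}" and \<tau>: "bij_betw \<tau> P P"
    and \<sigma>\<tau>: "\<And>p. p \<in> P \<Longrightarrow> fst ` \<tau> p = \<sigma> ` fst ` p"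
  shows "\<sigma> = id" "\<And>p. p \<in> P \<Longrightarrow> \<tau> p = p"
proof -
  let ?V = "multipartite_verts ns"
  have part: "partition_on ?V P" using dp by (simp add: distinguishing_partition_def)
  have \<tau>P: "\<tau> p \<in> P" if "p \<in> P" for p using \<tau> that by (auto simp: bij_betw_def)
  have ex: "\<exists>p. p \<in> P \<and> w \<in> p" if "w \<in> ?V" for w using part that by (auto simp: partition_on_def)
  have uniq: "p = q" if "p \<in> P" "q \<in> P" "w \<in> p" "w \<in> q" for p q w
    using part that by (auto simp: partition_on_def disjoint_def)
  have sub: "p \<subseteq> ?V" if "p \<in> P" for p using part that by (auto simp: partition_on_def)
  define blk where "blk w = (THE p. p \<in> P \<and> w \<in> p)" for w
  have blk: "blk w = p" if "p \<in> P" "w \<in> p" for w p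
    unfolding blk_def using that uniq[OF _ that(1) _ that(2)] by (intro the_equality) blast+
  \<comment> \<open>The vertex \<open>w\<close> goes to the only vertex of the image block that lies
    in the image part.\<close>
  define \<gamma> where "\<gamma> w = (if w \<in> ?V then inv_into (\<tau> (blk w)) fst (\<sigma> (fst w)) else w)" for w
  have \<gamma>: "\<gamma> w \<in> \<tau> p \<and> fst (\<gamma> w) = \<sigma> (fst w)" if "p \<in> P" "w \<in> p" for p w
  proof -
    have "\<sigma> (fst w) \<in> fst ` \<tau> p" using that \<sigma>\<tau> by auto
    moreover have "w \<in> ?V" using that sub by auto
    ultimately show ?thesis
      using that by (simp add: \<gamma>_def blk inv_into_into f_inv_into_f)
  qed
  have \<gamma>V: "\<gamma> w \<in> ?V" if "w \<in> ?V" for w using ex[OF that] \<gamma> sub \<tau>P by blast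
  have inj: "inj_on \<gamma> ?V"
  proof (rule inj_onI)
    fix w w' assume w: "w \<in> ?V" "w' \<in> ?V" "\<gamma> w = \<gamma> w'"
    obtain p p' where p: "p \<in> P" "w \<in> p" "p' \<in> P" "w' \<in> p'" using ex w by metis
    have "\<tau> p = \<tau> p'" using \<gamma>[of p w] \<gamma>[of p' w'] p w uniq[OF \<tau>P \<tau>P] by metis
    then have "p = p'" using \<tau> p by (auto simp: bij_betw_def inj_on_def)
    moreover have "fst w = fst w'"
      using \<gamma>[of p w] \<gamma>[of p' w'] p w permutes_inj[OF \<sigma>] by (metis injD)
    ultimately show "w = w'"
      using distinguishing_partition_inj_on_block[OF dp, of p] p by (auto simp: inj_on_def)
  qed
  have perm: "\<gamma> permutes ?V"
  proof (rule bij_imp_permutes)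
    show "bij_betw \<gamma> ?V ?V"
      using inj \<gamma>V endo_inj_surj[of ?V \<gamma>] by (simp add: bij_betw_def image_subsetI)
  qed (simp add: \<gamma>_def)
  have fst\<gamma>: "fst (\<gamma> w) = \<sigma> (fst w)" if "w \<in> ?V" for w using ex[OF that] \<gamma> by blast
  have "\<gamma> \<in> aut (complete_multipartite ns)"
    unfolding aut_complete_multipartite_iff using perm fst\<gamma> permutes_inj[OF \<sigma>]
    by (auto dest: injD)
  moreover have img: "\<gamma> ` p = \<tau> p" if "p \<in> P" for p
  proof
    show "\<gamma> ` p \<subseteq> \<tau> p" using \<gamma> that by auto
    show "\<tau> p \<subseteq> \<gamma> ` p"
    proof
      fix u assume u: "u \<in> \<tau> p"
      then have "fst u \<in> \<sigma> ` fst ` p" using \<sigma>\<tau>[OF that] by (metis imageI)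
      then obtain w where w: "w \<in> p" "fst u = \<sigma> (fst w)" by auto
      then have "fst (\<gamma> w) = fst u" "\<gamma> w \<in> \<tau> p" using \<gamma> that by auto
      then have "u = \<gamma> w"
        using distinguishing_partition_inj_on_block[OF dp \<tau>P[OF that]] u by (auto simp: inj_on_def)
      then show "u \<in> \<gamma> ` p" using w by blast
    qed
  qed
  then have "(`) \<gamma> ` P = \<tau> ` P" by (intro image_cong) auto
  then have "(`) \<gamma> ` P = P" using \<tau> by (simp add: bij_betw_def)
  ultimately have id: "\<gamma> = id" using dp by (auto simp: distinguishing_partition_def)
  show "\<tau> p = p" if "p \<in> P" for p using img[OF that] id by simp
  have "\<sigma> i = i" for i
  proof (cases "i < length ns")
    case True
    then have "(i, 0) \<in> ?V" using pos by (simp add: multipartite_verts_def)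
    from fst\<gamma>[OF this] show ?thesis using id by simp
  qed (use \<sigma> in \<open>simp add: permutes_def\<close>)
  then show "\<sigma> = id" by auto
qed

text \<open>Each block is replaced by the set of parts that it meets. Two blocks with the same trace
  could be exchanged, so the traces are distinct; a symmetry of the traces therefore induces a
  permutation of the blocks, and lifting it to the vertices shows that it is trivial.\<close>

lemma rigid_family_of_distinguishing_partition:
  assumes dp: "distinguishing_partition (complete_multipartite ns) P"
    and pos: "\<forall>i<length ns. ns ! i > 0"
  obtains F where "rigid_family {..<length ns} F" "\<forall>i<length ns. card {S \<in> F. i \<in> S} = ns ! i"
proof -
  let ?V = "multipartite_verts ns"
  have part: "partition_on ?V P" using dp by (simp add: distinguishing_partition_def)
  define F where "F = (`) fst ` P"
  have inj: "inj_on ((`) fst) P"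
  proof (rule inj_onI)
    fix p q assume pq: "p \<in> P" "q \<in> P" "fst ` p = fst ` q"
    have "bij_betw (transpose p q) P P"
      using pq inj_on_subset[OF inj_transpose] by (simp add: bij_betw_def transpose_image_eq)
    moreover have "fst ` transpose p q r = id ` fst ` r" for r
      using pq by (cases "r = p"; cases "r = q") auto
    ultimately have "transpose p q p = p"
      by (rule distinguishing_partition_rigid(2)[OF dp pos permutes_id _ _ pq(1)])
    then show "p = q" by simp
  qed
  have "rigid_family {..<length ns} F"
    unfolding rigid_family_def
  proof (intro conjI allI impI)
    show "F \<subseteq> Pow {..<length ns} - {{}}"
      using part by (fastforce simp: F_def partition_on_def multipartite_verts_def)
    fix \<sigma> assume \<sigma>: "\<sigma> permutes {..<length ns} \<and> (`) \<sigma> ` F = F"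
    define \<tau> where "\<tau> p = inv_into P ((`) fst) (\<sigma> ` fst ` p)" for p :: "(nat \<times> nat) set"
    have mem: "\<sigma> ` fst ` p \<in> F" if "p \<in> P" for p using \<sigma> that by (metis F_def imageI)
    have "fst ` \<tau> p = \<sigma> ` fst ` p" if "p \<in> P" for p
      unfolding \<tau>_def using mem[OF that] by (auto simp: F_def f_inv_into_f)
    moreover have "bij_betw \<tau> P P"
    proof -
      have b1: "bij_betw ((`) fst) P F" using inj by (simp add: F_def bij_betw_def)
      have b2: "bij_betw ((`) \<sigma>) F F"
        using \<sigma> inj_image_eq_iff[OF permutes_inj[of \<sigma>]] by (auto simp: bij_betw_def inj_on_def)
      have "bij_betw (inv_into P ((`) fst) \<circ> (`) \<sigma> \<circ> (`) fst) P P"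
        using b1 b2 bij_betw_inv_into[OF b1] by (auto intro: bij_betw_trans)
      then show ?thesis by (simp add: \<tau>_def comp_def cong: bij_betw_cong)
    qed
    ultimately show "\<sigma> = id"
      using distinguishing_partition_rigid(1)[OF dp pos, of \<sigma> \<tau>] conjunct1[OF \<sigma>] by simp
  qed
  moreover have "card {S \<in> F. i \<in> S} = ns ! i" if i: "i < length ns" for i
  proof -
    have ex: "\<exists>p. p \<in> P \<and> w \<in> p" if "w \<in> ?V" for w using part that by (auto simp: partition_on_def)
    have "\<exists>!a. a < ns ! i \<and> (i, a) \<in> p" if "p \<in> P" "i \<in> fst ` p" for p
    proof -
      have "p \<subseteq> ?V" using part that by (auto simp: partition_on_def)
      then show ?thesis
        using that distinguishing_partition_inj_on_block[OF dp that(1)]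
        by (force simp: multipartite_verts_def inj_on_def)
    qed
    then have "\<exists>g. \<forall>p. p \<in> P \<and> i \<in> fst ` p \<longrightarrow> g p < ns ! i \<and> (i, g p) \<in> p" by metis
    then obtain g where g: "\<And>p. p \<in> P \<Longrightarrow> i \<in> fst ` p \<Longrightarrow> g p < ns ! i \<and> (i, g p) \<in> p" by blast
    \<comment> \<open>Each vertex of part \<open>i\<close> lies in exactly one block, and
      \<open>g\<close> finds it again from that block.\<close>
    have "bij_betw g {p \<in> P. i \<in> fst ` p} {..<ns ! i}"
      unfolding bij_betw_def
    proof (intro conjI equalityI subsetI)
      show "inj_on g {p \<in> P. i \<in> fst ` p}"
      proof (rule inj_onI, rule ccontr)
        fix p q assume "p \<in> {p \<in> P. i \<in> fst ` p}" "q \<in> {p \<in> P. i \<in> fst ` p}" "g p = g q" "p \<noteq> q"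
        moreover from this have "p \<inter> q = {}"
          using part by (auto simp: partition_on_def disjoint_def)
        ultimately show False using g[of p] g[of q] by auto
      qed
      fix a assume "a \<in> {..<ns ! i}"
      then have "(i, a) \<in> ?V" using i by (simp add: multipartite_verts_def)
      then obtain p where p: "p \<in> P" "(i, a) \<in> p" using ex by blast
      then have "i \<in> fst ` p" by force
      moreover from g[OF p(1) this] have "g p = a"
        using distinguishing_partition_inj_on_block[OF dp p(1)] p by (force simp: inj_on_def)
      ultimately show "a \<in> g ` {p \<in> P. i \<in> fst ` p}" using p by blast
    qed (use g in auto)
    then have "card {p \<in> P. i \<in> fst ` p} = ns ! i" using bij_betw_same_card by fastforce
    moreover have "{S \<in> F. i \<in> S} = (`) fst ` {p \<in> P. i \<in> fst ` p}" by (auto simp: F_def)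
    moreover have "inj_on ((`) fst) {p \<in> P. i \<in> fst ` p}" using inj by (rule inj_on_subset) auto
    ultimately show ?thesis by (simp add: card_image)
  qed
  ultimately show ?thesis using that by blast
qed

text \<open>The vertices of part \<open>i\<close> are labelled bijectively by the sets of
  \<open>F\<close> through \<open>i\<close>, and equally labelled vertices form a block. An
  automorphism preserving these blocks permutes the parts and preserves \<open>F\<close>; once this
  permutation is trivial, every vertex keeps its part and its block, which together determine
  it.\<close>

lemma distinguishing_partition_of_rigid_family:
  assumes rf: "rigid_family {..<length ns} F"
    and deg: "\<forall>i<length ns. card {S \<in> F. i \<in> S} = ns ! i"
    and pos: "\<forall>i<length ns. ns ! i > 0"
  shows "\<exists>P. distinguishing_partition (complete_multipartite ns) P"
proof -
  let ?V = "multipartite_verts ns"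
  have F: "F \<subseteq> Pow {..<length ns}" "{} \<notin> F" using rf by (auto simp: rigid_family_def)
  have "\<exists>\<phi>. bij_betw \<phi> {..<ns ! i} {S \<in> F. i \<in> S}" if "i < length ns" for i
  proof -
    have "finite F" using F finite_subset by blast
    then have "finite {S \<in> F. i \<in> S}" by simp
    with finite_same_card_bij[of "{..<ns ! i}" "{S \<in> F. i \<in> S}"] show ?thesis using deg that by simp
  qed
  then obtain \<phi> where \<phi>: "\<And>i. i < length ns \<Longrightarrow> bij_betw (\<phi> i) {..<ns ! i} {S \<in> F. i \<in> S}" by metis
  have \<phi>F: "\<phi> i a \<in> F \<and> i \<in> \<phi> i a" if "(i, a) \<in> ?V" for i a
    using \<phi>[of i] that by (auto simp: multipartite_verts_def bij_betw_def)
  have \<phi>_inj: "a = b" if "(i, a) \<in> ?V" "(i, b) \<in> ?V" "\<phi> i a = \<phi> i b" for i a b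
    using \<phi>[of i] that by (auto simp: multipartite_verts_def bij_betw_def inj_on_def)
  have \<phi>_surj: "\<exists>a. (i, a) \<in> ?V \<and> \<phi> i a = S" if "S \<in> F" "i \<in> S" for i S
  proof -
    have "i < length ns" using that F by auto
    moreover have "S \<in> \<phi> i ` {..<ns ! i}"
      using \<phi>[OF calculation] that by (simp add: bij_betw_def)
    ultimately show ?thesis by (auto simp: multipartite_verts_def)
  qed
  define bl where "bl S = {(i, a) \<in> ?V. \<phi> i a = S}" for S
  have fst_bl: "fst ` bl S = S" if "S \<in> F" for S
    using that \<phi>F \<phi>_surj unfolding bl_def by (force simp: image_iff)
  have "partition_on ?V (bl ` F)"
  proof (rule partition_onI)
    show "\<Union> (bl ` F) = ?V" using \<phi>F by (auto simp: bl_def)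
    show "{} \<notin> bl ` F" using fst_bl F by force
  qed (auto simp: bl_def disjnt_def)
  moreover have "\<gamma> = id" if \<gamma>: "\<gamma> \<in> aut (complete_multipartite ns)" "(`) \<gamma> ` bl ` F = bl ` F" for \<gamma>
  proof -
    have perm: "\<gamma> permutes ?V" and eq: "\<And>u v. u \<in> ?V \<Longrightarrow> v \<in> ?V \<Longrightarrow> fst (\<gamma> u) = fst (\<gamma> v) \<longleftrightarrow> fst u = fst v"
      using \<gamma> by (auto simp: aut_complete_multipartite_iff)
    have \<gamma>V: "\<gamma> u \<in> ?V" if "u \<in> ?V" for u using perm that by (simp add: permutes_in_image)
    \<comment> \<open>Automorphisms permute the parts, so any vertex of a part shows where the part
      goes; \<open>(i, 0)\<close> exists because no part is empty.\<close>
    define \<sigma> where "\<sigma> i = (if i < length ns then fst (\<gamma> (i, 0)) else i)" for i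
    have V0: "(i, 0) \<in> ?V" if "i < length ns" for i
      using pos that by (simp add: multipartite_verts_def)
    have ltV: "fst u < length ns" if "u \<in> ?V" for u using that by (auto simp: multipartite_verts_def)
    have \<sigma>: "fst (\<gamma> u) = \<sigma> (fst u)" if "u \<in> ?V" for u
      using eq[OF that V0[OF ltV[OF that]]] ltV[OF that] by (simp add: \<sigma>_def)
    have "\<sigma> permutes {..<length ns}"
    proof (rule bij_imp_permutes)
      have "inj_on \<sigma> {..<length ns}"
        using eq V0 by (auto simp: inj_on_def \<sigma>_def)
      moreover have "\<sigma> ` {..<length ns} \<subseteq> {..<length ns}"
        using ltV[OF \<gamma>V[OF V0]] by (auto simp: \<sigma>_def)
      ultimately show "bij_betw \<sigma> {..<length ns} {..<length ns}"
        by (simp add: bij_betw_def endo_inj_surj)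
    qed (simp add: \<sigma>_def)
    moreover have bl\<sigma>: "\<sigma> ` S \<in> F \<and> \<gamma> ` bl S = bl (\<sigma> ` S)" if "S \<in> F" for S
    proof -
      obtain S' where S': "S' \<in> F" "\<gamma> ` bl S = bl S'" using \<gamma>(2) \<open>S \<in> F\<close> by (metis imageE imageI)
      have "S' = fst ` \<gamma> ` bl S" using S' fst_bl by simp
      also have "\<dots> = \<sigma> ` fst ` bl S" unfolding image_image
        by (intro image_cong refl \<sigma>) (auto simp: bl_def)
      also have "\<dots> = \<sigma> ` S" using fst_bl that by simp
      finally show ?thesis using S' by simp
    qed
    moreover have "(`) \<sigma> ` F = F"
    proof (rule endo_inj_surj)
      show "finite F" using F finite_subset by blast
      show "(`) \<sigma> ` F \<subseteq> F" using bl\<sigma> by auto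
      have "inj \<sigma>" using \<open>\<sigma> permutes _\<close> by (rule permutes_inj)
      then show "inj_on ((`) \<sigma>) F" by (auto simp: inj_on_def inj_image_eq_iff)
    qed
    ultimately have id: "\<sigma> = id" using rf by (auto simp: rigid_family_def)
    show "\<gamma> = id"
    proof
      fix u show "\<gamma> u = id u"
      proof (cases "u \<in> ?V")
        case True
        obtain i a where u: "u = (i, a)" by force
        let ?S = "\<phi> i a"
        have "u \<in> bl ?S" using True by (simp add: u bl_def)
        then have "\<gamma> u \<in> bl ?S" using bl\<sigma>[of ?S] \<phi>F[of i a] True u id by auto
        moreover have "fst (\<gamma> u) = i" using \<sigma>[OF True] id u by simp
        ultimately show ?thesis using \<phi>_inj[of i] True u by (cases "\<gamma> u") (auto simp: bl_def)
      next
        case False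
        then show ?thesis using perm by (simp add: permutes_not_in)
      qed
    qed
  qed
  ultimately show ?thesis unfolding distinguishing_partition_def by auto
qed

section \<open>Large sets\<close>

definition large_sets :: "'b set \<Rightarrow> 'b set set" where
  "large_sets B = {T. T \<subseteq> B \<and> card B < 2 * card T}"

lemma finite_large_sets: "finite B \<Longrightarrow> finite (large_sets B)"
  by (rule finite_subset[of _ "Pow B"]) (auto simp: large_sets_def)

lemma card_subsets_le:
  assumes "finite B"
  shows "card {T. T \<subseteq> B \<and> card T \<le> j} = (\<Sum>i=0..j. card B choose i)"
proof -
  have "{T. T \<subseteq> B \<and> card T \<le> j} = (\<Union>i\<in>{0..j}. {T. T \<subseteq> B \<and> card T = i})" by auto
  also have "card \<dots> = (\<Sum>i=0..j. card {T. T \<subseteq> B \<and> card T = i})"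
    by (rule card_UN_disjoint) (use assms in auto)
  also have "\<dots> = (\<Sum>i=0..j. card B choose i)" using n_subsets[OF assms] by simp
  finally show ?thesis .
qed

lemma card_Diff_le_iff_large:
  assumes "finite B" "B \<noteq> {}" "T \<subseteq> B"
  shows "card (B - T) \<le> (card B - 1) div 2 \<longleftrightarrow> card B < 2 * card T"
proof -
  have "card T \<le> card B" "card B > 0" using assms by (auto simp: card_mono card_gt_0_iff)
  moreover have "card (B - T) = card B - card T"
    using assms by (simp add: card_Diff_subset finite_subset)
  ultimately show ?thesis by linarith
qed

text \<open>Complementation in \<open>B\<close> pairs the large sets with the sets of at most
  \<open>(card B - 1) div 2\<close> elements. In the critical case the sum is
  \<open>n1 - 2\<close>.\<close>

lemma card_large_sets:
  assumes "finite B" "B \<noteq> {}"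
  shows "card (large_sets B) = (\<Sum>i=0..(card B - 1) div 2. card B choose i)"
proof -
  have "bij_betw (\<lambda>T. B - T) (large_sets B) {T. T \<subseteq> B \<and> card T \<le> (card B - 1) div 2}"
  proof (rule bij_betw_byWitness[where f' = "\<lambda>T. B - T"])
    show "(\<lambda>T. B - T) ` large_sets B \<subseteq> {T. T \<subseteq> B \<and> card T \<le> (card B - 1) div 2}"
      using assms card_Diff_le_iff_large by (auto simp: large_sets_def)
    show "(\<lambda>T. B - T) ` {T. T \<subseteq> B \<and> card T \<le> (card B - 1) div 2} \<subseteq> large_sets B"
    proof (rule image_subsetI)
      fix T assume T: "T \<in> {T. T \<subseteq> B \<and> card T \<le> (card B - 1) div 2}"
      then have "B - (B - T) = T" by auto
      with T show "B - T \<in> large_sets B"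
        using assms card_Diff_le_iff_large[of B "B - T"] by (auto simp: large_sets_def)
    qed
  qed (auto simp: large_sets_def)
  then show ?thesis using card_subsets_le[OF assms(1)] bij_betw_same_card by fastforce
qed

text \<open>The complements of the large sets through \<open>b\<close> are the sets of at most
  \<open>(card B - 1) div 2\<close> elements that avoid \<open>b\<close>.\<close>

lemma card_large_sets_containing:
  assumes "finite B" "b \<in> B"
  shows "card {T \<in> large_sets B. b \<in> T} = (\<Sum>i=0..(card B - 1) div 2. (card B - 1) choose i)"
proof -
  have "bij_betw (\<lambda>T. B - T) {T \<in> large_sets B. b \<in> T} {T. T \<subseteq> B - {b} \<and> card T \<le> (card B - 1) div 2}"
  proof (rule bij_betw_byWitness[where f' = "\<lambda>T. B - T"])
    show "(\<lambda>T. B - T) ` {T \<in> large_sets B. b \<in> T} \<subseteq> {T. T \<subseteq> B - {b} \<and> card T \<le> (card B - 1) div 2}"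
      using assms card_Diff_le_iff_large by (auto simp: large_sets_def)
    show "(\<lambda>T. B - T) ` {T. T \<subseteq> B - {b} \<and> card T \<le> (card B - 1) div 2} \<subseteq> {T \<in> large_sets B. b \<in> T}"
    proof (rule image_subsetI)
      fix T assume T: "T \<in> {T. T \<subseteq> B - {b} \<and> card T \<le> (card B - 1) div 2}"
      then have "B - (B - T) = T" by auto
      with T show "B - T \<in> {T \<in> large_sets B. b \<in> T}"
        using assms card_Diff_le_iff_large[of B "B - T"] by (auto simp: large_sets_def)
    qed
  qed (auto simp: large_sets_def)
  then have "card {T \<in> large_sets B. b \<in> T} = (\<Sum>i=0..(card B - 1) div 2. card (B - {b}) choose i)"
    using card_subsets_le[of "B - {b}"] assms(1) bij_betw_same_card by fastforce
  then show ?thesis using assms by simp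
qed

lemma card_subsets_containing:
  assumes "finite B" "b \<in> B"
  shows "card {T. T \<subseteq> B \<and> b \<in> T} = 2 ^ (card B - 1)"
proof -
  have "bij_betw (insert b) (Pow (B - {b})) {T. T \<subseteq> B \<and> b \<in> T}"
    by (rule bij_betw_byWitness[where f' = "\<lambda>T. T - {b}"]) (use assms in auto)
  then have "card {T. T \<subseteq> B \<and> b \<in> T} = card (Pow (B - {b}))" using bij_betw_same_card by fastforce
  then show ?thesis using assms by (simp add: card_Pow)
qed

text \<open>Double counting of the incidences between \<open>G\<close> and \<open>B\<close>.\<close>

lemma sum_card_Int_eq:
  assumes "finite B" "finite G"
  shows "(\<Sum>S\<in>G. card (S \<inter> B)) = (\<Sum>b\<in>B. card {S \<in> G. b \<in> S})"
proof -
  have "(\<Sum>S\<in>G. card (S \<inter> B)) = (\<Sum>S\<in>G. \<Sum>b\<in>B. if b \<in> S then 1 else 0)"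
    using assms by (intro sum.cong) (simp_all add: sum.If_cases Int_commute)
  also have "\<dots> = (\<Sum>b\<in>B. \<Sum>S\<in>G. if b \<in> S then 1 else 0)" by (rule sum.swap)
  also have "\<dots> = (\<Sum>b\<in>B. card {S \<in> G. b \<in> S})"
    using assms by (intro sum.cong) (simp_all add: sum.If_cases Int_def)
  finally show ?thesis .
qed

lemma sum_card_eq:
  assumes "finite B" "G \<subseteq> Pow B"
  shows "(\<Sum>T\<in>G. card T) = (\<Sum>b\<in>B. card {T \<in> G. b \<in> T})"
proof -
  have "(\<Sum>T\<in>G. card T) = (\<Sum>T\<in>G. card (T \<inter> B))"
    using assms by (intro sum.cong) (auto simp: Int_absorb2)
  also have "\<dots> = (\<Sum>b\<in>B. card {T \<in> G. b \<in> T})"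
    using assms finite_subset by (intro sum_card_Int_eq) auto
  finally show ?thesis .
qed

lemma sum_card_large_sets:
  assumes "finite B"
  shows "(\<Sum>T\<in>large_sets B. card T) = card B * (\<Sum>i=0..(card B - 1) div 2. (card B - 1) choose i)"
proof -
  have "(\<Sum>T\<in>large_sets B. card T) = (\<Sum>b\<in>B. card {T \<in> large_sets B. b \<in> T})"
    using assms by (intro sum_card_eq) (auto simp: large_sets_def)
  then show ?thesis using assms by (simp add: card_large_sets_containing)
qed

lemma sum_card_Pow:
  assumes "finite B"
  shows "(\<Sum>T\<in>Pow B. card T) = card B * 2 ^ (card B - 1)"
proof -
  have "(\<Sum>T\<in>Pow B. card T) = (\<Sum>b\<in>B. card {T \<in> Pow B. b \<in> T})"
    using assms by (intro sum_card_eq) auto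
  then show ?thesis using assms by (simp add: card_subsets_containing)
qed

text \<open>The absorption identity
  \<open>(m2 - i) * (m2 choose i) = m2 * ((m2 - 1) choose i)\<close> turns the weighted sum into the
  number of large sets through a fixed element of an \<open>m2\<close>-element set; thus
  \<open>r\<close> is one more than this number.\<close>

lemma r_param_eq:
  assumes "m2 \<ge> 1"
  shows "r_param m2 ((m2 - 1) div 2) 0 = 1 + real (\<Sum>i=0..(m2 - 1) div 2. (m2 - 1) choose i)"
proof -
  have "(real m2 - real i) / real m2 * real (m2 choose i) = real ((m2 - 1) choose i)"
    if "i \<le> (m2 - 1) div 2" for i
  proof -
    have i: "i < m2" using that assms by linarith
    have "(m2 - i) * (m2 choose i) = m2 * ((m2 - 1) choose i)"
      using binomial_absorb_comp[of m2 i] by simp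
    then have "real (m2 - i) * real (m2 choose i) = real m2 * real ((m2 - 1) choose i)"
      by (metis of_nat_mult)
    then show ?thesis using i by (simp add: field_simps of_nat_diff)
  qed
  then have "(\<Sum>i=0..(m2 - 1) div 2. (real m2 - real i) / real m2 * real (m2 choose i)) =
    (\<Sum>i=0..(m2 - 1) div 2. real ((m2 - 1) choose i))" by (intro sum.cong) auto
  then show ?thesis by (simp add: r_param_def)
qed

section \<open>Pairs of involutions\<close>

text \<open>An abstract graph of maximum degree two: the elements of \<open>D\<close> are its
  half-edges, \<open>\<alpha>\<close> exchanges the two half-edges at a point and
  \<open>\<beta>\<close> those of an edge. Fixed points of \<open>\<beta>\<close> are loose ends, so
  the components are paths between two loose ends and cycles. The involution laws hold on the whole
  type, which makes them unconditional simp rules.\<close>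

locale involution_pair =
  fixes D :: "'d set" and \<alpha> \<beta> :: "'d \<Rightarrow> 'd"
  assumes finite_D: "finite D"
    and \<alpha>_in: "d \<in> D \<Longrightarrow> \<alpha> d \<in> D" and \<beta>_in: "d \<in> D \<Longrightarrow> \<beta> d \<in> D"
    and \<alpha>_invol [simp]: "\<alpha> (\<alpha> d) = d" and \<beta>_invol [simp]: "\<beta> (\<beta> d) = d"
    and \<alpha>_no_fix: "d \<in> D \<Longrightarrow> \<alpha> d \<noteq> d"
begin

definition rot :: "'d \<Rightarrow> 'd" where "rot d = \<alpha> (\<beta> d)"

lemma rot_in: "d \<in> D \<Longrightarrow> rot d \<in> D"
  by (simp add: rot_def \<alpha>_in \<beta>_in)

lemma funpow_rot_in: "d \<in> D \<Longrightarrow> (rot ^^ i) d \<in> D"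
  by (induction i) (auto simp: rot_in)

lemma inj_funpow_rot: "inj (rot ^^ i)"
proof (rule inj_fn)
  show "inj rot" unfolding rot_def by (rule injI) (metis \<alpha>_invol \<beta>_invol)
qed

lemma funpow_rot_eq_iff [simp]: "(rot ^^ i) x = (rot ^^ i) y \<longleftrightarrow> x = y"
  using inj_funpow_rot by (auto dest: injD)

text \<open>The dihedral relation: an involution conjugates \<open>rot\<close> to its
  inverse.\<close>

lemma rot_\<alpha>_rot [simp]: "(rot ^^ i) (\<alpha> ((rot ^^ i) d)) = \<alpha> d"
proof (induction i)
  case (Suc i)
  have "(rot ^^ Suc i) (\<alpha> ((rot ^^ Suc i) d)) = (rot ^^ i) (rot (\<alpha> (rot ((rot ^^ i) d))))"
    by (simp add: funpow_swap1)
  also have "\<dots> = (rot ^^ i) (\<alpha> ((rot ^^ i) d))" by (simp add: rot_def)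
  finally show ?case using Suc by simp
qed simp

lemma rot_\<beta>_rot [simp]: "(rot ^^ i) (\<beta> ((rot ^^ i) d)) = \<beta> d"
proof (induction i)
  case (Suc i)
  have "(rot ^^ Suc i) (\<beta> ((rot ^^ Suc i) d)) = (rot ^^ i) (rot (\<beta> (rot ((rot ^^ i) d))))"
    by (simp add: funpow_swap1)
  also have "\<dots> = (rot ^^ i) (\<beta> ((rot ^^ i) d))" by (simp add: rot_def)
  finally show ?case using Suc by simp
qed simp

text \<open>Comparing two forward iterates avoids the inverse of \<open>rot\<close>; as
  \<open>rot\<close> is bijective, this is the orbit relation of all its integer powers.\<close>

definition orbit_eq :: "'d \<Rightarrow> 'd \<Rightarrow> bool" where
  "orbit_eq x y \<longleftrightarrow> (\<exists>i j. (rot ^^ i) x = (rot ^^ j) y)"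

lemma orbit_eq_refl [simp]: "orbit_eq x x"
  by (auto simp: orbit_eq_def)

lemma orbit_eq_rot_iff [simp]: "orbit_eq (rot x) y \<longleftrightarrow> orbit_eq x y"
proof
  assume "orbit_eq (rot x) y"
  then obtain i j where "(rot ^^ i) (rot x) = (rot ^^ j) y" by (auto simp: orbit_eq_def)
  then have "(rot ^^ Suc i) x = (rot ^^ j) y" by (simp add: funpow_swap1)
  then show "orbit_eq x y" unfolding orbit_eq_def by blast
next
  assume "orbit_eq x y"
  then obtain i j where ij: "(rot ^^ i) x = (rot ^^ j) y" by (auto simp: orbit_eq_def)
  have "(rot ^^ i) (rot x) = rot ((rot ^^ i) x)" by (simp add: funpow_swap1)
  also have "\<dots> = (rot ^^ Suc j) y" by (simp add: ij)
  finally show "orbit_eq (rot x) y" unfolding orbit_eq_def by blast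
qed

text \<open>A loose end \<open>e\<close> satisfies \<open>rot e = \<alpha> e\<close>, so the
  reflection \<open>\<alpha>\<close> maps the orbit of \<open>e\<close> to itself.\<close>

lemma orbit_eq_\<alpha>_of_fixed:
  assumes "\<beta> e = e" "orbit_eq x e"
  shows "orbit_eq (\<alpha> x) e"
proof -
  obtain i j where ij: "(rot ^^ i) x = (rot ^^ j) e" using assms by (auto simp: orbit_eq_def)
  have "(rot ^^ j) (\<alpha> x) = (rot ^^ j) ((rot ^^ i) (\<alpha> ((rot ^^ i) x)))" by simp
  also have "\<dots> = (rot ^^ i) ((rot ^^ j) (\<alpha> ((rot ^^ j) e)))"
    unfolding ij by (metis comp_apply funpow_add add.commute)
  also have "\<dots> = (rot ^^ Suc i) e" using assms(1) by (simp add: rot_def funpow_swap1)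
  finally show ?thesis unfolding orbit_eq_def by blast
qed

lemma orbit_eq_\<beta>_of_fixed:
  assumes "\<beta> e = e" "orbit_eq x e"
  shows "orbit_eq (\<beta> x) e"
proof -
  have "orbit_eq (\<alpha> (rot x)) e" using assms by (intro orbit_eq_\<alpha>_of_fixed) auto
  then show ?thesis by (simp add: rot_def)
qed

section \<open>Periods and half turns\<close>

definition period :: "'d \<Rightarrow> nat" where
  "period d = (LEAST n. 0 < n \<and> (rot ^^ n) d = d)"

text \<open>By the pigeonhole principle two iterates agree, and injectivity of \<open>rot\<close>
  cancels their common power.\<close>

lemma period:
  assumes "d \<in> D"
  shows "0 < period d" "(rot ^^ period d) d = d"
proof -
  have "\<not> inj_on (\<lambda>i. (rot ^^ i) d) UNIV"
  proof
    assume "inj_on (\<lambda>i. (rot ^^ i) d) UNIV"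
    moreover have "finite ((\<lambda>i. (rot ^^ i) d) ` UNIV)"
      using funpow_rot_in[OF assms] finite_D by (intro finite_subset[OF _ finite_D]) auto
    ultimately show False using finite_imageD infinite_UNIV_nat by blast
  qed
  then obtain i j where ij: "i < j" "(rot ^^ i) d = (rot ^^ j) d"
    unfolding inj_on_def by (metis linorder_neqE_nat)
  have "(rot ^^ j) d = (rot ^^ (i + (j - i))) d" using ij by simp
  also have "\<dots> = (rot ^^ i) ((rot ^^ (j - i)) d)" by (simp only: funpow_add comp_apply)
  finally have "(rot ^^ (j - i)) d = d" using ij by simp
  then have "\<exists>n. 0 < n \<and> (rot ^^ n) d = d" using ij by (intro exI[of _ "j - i"]) auto
  then show "0 < period d" "(rot ^^ period d) d = d"
    unfolding period_def by (metis (mono_tags, lifting) LeastI_ex)+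
qed

lemma period_le: "0 < n \<Longrightarrow> (rot ^^ n) d = d \<Longrightarrow> period d \<le> n"
  unfolding period_def by (rule Least_le) simp

lemma funpow_period_mult:
  assumes "d \<in> D" shows "(rot ^^ (k * period d)) d = d"
  by (induction k) (simp_all add: funpow_add period assms)

lemma period_dvd:
  assumes "d \<in> D" "(rot ^^ n) d = d" shows "period d dvd n"
proof -
  have "(rot ^^ n) d = (rot ^^ (n mod period d + n div period d * period d)) d" by simp
  also have "\<dots> = (rot ^^ (n mod period d)) d"
    by (simp only: funpow_add comp_apply funpow_period_mult[OF assms(1)])
  finally have "(rot ^^ (n mod period d)) d = d" using assms by simp
  moreover have "n mod period d < period d" using period[OF assms(1)] by simp
  ultimately have "n mod period d = 0" using period_le[of "n mod period d" d] by linarith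
  then show ?thesis by auto
qed

lemma period_\<alpha>: "period (\<alpha> d) = period d"
proof -
  have "(rot ^^ n) (\<alpha> d) = \<alpha> d" if "(rot ^^ n) d = d" for n d using rot_\<alpha>_rot[of n d] that by simp
  then have "(rot ^^ n) (\<alpha> d) = \<alpha> d \<longleftrightarrow> (rot ^^ n) d = d" for n by (metis \<alpha>_invol)
  then show ?thesis by (simp add: period_def)
qed

lemma period_\<beta>: "period (\<beta> d) = period d"
proof -
  have "(rot ^^ n) (\<beta> d) = \<beta> d" if "(rot ^^ n) d = d" for n d using rot_\<beta>_rot[of n d] that by simp
  then have "(rot ^^ n) (\<beta> d) = \<beta> d \<longleftrightarrow> (rot ^^ n) d = d" for n by (metis \<beta>_invol)
  then show ?thesis by (simp add: period_def)
qed

lemma period_funpow_rot: "period ((rot ^^ i) d) = period d"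
  by (induction i) (simp_all add: rot_def period_\<alpha> period_\<beta>)

text \<open>On an orbit of even length the shift by half the period is its own inverse, which makes
  it commute with both involutions. On the orbit of a loose end it reverses the path. Orbits of odd
  length, which contain no loose end, stay pointwise fixed.\<close>

definition half_turn :: "'d \<Rightarrow> 'd" where
  "half_turn d = (if even (period d) then (rot ^^ (period d div 2)) d else d)"

lemma half_turn_in: "d \<in> D \<Longrightarrow> half_turn d \<in> D"
  by (simp add: half_turn_def funpow_rot_in)

lemma funpow_half_period:
  assumes "d \<in> D" "even (period d)"
  shows "(rot ^^ (period d div 2)) ((rot ^^ (period d div 2)) d) = d"
  using period(2)[OF assms(1)] assms(2)
  by (metis comp_apply dvd_mult_div_cancel funpow_add mult_2)

lemma half_turn_half_turn: "d \<in> D \<Longrightarrow> half_turn (half_turn d) = d"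
  using funpow_half_period[of d] by (auto simp: half_turn_def period_funpow_rot)

lemma half_turn_\<alpha>:
  assumes "d \<in> D" shows "half_turn (\<alpha> d) = \<alpha> (half_turn d)"
proof (cases "even (period d)")
  case True
  let ?n = "period d div 2"
  have "(rot ^^ ?n) (\<alpha> ((rot ^^ ?n) ((rot ^^ ?n) d))) = \<alpha> ((rot ^^ ?n) d)" by (rule rot_\<alpha>_rot)
  then show ?thesis
    using True by (simp add: half_turn_def period_\<alpha> funpow_half_period[OF assms])
qed (simp add: half_turn_def period_\<alpha>)

lemma half_turn_\<beta>:
  assumes "d \<in> D" shows "half_turn (\<beta> d) = \<beta> (half_turn d)"
proof (cases "even (period d)")
  case True
  let ?n = "period d div 2"
  have "(rot ^^ ?n) (\<beta> ((rot ^^ ?n) ((rot ^^ ?n) d))) = \<beta> ((rot ^^ ?n) d)" by (rule rot_\<beta>_rot)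
  then show ?thesis
    using True by (simp add: half_turn_def period_\<beta> funpow_half_period[OF assms])
qed (simp add: half_turn_def period_\<beta>)

lemma orbit_eq_half_turn_iff [simp]: "orbit_eq (half_turn x) y \<longleftrightarrow> orbit_eq x y"
proof -
  have "orbit_eq ((rot ^^ i) x) y \<longleftrightarrow> orbit_eq x y" for i by (induction i) simp_all
  then show ?thesis by (simp add: half_turn_def)
qed

lemma even_period_of_fixed:
  assumes "e \<in> D" "\<beta> e = e"
  shows "even (period e)"
proof (rule ccontr)
  assume "odd (period e)"
  then obtain k where k: "period e = 2 * k + 1" by (rule oddE)
  \<comment> \<open>With period \<open>2 * k + 1\<close>, the reflection of the orbit by
    \<open>\<alpha>\<close> would fix this iterate, contrary to
    \<open>\<alpha>_no_fix\<close>.\<close>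
  let ?x = "(rot ^^ (k + 1)) e"
  have "(rot ^^ (k + 1)) (\<alpha> ?x) = \<alpha> e" by (rule rot_\<alpha>_rot)
  also have "\<dots> = rot e" using assms by (simp add: rot_def)
  also have "\<dots> = rot ((rot ^^ period e) e)" using period assms by simp
  also have "\<dots> = (rot ^^ ((k + 1) + (k + 1))) e" by (simp add: k flip: mult_2)
  also have "\<dots> = (rot ^^ (k + 1)) ?x" by (simp only: funpow_add comp_apply)
  finally have "\<alpha> ?x = ?x" by (simp only: funpow_rot_eq_iff)
  then show False using \<alpha>_no_fix[of ?x] funpow_rot_in assms by blast
qed

lemma half_turn_of_fixed_neq:
  assumes "e \<in> D" "\<beta> e = e"
  shows "half_turn e \<noteq> e"
proof
  assume "half_turn e = e"
  then have "(rot ^^ (period e div 2)) e = e"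
    using even_period_of_fixed[OF assms] by (simp add: half_turn_def)
  moreover have "0 < period e div 2" "period e div 2 < period e"
    using even_period_of_fixed[OF assms] period(1)[OF assms(1)] by (auto elim: evenE)
  ultimately show False using period_le[of "period e div 2" e] by linarith
qed

text \<open>If \<open>x = (rot ^^ m) e\<close> is a loose end as well, then applying
  \<open>\<beta>\<close> gives \<open>(rot ^^ (m + m)) e = e\<close>, so \<open>m\<close> is a
  multiple of half the period. The two values are the two ends of a path.\<close>

lemma fixed_in_orbit_of_fixed:
  assumes "e \<in> D" "\<beta> e = e" "x \<in> D" "\<beta> x = x" "orbit_eq x e"
  shows "x = e \<or> x = half_turn e"
proof -
  obtain i j where ij: "(rot ^^ i) x = (rot ^^ j) e" using assms by (auto simp: orbit_eq_def)
  \<comment> \<open>Since \<open>i * period x\<close> rotations bring \<open>x\<close> back,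
    \<open>i * period x - i\<close> further ones undo the first \<open>i\<close>.\<close>
  define m where "m = i * period x - i + j"
  have "i \<le> i * period x" using period(1)[OF assms(3)] by simp
  then have "x = (rot ^^ (i * period x - i + i)) x"
    using funpow_period_mult[OF assms(3), of i] by simp
  also have "\<dots> = (rot ^^ (i * period x - i)) ((rot ^^ i) x)" by (simp only: funpow_add comp_apply)
  also have "\<dots> = (rot ^^ m) e" unfolding ij m_def by (simp only: funpow_add comp_apply)
  finally have m: "x = (rot ^^ m) e" .
  have "(rot ^^ (m + m)) e = (rot ^^ m) (\<beta> x)" using assms(4) by (simp add: m funpow_add)
  also have "\<dots> = e" using assms(2) by (simp add: m)
  finally have "period e dvd m + m" using period_dvd assms(1) by blast
  then have "period e div 2 dvd m" using even_period_of_fixed[OF assms(1,2)]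
    by (metis dvd_mult_cancel_left dvd_mult_div_cancel mult_2 zero_neq_numeral dvd_times_left_cancel_iff)
  then obtain t where t: "m = t * (period e div 2)" by (metis dvd_def mult.commute)
  show ?thesis
  proof (cases "even t")
    case True
    then obtain s where "t = 2 * s" by (rule evenE)
    then have "m = s * period e" using t even_period_of_fixed[OF assms(1,2)] by auto
    then show ?thesis using m funpow_period_mult assms(1) by simp
  next
    case False
    then obtain s where "t = 2 * s + 1" by (rule oddE)
    then have "m = period e div 2 + s * period e"
      using t even_period_of_fixed[OF assms(1,2)] by (auto simp: algebra_simps elim!: evenE)
    then have "x = (rot ^^ (period e div 2)) e"
      using m funpow_period_mult[OF assms(1)] by (simp add: funpow_add)
    then show ?thesis using even_period_of_fixed[OF assms(1,2)] by (simp add: half_turn_def)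
  qed
qed

section \<open>Maps that commute with both involutions\<close>

definition equivariant :: "('d \<Rightarrow> 'd) \<Rightarrow> bool" where
  "equivariant f \<longleftrightarrow> f ` D \<subseteq> D \<and> inj_on f D \<and> (\<forall>d\<in>D. f (\<alpha> d) = \<alpha> (f d) \<and> f (\<beta> d) = \<beta> (f d))"

lemma equivariant_half_turn: "equivariant half_turn"
  unfolding equivariant_def
  using half_turn_in half_turn_half_turn half_turn_\<alpha> half_turn_\<beta> by (auto intro: inj_on_inverseI)

text \<open>This reverses a single path and leaves everything else alone, which is possible because
  the orbit of a loose end is closed under both involutions.\<close>

lemma equivariant_half_turn_on_orbit:
  assumes "\<beta> e = e"
  shows "equivariant (\<lambda>d. if orbit_eq d e then half_turn d else d)"
proof -
  have "orbit_eq (\<alpha> d) e \<longleftrightarrow> orbit_eq d e" "orbit_eq (\<beta> d) e \<longleftrightarrow> orbit_eq d e" for d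
    using orbit_eq_\<alpha>_of_fixed[OF assms] orbit_eq_\<beta>_of_fixed[OF assms] by (metis \<alpha>_invol \<beta>_invol)+
  then show ?thesis unfolding equivariant_def
    using half_turn_in half_turn_half_turn half_turn_\<alpha> half_turn_\<beta>
    by (auto intro!: inj_on_inverseI[of _ "\<lambda>d. if orbit_eq d e then half_turn d else d"])
qed

text \<open>Without fixed points of \<^term>\<open>\<beta>\<close>, the map \<^term>\<open>\<alpha>\<close> exchanges two different orbits of
  \<^term>\<open>rot\<close> of the same component; these are rotated in opposite directions.\<close>

lemma equivariant_rotation:
  assumes \<beta>_no_fix: "\<And>d. d \<in> D \<Longrightarrow> \<beta> d \<noteq> d" and d0: "d0 \<in> D"
  obtains f where "equivariant f" "f d0 = rot d0"
proof -
  \<comment> \<open>Otherwise some iterate of \<open>d\<close> would be a fixed point, of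
    \<open>\<alpha>\<close> if \<open>k\<close> is even and of \<open>\<beta>\<close> if
    \<open>k\<close> is odd.\<close>
  have 1: "(rot ^^ k) d \<noteq> \<alpha> d" if "d \<in> D" for k d
  proof
    assume k: "(rot ^^ k) d = \<alpha> d"
    show False
    proof (cases "even k")
      case True
      then obtain i where i: "k = i + i" by (metis evenE mult_2)
      have "(rot ^^ i) (\<alpha> ((rot ^^ i) d)) = (rot ^^ i) ((rot ^^ i) d)"
        using k i by (simp add: funpow_add)
      then have "\<alpha> ((rot ^^ i) d) = (rot ^^ i) d" by (simp only: funpow_rot_eq_iff)
      then show False using \<alpha>_no_fix funpow_rot_in that by blast
    next
      case False
      then obtain i where i: "k = Suc (i + i)" by (metis oddE mult_2 Suc_eq_plus1)
      have "rot (\<beta> d) = rot ((rot ^^ (i + i)) d)" using k i by (simp add: rot_def)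
      then have "\<beta> d = (rot ^^ (i + i)) d" using funpow_rot_eq_iff[of 1] by simp
      then have "(rot ^^ i) (\<beta> ((rot ^^ i) d)) = (rot ^^ i) ((rot ^^ i) d)"
        by (simp add: funpow_add)
      then have "\<beta> ((rot ^^ i) d) = (rot ^^ i) d" by (simp only: funpow_rot_eq_iff)
      then show False using \<beta>_no_fix funpow_rot_in that by blast
    qed
  qed
  have 2: "(rot ^^ a) d \<noteq> (rot ^^ b) (\<alpha> d)" if "d \<in> D" for a b d
  proof
    assume ab: "(rot ^^ a) d = (rot ^^ b) (\<alpha> d)"
    show False
    proof (cases "b \<le> a")
      case True
      then have "(rot ^^ b) ((rot ^^ (a - b)) d) = (rot ^^ b) (\<alpha> d)"
        using ab by (metis comp_apply funpow_add le_add_diff_inverse)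
      then show False using 1 that by simp
    next
      case False
      then have "(rot ^^ a) ((rot ^^ (b - a)) (\<alpha> d)) = (rot ^^ a) d"
        using ab by (metis comp_apply funpow_add le_add_diff_inverse nat_le_linear)
      then show False using 1[of "\<alpha> d" "b - a"] that \<alpha>_in by simp
    qed
  qed
  define O1 where "O1 = {d \<in> D. orbit_eq d d0}"
  have disj: "\<alpha> d \<notin> O1" if dO: "d \<in> O1" for d
  proof
    assume "\<alpha> d \<in> O1"
    then obtain k l where "(rot ^^ k) (\<alpha> d) = (rot ^^ l) d0" by (auto simp: O1_def orbit_eq_def)
    moreover obtain i j where "(rot ^^ i) d = (rot ^^ j) d0"
      using dO by (auto simp: O1_def orbit_eq_def)
    moreover have "(rot ^^ l) ((rot ^^ j) d0) = (rot ^^ j) ((rot ^^ l) d0)"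
      by (simp flip: funpow_add add: add.commute o_apply[of "rot ^^ _" "rot ^^ _", symmetric] del: o_apply)
    ultimately have "(rot ^^ l) ((rot ^^ i) d) = (rot ^^ j) ((rot ^^ k) (\<alpha> d))" by simp
    then have "(rot ^^ (l + i)) d = (rot ^^ (j + k)) (\<alpha> d)" by (simp add: funpow_add)
    then show False using 2 dO by (auto simp: O1_def)
  qed
  have rotO: "rot d \<in> O1 \<longleftrightarrow> d \<in> O1" for d
  proof -
    have "rot d \<in> D \<longleftrightarrow> d \<in> D" unfolding rot_def by (metis \<alpha>_in \<alpha>_invol \<beta>_in \<beta>_invol)
    then show ?thesis by (auto simp: O1_def)
  qed
  define f where "f d = (if d \<in> O1 then \<alpha> (\<beta> d) else if \<alpha> d \<in> O1 then \<beta> (\<alpha> d) else d)" for d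
  have \<beta>1: "\<beta> d \<in> O1 \<longleftrightarrow> \<alpha> d \<in> O1" for d using rotO[of "\<beta> d"] by (simp add: rot_def)
  have \<beta>2: "\<alpha> (\<beta> d) \<in> O1 \<longleftrightarrow> d \<in> O1" for d using rotO[of d] by (simp add: rot_def)
  have "equivariant f"
    unfolding equivariant_def
  proof (intro conjI ballI)
    show "f ` D \<subseteq> D" by (auto simp: f_def \<alpha>_in \<beta>_in)
    have f1: "f d \<in> O1 \<longleftrightarrow> d \<in> O1" and f2: "\<alpha> (f d) \<in> O1 \<longleftrightarrow> \<alpha> d \<in> O1" for d
      using \<beta>1 \<beta>2 disj by (auto simp: f_def)
    show "inj_on f D"
    proof (rule inj_onI)
      fix x y assume "f x = f y"
      then show "x = y" using f1[of x] f1[of y] f2[of x] f2[of y]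
        by (auto simp: f_def split: if_splits) (metis \<alpha>_invol \<beta>_invol)+
    qed
    show "f (\<alpha> d) = \<alpha> (f d)" "f (\<beta> d) = \<beta> (f d)" for d using disj \<beta>1 \<beta>2 by (auto simp: f_def)
  qed
  moreover have "f d0 = rot d0" using d0 by (simp add: f_def O1_def rot_def)
  ultimately show thesis using that by blast
qed

end

section \<open>The upper bound\<close>

lemma card_2_other:
  assumes "card X = 2" "x \<in> X"
  obtains y where "X = {x, y}" "y \<noteq> x"
proof -
  obtain u v where "X = {u, v}" "u \<noteq> v" using assms(1) by (auto simp: card_2_iff)
  then show thesis using that[of u] that[of v] assms(2) by (cases "x = u") auto
qed

text \<open>The degree conditions from which the double count starts: \<open>A\<close> stands for
  the parts of size \<open>n1\<close>, at its critical value, and \<open>B\<close> for those of size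
  \<open>n2\<close>. Rigidity enters later, in the case of equality.\<close>

locale extremal_family =
  fixes A B :: "'i set" and F :: "'i set set" and n2 :: nat
  assumes finite_A: "finite A" and finite_B: "finite B" and disj: "A \<inter> B = {}" and B_ne: "B \<noteq> {}"
    and F_sub: "F \<subseteq> Pow (A \<union> B) - {{}}"
    and deg_A: "a \<in> A \<Longrightarrow> card {S \<in> F. a \<in> S} = 2 + card (large_sets B)"
    and deg_B: "b \<in> B \<Longrightarrow> card {S \<in> F. b \<in> S} = n2"
begin

text \<open>In the double count of the incidences with \<^term>\<open>B\<close>, a set that meets \<^term>\<open>A\<close> distributes
  its elements of \<^term>\<open>B\<close> evenly among its elements of \<^term>\<open>A\<close>. Only sets \<^term>\<open>insert a T\<close> with
  \<^term>\<open>T\<close> large contribute more than \<^term>\<open>card B / 2\<close> to the share of \<^term>\<open>a\<close>.\<close>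

definition weight :: "'i set \<Rightarrow> real" where
  "weight S = real (card (S \<inter> B)) / real (card (S \<inter> A))"

definition bonus :: "'i \<Rightarrow> 'i set \<Rightarrow> real" where
  "bonus a S = (if S \<inter> A = {a} \<and> S \<inter> B \<in> large_sets B then real (card (S \<inter> B)) - card B / 2 else 0)"

lemma finite_F: "finite F"
  using F_sub finite_A finite_B by (auto intro: finite_subset[of F "Pow (A \<union> B)"])

lemma F_eq_Un: "S \<in> F \<Longrightarrow> S = (S \<inter> A) \<union> (S \<inter> B)"
  using F_sub by auto

lemma weight_le:
  assumes "a \<in> A" "a \<in> S"
  shows "weight S \<le> card B / 2 + bonus a S"
proof -
  have le: "card (S \<inter> B) \<le> card B" using finite_B by (simp add: card_mono)
  have pos: "card (S \<inter> A) > 0" using assms finite_A by (auto simp: card_gt_0_iff)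
  show ?thesis
  proof (cases "S \<inter> A = {a}")
    case True
    then show ?thesis using le by (auto simp: weight_def bonus_def large_sets_def)
  next
    case False
    then have "card (S \<inter> A) \<noteq> 1" using assms by (metis IntI card_1_singletonE singletonD)
    then have "card (S \<inter> A) \<ge> 2" using pos by linarith
    then have "weight S \<le> card (S \<inter> B) / 2"
      unfolding weight_def by (intro divide_left_mono) auto
    then show ?thesis using False le by (simp add: bonus_def)
  qed
qed

text \<open>A set that meets \<open>A\<close> in \<open>a\<close> alone is determined by its trace
  on \<open>B\<close>, so each large set yields its bonus at most once.\<close>

lemma sum_bonus:
  "(\<Sum>S | S \<in> F \<and> a \<in> S. bonus a S) =
    (\<Sum>T\<in>(\<lambda>S. S \<inter> B) ` {S \<in> F. S \<inter> A = {a} \<and> S \<inter> B \<in> large_sets B}. real (card T) - card B / 2)"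
proof -
  let ?G = "{S \<in> F. S \<inter> A = {a} \<and> S \<inter> B \<in> large_sets B}"
  have "(\<Sum>S | S \<in> F \<and> a \<in> S. bonus a S) = (\<Sum>S\<in>?G. bonus a S)"
    by (rule sum.mono_neutral_right) (auto simp: finite_F bonus_def)
  also have "\<dots> = (\<Sum>S\<in>?G. real (card (S \<inter> B)) - card B / 2)"
    by (intro sum.cong) (auto simp: bonus_def)
  also have "\<dots> = (\<Sum>T\<in>(\<lambda>S. S \<inter> B) ` ?G. real (card T) - card B / 2)"
  proof (subst sum.reindex)
    show "inj_on (\<lambda>S. S \<inter> B) ?G"
    proof (rule inj_onI)
      fix S S' assume "S \<in> ?G" "S' \<in> ?G" "S \<inter> B = S' \<inter> B"
      then show "S = S'" using F_eq_Un[of S] F_eq_Un[of S'] by simp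
    qed
  qed simp
  finally show ?thesis .
qed

lemma sum_bonus_le:
  "(\<Sum>S | S \<in> F \<and> a \<in> S. bonus a S) \<le> (\<Sum>T\<in>large_sets B. real (card T) - card B / 2)"
  unfolding sum_bonus
  by (rule sum_mono2) (auto simp: finite_large_sets finite_B large_sets_def)

text \<open>Each of the \<open>2 + card (large_sets B)\<close> sets through \<open>a\<close> gives
  at most \<open>card B / 2\<close> and its bonus, and the bonuses raise this to the full sizes of
  the large sets. The second claim records that equality in total forces equality for every single
  set and in the sum of the bonuses.\<close>

lemma sum_weight_le:
  assumes "a \<in> A"
  shows "(\<Sum>S | S \<in> F \<and> a \<in> S. weight S) \<le> real (card B + (\<Sum>T\<in>large_sets B. card T))" (is "?l \<le> ?r")
    and "(\<Sum>S | S \<in> F \<and> a \<in> S. weight S) = real (card B + (\<Sum>T\<in>large_sets B. card T)) \<Longrightarrow>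
      (\<forall>S\<in>F. a \<in> S \<longrightarrow> weight S = card B / 2 + bonus a S) \<and>
      (\<Sum>S | S \<in> F \<and> a \<in> S. bonus a S) = (\<Sum>T\<in>large_sets B. real (card T) - card B / 2)"
proof -
  let ?m = "\<Sum>S | S \<in> F \<and> a \<in> S. card B / 2 + bonus a S"
  have 1: "?l \<le> ?m" using weight_le[OF assms] by (intro sum_mono) auto
  have m: "?m = (2 + real (card (large_sets B))) * (card B / 2) + (\<Sum>S | S \<in> F \<and> a \<in> S. bonus a S)"
    using deg_A[OF assms] by (simp add: sum.distrib)
  have r: "?r = (2 + real (card (large_sets B))) * (card B / 2) +
      (\<Sum>T\<in>large_sets B. real (card T) - card B / 2)"
    by (simp add: sum_subtractf algebra_simps)
  show "?l \<le> ?r" using 1 m r sum_bonus_le[of a] by linarith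
  assume eq: "?l = ?r"
  then have "?l = ?m" and 2: "(\<Sum>S | S \<in> F \<and> a \<in> S. bonus a S) = (\<Sum>T\<in>large_sets B. real (card T) - card B / 2)"
    using 1 m r sum_bonus_le[of a] by linarith+
  then have "weight S = card B / 2 + bonus a S" if "S \<in> F" "a \<in> S" for S
    using sum_mono_inv[of weight "{S \<in> F. a \<in> S}" "\<lambda>S. card B / 2 + bonus a S" S]
      weight_le[OF assms] that finite_F by auto
  with 2 show "(\<forall>S\<in>F. a \<in> S \<longrightarrow> weight S = card B / 2 + bonus a S) \<and>
      (\<Sum>S | S \<in> F \<and> a \<in> S. bonus a S) = (\<Sum>T\<in>large_sets B. real (card T) - card B / 2)" by blast
qed

text \<open>A set that meets \<open>A\<close> gives out \<open>card (S \<inter> A)\<close> equal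
  shares, which add up to \<open>card (S \<inter> B)\<close>; a set inside \<open>B\<close> has no
  recipient and is counted by its size.\<close>

lemma incidences_eq:
  "real (card B * n2) = real (\<Sum>S | S \<in> F \<and> S \<inter> A = {}. card S) + (\<Sum>a\<in>A. \<Sum>S | S \<in> F \<and> a \<in> S. weight S)"
proof -
  have "card B * n2 = (\<Sum>S\<in>F. card (S \<inter> B))"
    using deg_B by (simp add: sum_card_Int_eq finite_B finite_F)
  also have "real \<dots> = (\<Sum>S\<in>F. (if S \<inter> A = {} then real (card S) else 0) + (\<Sum>a\<in>A. if a \<in> S then weight S else 0))"
    unfolding of_nat_sum
  proof (rule sum.cong)
    fix S :: "'i set" assume S: "S \<in> F"
    have "(\<Sum>a\<in>A. if a \<in> S then weight S else 0) = real (card (S \<inter> A)) * weight S"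
      using finite_A by (simp add: sum.If_cases Int_commute)
    moreover have "card (S \<inter> A) = 0 \<longleftrightarrow> S \<inter> A = {}" using finite_A by simp
    moreover have "S \<inter> A = {} \<Longrightarrow> S \<inter> B = S" using F_eq_Un[OF S] by auto
    ultimately show "real (card (S \<inter> B)) =
        (if S \<inter> A = {} then real (card S) else 0) + (\<Sum>a\<in>A. if a \<in> S then weight S else 0)"
      by (cases "S \<inter> A = {}") (simp_all add: weight_def)
  qed simp
  also have "\<dots> = (\<Sum>S\<in>F. if S \<inter> A = {} then real (card S) else 0) + (\<Sum>S\<in>F. \<Sum>a\<in>A. if a \<in> S then weight S else 0)"
    by (rule sum.distrib)
  also have "(\<Sum>S\<in>F. \<Sum>a\<in>A. if a \<in> S then weight S else 0) = (\<Sum>a\<in>A. \<Sum>S\<in>F. if a \<in> S then weight S else 0)"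
    by (rule sum.swap)
  finally show ?thesis using finite_F by (simp add: sum.If_cases Int_def conj_commute)
qed

lemma sum_isolated_le: "(\<Sum>S | S \<in> F \<and> S \<inter> A = {}. card S) \<le> (\<Sum>T\<in>Pow B. card T)"
  using F_sub finite_B by (intro sum_mono2) auto

lemma incidences_le:
  "card B * n2 \<le> (\<Sum>T\<in>Pow B. card T) + card A * (card B + (\<Sum>T\<in>large_sets B. card T))"
proof -
  have "(\<Sum>a\<in>A. \<Sum>S | S \<in> F \<and> a \<in> S. weight S) \<le> (\<Sum>a\<in>A. real (card B + (\<Sum>T\<in>large_sets B. card T)))"
    using sum_weight_le(1) by (intro sum_mono) auto
  then have "real (card B * n2) \<le> real ((\<Sum>T\<in>Pow B. card T) + card A * (card B + (\<Sum>T\<in>large_sets B. card T)))"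
    using of_nat_mono[OF sum_isolated_le, where ?'a = real] incidences_eq by simp
  then show ?thesis by linarith
qed

end

section \<open>Equality in the double count\<close>

lemma sum_eq_imp_subset:
  fixes f :: "'x \<Rightarrow> real"
  assumes "finite Y" "X \<subseteq> Y" "sum f X = sum f Y" "\<And>y. y \<in> Y \<Longrightarrow> f y \<ge> 0" "y \<in> Y" "f y > 0"
  shows "y \<in> X"
proof (rule ccontr)
  assume "y \<notin> X"
  then have "sum f X < sum f Y"
    using assms by (intro sum_strict_mono2[of Y X y f]) auto
  then show False using assms by simp
qed

locale tight_family = extremal_family A B F n2
  for A B :: "'i set" and F :: "'i set set" and n2 :: nat +
  assumes tight: "card B * n2 = (\<Sum>T\<in>Pow B. card T) + card A * (card B + (\<Sum>T\<in>large_sets B. card T))"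
begin

text \<open>All estimates behind the double count must hold with equality. Hence every nonempty
  subset of \<open>B\<close> occurs, every share attains its bound, and every point of
  \<open>A\<close> is combined with every large set.\<close>

lemma
  shows isolated_in: "\<And>T. T \<subseteq> B \<Longrightarrow> T \<noteq> {} \<Longrightarrow> T \<in> F"
    and weight_eq: "\<And>a S. a \<in> A \<Longrightarrow> S \<in> F \<Longrightarrow> a \<in> S \<Longrightarrow> weight S = card B / 2 + bonus a S"
    and large_in: "\<And>a T. a \<in> A \<Longrightarrow> T \<in> large_sets B \<Longrightarrow> insert a T \<in> F"
proof -
  let ?w = "\<lambda>a. \<Sum>S | S \<in> F \<and> a \<in> S. weight S" and ?R = "real (card B + (\<Sum>T\<in>large_sets B. card T))"
  have le: "(\<Sum>a\<in>A. ?w a) \<le> (\<Sum>a\<in>A. ?R)" using sum_weight_le(1) by (intro sum_mono) auto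
  have "real (card B * n2) = real (\<Sum>T\<in>Pow B. card T) + (\<Sum>a\<in>A. ?R)" by (simp add: tight)
  with le have eq1: "real (\<Sum>S | S \<in> F \<and> S \<inter> A = {}. card S) = real (\<Sum>T\<in>Pow B. card T)"
    and eq2: "(\<Sum>a\<in>A. ?w a) = (\<Sum>a\<in>A. ?R)"
    using sum_isolated_le incidences_eq by linarith+
  have w: "?w a = ?R" if "a \<in> A" for a
    by (rule sum_mono_inv[OF eq2]) (use sum_weight_le(1) that finite_A in auto)
  show "weight S = card B / 2 + bonus a S" if "a \<in> A" "S \<in> F" "a \<in> S" for a S
    using sum_weight_le(2)[OF that(1)] w[OF that(1)] that by blast
  show "T \<in> F" if T: "T \<subseteq> B" "T \<noteq> {}" for T
  proof -
    have "T \<in> {S. S \<in> F \<and> S \<inter> A = {}}"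
    proof (rule sum_eq_imp_subset[of "Pow B" _ "\<lambda>T. real (card T)"])
      show "(\<Sum>S | S \<in> F \<and> S \<inter> A = {}. real (card S)) = (\<Sum>T\<in>Pow B. real (card T))"
        using eq1 by simp
    qed (use T finite_B F_sub finite_subset[OF T(1)] in \<open>auto simp: card_gt_0_iff\<close>)
    then show ?thesis by simp
  qed
  show "insert a T \<in> F" if a: "a \<in> A" and T: "T \<in> large_sets B" for a T
  proof -
    let ?G = "{S \<in> F. S \<inter> A = {a} \<and> S \<inter> B \<in> large_sets B}"
    have "T \<in> (\<lambda>S. S \<inter> B) ` ?G"
    proof (rule sum_eq_imp_subset[of "large_sets B" _ "\<lambda>T. real (card T) - card B / 2"])
      show "(\<Sum>T\<in>(\<lambda>S. S \<inter> B) ` ?G. real (card T) - card B / 2) =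
          (\<Sum>T\<in>large_sets B. real (card T) - card B / 2)"
        using sum_weight_le(2)[OF a] w[OF a] unfolding sum_bonus by blast
    qed (use T in \<open>auto simp: finite_large_sets finite_B large_sets_def\<close>)
    then obtain S where S: "S \<in> F" "S \<inter> A = {a}" "T = S \<inter> B" by auto
    then have "S = insert a T" using F_eq_Un[of S] by auto
    then show ?thesis using S by simp
  qed
qed

section \<open>The graph formed by the special sets\<close>

definition special :: "'i \<Rightarrow> 'i set set" where
  "special a = {S \<in> F. a \<in> S \<and> \<not> (S \<inter> A = {a} \<and> S \<inter> B \<in> large_sets B)}"

text \<open>All sets \<open>insert a T\<close> with \<open>T\<close> large belong to
  \<open>F\<close>, and the degree of \<open>a\<close> leaves room for two more.\<close>

lemma card_special:
  assumes "a \<in> A"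
  shows "card (special a) = 2"
proof -
  have aB: "a \<notin> B" using assms disj by auto
  have sub: "insert a ` large_sets B \<subseteq> {S \<in> F. a \<in> S}" using large_in assms by auto
  have "special a = {S \<in> F. a \<in> S} - insert a ` large_sets B"
  proof
    show "special a \<subseteq> {S \<in> F. a \<in> S} - insert a ` large_sets B"
      using aB assms disj by (auto simp: special_def large_sets_def) (metis Int_insert_left_if0 Int_absorb2)+
    show "{S \<in> F. a \<in> S} - insert a ` large_sets B \<subseteq> special a"
    proof
      fix S assume S: "S \<in> {S \<in> F. a \<in> S} - insert a ` large_sets B"
      moreover have "S = insert a (S \<inter> B)" if "S \<inter> A = {a}" using F_eq_Un[of S] S that by auto
      ultimately show "S \<in> special a" unfolding special_def by blast
    qed
  qed
  moreover have "inj_on (insert a) (large_sets B)"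
    using aB by (intro inj_onI) (auto simp: large_sets_def insert_ident)
  ultimately show ?thesis
    using deg_A[OF assms] sub finite_F finite_large_sets[OF finite_B]
    by (simp add: card_Diff_subset card_image)
qed

text \<open>A special set gives \<open>a\<close> a share of exactly \<open>card B / 2\<close>, so
  \<open>2 * card (S \<inter> B) = card B * card (S \<inter> A)\<close>. As
  \<open>card (S \<inter> B)\<close> is at most \<open>card B\<close>, the set has one or two points
  in \<open>A\<close>, and two force it to contain all of \<open>B\<close>.\<close>

lemma special_cases:
  assumes "a \<in> A" "S \<in> special a"
  obtains (pendant) "S \<inter> A = {a}" "2 * card (S \<inter> B) = card B"
    | (link) a' where "a' \<in> A" "a' \<noteq> a" "S = {a, a'} \<union> B"
proof -
  have S: "S \<in> F" "a \<in> S" and ns: "\<not> (S \<inter> A = {a} \<and> S \<inter> B \<in> large_sets B)"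
    using assms by (auto simp: special_def)
  have w: "weight S = card B / 2" using weight_eq[OF assms(1) S] ns by (simp add: bonus_def)
  have le: "card (S \<inter> B) \<le> card B" using finite_B by (simp add: card_mono)
  have Bpos: "card B > 0" using B_ne finite_B by (simp add: card_gt_0_iff)
  show thesis
  proof (cases "S \<inter> A = {a}")
    case True
    then have "real (2 * card (S \<inter> B)) = real (card B)" using w by (simp add: weight_def)
    then show thesis using True pendant by linarith
  next
    case False
    have "card (S \<inter> A) \<noteq> 0" using S assms finite_A by auto
    then have e: "real (2 * card (S \<inter> B)) = real (card B * card (S \<inter> A))"
      using w by (simp add: weight_def field_simps)
    then have e': "2 * card (S \<inter> B) = card B * card (S \<inter> A)" by linarith
    have "card (S \<inter> A) \<noteq> 1" using False S assms by (metis IntI card_1_singletonE singletonD)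
    then have d2: "card (S \<inter> A) \<ge> 2" using \<open>card (S \<inter> A) \<noteq> 0\<close> by linarith
    have "card B * card (S \<inter> A) \<le> card B * 2" using e' le by linarith
    then have d: "card (S \<inter> A) = 2" using d2 Bpos by simp
    then have "card (S \<inter> B) = card B" using e' by simp
    then have SB: "S \<inter> B = B" using finite_B by (metis card_subset_eq inf_le2)
    obtain a' where "S \<inter> A = {a, a'}" "a' \<noteq> a"
      using S assms by (auto intro: card_2_other[OF d, of a])
    then show thesis using link[of a'] SB F_eq_Un[OF S(1)] by auto
  qed
qed

text \<open>The half-edges of the graph on \<open>A\<close> whose edges are the links; a pendant set
  is a loose end. Every point has two of them.\<close>

definition darts :: "('i \<times> 'i set) set" where
  "darts = {(a, S). a \<in> A \<and> S \<in> special a}"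

text \<open>Both switches are the identity outside \<open>darts\<close>, so that they are
  involutions on the whole type.\<close>

definition switch_set :: "'i \<times> 'i set \<Rightarrow> 'i \<times> 'i set" where
  "switch_set d = (if d \<in> darts then (fst d, THE S. S \<in> special (fst d) \<and> S \<noteq> snd d) else d)"

definition switch_point :: "'i \<times> 'i set \<Rightarrow> 'i \<times> 'i set" where
  "switch_point d = (if d \<in> darts \<and> snd d \<inter> A \<noteq> {fst d}
     then (THE a. a \<in> snd d \<inter> A \<and> a \<noteq> fst d, snd d) else d)"

lemma switch_set:
  assumes "a \<in> A" "S \<in> special a"
  obtains S' where "special a = {S, S'}" "S' \<noteq> S" "switch_set (a, S) = (a, S')"
proof -
  obtain S' where S': "special a = {S, S'}" "S' \<noteq> S"
    using card_2_other[OF card_special[OF assms(1)] assms(2)] by blast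
  moreover have "(THE X. X \<in> special a \<and> X \<noteq> S) = S'" using S' by (intro the_equality) auto
  ultimately show thesis using that assms by (simp add: switch_set_def darts_def)
qed

lemma switch_point_pendant: "S \<inter> A = {a} \<Longrightarrow> switch_point (a, S) = (a, S)"
  by (simp add: switch_point_def)

lemma switch_point_link:
  assumes "a \<in> A" "S \<in> special a" "a' \<in> A" "a' \<noteq> a" "S = {a, a'} \<union> B"
  shows "switch_point (a, S) = (a', S)" "S \<in> special a'"
proof -
  have SA: "S \<inter> A = {a, a'}" using assms disj by auto
  have "(THE x. x \<in> S \<inter> A \<and> x \<noteq> a) = a'" using SA assms by (intro the_equality) auto
  then show "switch_point (a, S) = (a', S)" using SA assms by (auto simp: switch_point_def darts_def)
  show "S \<in> special a'" using assms SA by (auto simp: special_def)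
qed

sublocale involution_pair darts switch_set switch_point
proof
  show "finite darts"
    by (rule finite_subset[of _ "A \<times> F"]) (auto simp: darts_def special_def finite_A finite_F)
  fix d :: "'i \<times> 'i set"
  obtain a S where d: "d = (a, S)" by force
  show "switch_set d \<in> darts" "switch_set d \<noteq> d" if "d \<in> darts"
  proof -
    have "a \<in> A" "S \<in> special a" using that by (auto simp: d darts_def)
    then obtain S' where "special a = {S, S'}" "S' \<noteq> S" "switch_set (a, S) = (a, S')"
      by (rule switch_set)
    then show "switch_set d \<in> darts" "switch_set d \<noteq> d" using \<open>a \<in> A\<close> by (auto simp: d darts_def)
  qed
  show "switch_point d \<in> darts" if "d \<in> darts"
  proof -
    have aS: "a \<in> A" "S \<in> special a" using that by (auto simp: d darts_def)
    from special_cases[OF this] show ?thesis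
    proof cases
      case 1
      then show ?thesis using that by (simp add: d switch_point_pendant)
    next
      case link: (2 a')
      then show ?thesis using switch_point_link[OF aS link] by (simp add: d darts_def)
    qed
  qed
  show "switch_set (switch_set d) = d"
  proof (cases "d \<in> darts")
    case True
    then have aS: "a \<in> A" "S \<in> special a" by (auto simp: d darts_def)
    then obtain S' where S': "special a = {S, S'}" "S' \<noteq> S" "switch_set (a, S) = (a, S')"
      by (rule switch_set)
    moreover from S'(1) have "S' \<in> special a" by simp
    with aS(1) obtain S'' where "special a = {S', S''}" "S'' \<noteq> S'" "switch_set (a, S') = (a, S'')"
      by (rule switch_set)
    ultimately show ?thesis by (auto simp: d doubleton_eq_iff)
  qed (simp add: switch_set_def)
  show "switch_point (switch_point d) = d"
  proof (cases "d \<in> darts")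
    case True
    then have aS: "a \<in> A" "S \<in> special a" by (auto simp: d darts_def)
    from special_cases[OF this] show ?thesis
    proof cases
      case 1
      then show ?thesis by (simp add: d switch_point_pendant)
    next
      case link: (2 a')
      then show ?thesis
      proof -
        have "switch_point (a, S) = (a', S)" "S \<in> special a'" using switch_point_link[OF aS link] by auto
        moreover have "S = {a', a} \<union> B" using link by auto
        ultimately show ?thesis using switch_point_link(1)[of a' S a] link aS by (simp add: d)
      qed
    qed
  qed (simp add: switch_point_def)
qed

lemma fixed_iff_pendant:
  assumes "a \<in> A" "S \<in> special a"
  shows "switch_point (a, S) = (a, S) \<longleftrightarrow> S \<inter> A = {a}"
  using assms(2)
proof (cases rule: special_cases[OF assms])
  case (2 a')
  then show ?thesis using switch_point_link(1)[OF assms 2] disj assms(1) by auto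
qed (simp add: switch_point_pendant)

text \<open>A map of the darts and a permutation \<open>\<pi>\<close> of \<open>B\<close> that agree
  on the labels of the pendant sets combine to a permutation \<open>\<sigma>\<close> preserving
  \<open>F\<close>. Subsets of \<open>B\<close> and sets of large type raise no obstruction, since
  all of them occur; links go to links because \<open>f\<close> commutes with
  \<open>switch_point\<close>.\<close>

lemma equivariant_imp_trivial:
  assumes rigid: "rigid_family (A \<union> B) F" and f: "equivariant f" and \<pi>: "\<pi> permutes B"
    and label: "\<And>a S. a \<in> A \<Longrightarrow> S \<in> special a \<Longrightarrow> S \<inter> A = {a} \<Longrightarrow> snd (f (a, S)) \<inter> B = \<pi> ` (S \<inter> B)"
  shows "\<pi> = id" "a \<in> A \<Longrightarrow> S \<in> special a \<Longrightarrow> fst (f (a, S)) = a"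
proof -
  have f_in: "f d \<in> darts" if "d \<in> darts" for d using f that by (auto simp: equivariant_def)
  have f_\<alpha>: "f (switch_set d) = switch_set (f d)" and f_\<beta>: "f (switch_point d) = switch_point (f d)"
    if "d \<in> darts" for d using f that by (auto simp: equivariant_def)
  have f_inj: "d = e" if "d \<in> darts" "e \<in> darts" "f d = f e" for d e
    using f that by (auto simp: equivariant_def inj_on_def)
  have fst_\<alpha>: "fst (switch_set d) = fst d" for d by (simp add: switch_set_def)
  define pick where "pick a = (SOME S. S \<in> special a)" for a
  have pick: "pick a \<in> special a" if "a \<in> A" for a
    unfolding pick_def some_in_eq using card_special[OF that] by force
  \<comment> \<open>The choice made by \<open>pick\<close> does not matter: \<open>f\<close>
    commutes with \<open>switch_set\<close> and so keeps the two darts of a point together.\<close>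
  define \<sigma> where "\<sigma> x = (if x \<in> A then fst (f (x, pick x)) else \<pi> x)" for x
  have \<sigma>: "fst (f (a, S)) = \<sigma> a" if aS: "a \<in> A" "S \<in> special a" for a S
  proof -
    obtain S' where S': "special a = {S, S'}" "switch_set (a, S) = (a, S')"
      using aS by (rule switch_set)
    have "fst (f (a, S')) = fst (f (a, S))"
      using f_\<alpha>[of "(a, S)"] fst_\<alpha>[of "f (a, S)"] S' aS by (simp add: darts_def)
    then show ?thesis using pick[OF aS(1)] S' aS by (auto simp: \<sigma>_def)
  qed
  have \<sigma>A: "\<sigma> a \<in> A" if "a \<in> A" for a
    using f_in[of "(a, pick a)"] pick[OF that] that by (auto simp: \<sigma>_def darts_def)
  have \<sigma>B: "\<sigma> ` T = \<pi> ` T" if "T \<subseteq> B" for T using that disj by (auto simp: \<sigma>_def image_iff)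
  have \<pi>B: "\<pi> ` T \<subseteq> B" "card (\<pi> ` T) = card T" if "T \<subseteq> B" for T
    using that permutes_in_image[OF \<pi>] card_image[OF permutes_inj_on[OF \<pi>]] by auto
  \<comment> \<open>The images of the two darts at \<open>a\<close> exhaust the darts at
    \<open>\<sigma> a\<close>. A dart at \<open>a'\<close> whose image is also there must be one of
    these two, by injectivity of \<open>f\<close>.\<close>
  have injA: "a = a'" if aa': "a \<in> A" "a' \<in> A" "\<sigma> a = \<sigma> a'" for a a'
  proof -
    obtain S where S: "special a = {pick a, S}" "S \<noteq> pick a" "switch_set (a, pick a) = (a, S)"
      using aa'(1) pick[OF aa'(1)] by (rule switch_set)
    let ?c = "\<sigma> a"
    obtain X where X: "f (a, pick a) = (?c, X)" using aa' by (cases "f (a, pick a)") (auto simp: \<sigma>_def)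
    obtain X' where X': "f (a, S) = (?c, X')" using \<sigma>[of a S] S aa' by (cases "f (a, S)") auto
    obtain Y where Y: "f (a', pick a') = (?c, Y)" using aa' by (cases "f (a', pick a')") (auto simp: \<sigma>_def)
    have d: "(a, pick a) \<in> darts" "(a, S) \<in> darts" "(a', pick a') \<in> darts"
      using aa' pick S by (auto simp: darts_def)
    have "X \<noteq> X'" using f_inj[OF d(1,2)] X X' S by auto
    moreover have "X \<in> special ?c" "X' \<in> special ?c" "Y \<in> special ?c"
      using f_in[OF d(1)] f_in[OF d(2)] f_in[OF d(3)] X X' Y by (auto simp: darts_def)
    ultimately have "Y = X \<or> Y = X'"
      using card_special[OF \<sigma>A[OF aa'(1)]] by (auto simp: card_2_iff)
    then show ?thesis using f_inj[OF d(3) d(1)] f_inj[OF d(3) d(2)] X X' Y by auto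
  qed
  have "\<sigma> permutes A \<union> B"
  proof (rule bij_imp_permutes)
    have \<sigma>\<pi>: "\<sigma> x = \<pi> x \<and> \<pi> x \<in> B" if "x \<in> B" for x
      using that disj permutes_in_image[OF \<pi>] by (auto simp: \<sigma>_def)
    have "inj_on \<sigma> (A \<union> B)"
    proof (rule inj_onI)
      fix x y assume "x \<in> A \<union> B" "y \<in> A \<union> B" "\<sigma> x = \<sigma> y"
      then show "x = y"
        using injA[of x y] \<sigma>A[of x] \<sigma>A[of y] \<sigma>\<pi>[of x] \<sigma>\<pi>[of y] disj injD[OF permutes_inj[OF \<pi>], of x y]
        by (metis Un_iff disjoint_iff)
    qed
    moreover have "\<sigma> ` (A \<union> B) \<subseteq> A \<union> B" using \<sigma>A permutes_in_image[OF \<pi>] by (auto simp: \<sigma>_def)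
    ultimately show "bij_betw \<sigma> (A \<union> B) (A \<union> B)"
      using finite_A finite_B by (simp add: bij_betw_def endo_inj_surj)
  qed (use \<pi> in \<open>auto simp: \<sigma>_def permutes_not_in\<close>)
  moreover have "\<sigma> ` S \<in> F" if S: "S \<in> F" for S
  proof (cases "S \<inter> A = {}")
    case True
    then have "S \<subseteq> B" "S \<noteq> {}" using S F_sub by auto
    then show ?thesis using isolated_in[of "\<pi> ` S"] \<pi>B \<sigma>B by auto
  next
    case False
    then obtain a where a: "a \<in> A" "a \<in> S" by auto
    have img: "\<sigma> ` S = \<sigma> ` (S \<inter> A) \<union> \<pi> ` (S \<inter> B)"
      using F_eq_Un[OF S] \<sigma>B[of "S \<inter> B"] by (metis image_Un inf_le2)
    show ?thesis
    proof (cases "S \<inter> A = {a} \<and> S \<inter> B \<in> large_sets B")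
      case True
      then have "\<pi> ` (S \<inter> B) \<in> large_sets B" using \<pi>B by (auto simp: large_sets_def)
      then show ?thesis using img large_in \<sigma>A[OF a(1)] True by auto
    next
      case False
      then have sp: "S \<in> special a" using S a by (simp add: special_def)
      obtain S1 where S1: "f (a, S) = (\<sigma> a, S1)" using \<sigma>[OF a(1) sp] by (cases "f (a, S)") auto
      have d: "(a, S) \<in> darts" using a sp by (simp add: darts_def)
      have sp1: "S1 \<in> special (\<sigma> a)" using f_in[OF d] S1 by (simp add: darts_def)
      then have F1: "S1 \<in> F" by (simp add: special_def)
      from special_cases[OF a(1) sp] show ?thesis
      proof cases
        case pendant: 1
        have "switch_point (\<sigma> a, S1) = (\<sigma> a, S1)"
          using f_\<beta>[OF d] S1 by (simp add: switch_point_pendant pendant)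
        then have "S1 \<inter> A = {\<sigma> a}" using fixed_iff_pendant[OF \<sigma>A[OF a(1)] sp1] by simp
        moreover have "S1 \<inter> B = \<pi> ` (S \<inter> B)" using label[OF a(1) sp pendant(1)] S1 by simp
        ultimately have "\<sigma> ` S = S1" using img pendant F_eq_Un[OF F1] by simp
        then show ?thesis using F1 by simp
      next
        case link: (2 a')
        have l: "switch_point (a, S) = (a', S)" "S \<in> special a'"
          using switch_point_link[OF a(1) sp link] by auto
        then have d': "(a', S) \<in> darts" using link by (simp add: darts_def)
        have "switch_point (\<sigma> a, S1) = f (a', S)" using f_\<beta>[OF d] l S1 by simp
        moreover have "f (a', S) \<noteq> f (a, S)" using f_inj[OF d' d] link by auto
        ultimately have "S1 \<inter> A \<noteq> {\<sigma> a}" and 2: "switch_point (\<sigma> a, S1) = f (a', S)"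
          using S1 switch_point_pendant[of S1 "\<sigma> a"] by auto
        then obtain c where c: "c \<in> A" "c \<noteq> \<sigma> a" "S1 = {\<sigma> a, c} \<union> B"
          using special_cases[OF \<sigma>A[OF a(1)] sp1] by metis
        then have "f (a', S) = (c, S1)" using 2 switch_point_link(1)[OF \<sigma>A[OF a(1)] sp1 c] by simp
        then have "\<sigma> a' = c" using \<sigma>[OF link(1) l(2)] by simp
        moreover have "S \<inter> A = {a, a'}" "S \<inter> B = B" using link a disj by auto
        ultimately have "\<sigma> ` S = S1" using img c permutes_image[OF \<pi>] by simp
        then show ?thesis using F1 by simp
      qed
    qed
  qed
  moreover have "(`) \<sigma> ` F = F"
  proof (rule endo_inj_surj[OF finite_F])
    show "(`) \<sigma> ` F \<subseteq> F" using calculation(2) by auto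
    show "inj_on ((`) \<sigma>) F"
      using permutes_inj[OF calculation(1)] by (auto simp: inj_on_def inj_image_eq_iff)
  qed
  ultimately have id: "\<sigma> = id" using rigid by (auto simp: rigid_family_def)
  show "fst (f (a, S)) = a" if "a \<in> A" "S \<in> special a" using \<sigma>[OF that] id by simp
  show "\<pi> = id"
  proof
    fix x show "\<pi> x = id x"
    proof (cases "x \<in> B")
      case True
      then have "\<sigma> x = \<pi> x" using disj by (auto simp: \<sigma>_def)
      then show ?thesis using id by simp
    qed (use \<pi> in \<open>simp add: permutes_not_in\<close>)
  qed
qed

text \<open>A pendant set would contain exactly half of an odd number of elements. Hence there are
  no loose ends, all components are cycles, and a rotation moves \<open>a\<close> to a
  neighbour.\<close>

lemma odd_not_rigid:
  assumes "odd (card B)" "A \<noteq> {}"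
  shows "\<not> rigid_family (A \<union> B) F"
proof
  assume rigid: "rigid_family (A \<union> B) F"
  obtain a where a: "a \<in> A" using assms by auto
  obtain S where S: "S \<in> special a" using card_special[OF a] by (auto simp: card_2_iff)
  have np: "S \<inter> A \<noteq> {a}" if "a \<in> A" "S \<in> special a" for a S
    using that(2)
  proof (cases rule: special_cases[OF that])
    case 1
    then show ?thesis using assms(1) by (metis dvd_triv_left)
  next
    case (2 a')
    then show ?thesis by auto
  qed
  have "switch_point d \<noteq> d" if "d \<in> darts" for d
    using that fixed_iff_pendant np by (auto simp: darts_def)
  then obtain f where f: "equivariant f" "f (a, S) = rot (a, S)"
    using equivariant_rotation[of "(a, S)"] a S by (auto simp: darts_def)
  have "fst (f (a, S)) = a"
    using equivariant_imp_trivial(2)[OF rigid f(1) permutes_id _ a S] np by auto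
  moreover obtain a' where a': "a' \<in> A" "a' \<noteq> a" "S = {a, a'} \<union> B"
    using special_cases[OF a S] np[OF a S] by metis
  moreover have "fst (rot (a, S)) = a'"
    using switch_point_link(1)[OF a S a'] by (simp add: rot_def switch_set_def)
  ultimately show False using f by simp
qed

text \<open>Every pendant set is labelled by \<open>{b0}\<close> or \<open>{b1}\<close>. If a path
  has equal labels at its two ends, it can be reversed on its own. Otherwise the half turns of all
  components together match the transposition of \<open>b0\<close> and \<open>b1\<close>; this
  includes the case without any path.\<close>

lemma card_2_not_rigid:
  assumes "card B = 2"
  shows "\<not> rigid_family (A \<union> B) F"
proof
  assume rigid: "rigid_family (A \<union> B) F"
  obtain b0 b1 where B: "B = {b0, b1}" "b0 \<noteq> b1" using assms by (auto simp: card_2_iff)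
  have half_fixed: "switch_point (half_turn d) = half_turn d" if "d \<in> darts" "switch_point d = d" for d
    using half_turn_\<beta>[OF that(1)] that(2) by simp
  show False
  proof (cases "\<exists>d\<in>darts. switch_point d = d \<and> snd (half_turn d) \<inter> B = snd d \<inter> B")
    case True
    then obtain e where e: "e \<in> darts" "switch_point e = e" "snd (half_turn e) \<inter> B = snd e \<inter> B" by blast
    define f where "f = (\<lambda>d. if orbit_eq d e then half_turn d else d)"
    have f: "equivariant f" unfolding f_def using equivariant_half_turn_on_orbit e(2) by blast
    have label: "snd (f (a, S)) \<inter> B = id ` (S \<inter> B)" if "a \<in> A" "S \<in> special a" "S \<inter> A = {a}" for a S
    proof (cases "orbit_eq (a, S) e")
      case True
      then have "(a, S) = e \<or> (a, S) = half_turn e"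
        using fixed_in_orbit_of_fixed[OF e(1,2), of "(a, S)"] that
        by (auto simp: darts_def switch_point_pendant)
      then show ?thesis
      proof
        assume h: "(a, S) = e"
        then have "snd (f (a, S)) \<inter> B = snd e \<inter> B" using True e(3) by (simp add: f_def)
        then show ?thesis by (simp flip: h)
      next
        assume h: "(a, S) = half_turn e"
        then have "half_turn (a, S) = e" using half_turn_half_turn[OF e(1)] by simp
        then have "snd (f (a, S)) \<inter> B = snd (half_turn e) \<inter> B" using True e(3) by (simp add: f_def)
        then show ?thesis by (simp flip: h)
      qed
    qed (simp add: f_def)
    obtain a S where aS: "e = (a, S)" by force
    have 1: "a \<in> A" "S \<in> special a" using e aS by (auto simp: darts_def)
    \<comment> \<open>Rigidity keeps the point, so both ends of the path are pendant at
      \<open>a\<close> with equal labels. Then they are the same set, although a half turn moves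
      every loose end.\<close>
    have "fst (f (a, S)) = a" by (rule equivariant_imp_trivial(2)[OF rigid f permutes_id _ 1]) (rule label)
    then obtain S1 where S1: "half_turn e = (a, S1)"
      by (cases "half_turn e") (simp add: f_def aS)
    have 2: "S1 \<in> special a" using half_turn_in[OF e(1)] S1 by (simp add: darts_def)
    have "S \<inter> A = {a}" using fixed_iff_pendant[OF 1] e aS by simp
    moreover have "S1 \<inter> A = {a}" using fixed_iff_pendant[OF 1(1) 2] half_fixed[OF e(1,2)] S1 by simp
    moreover have "S1 \<inter> B = S \<inter> B" using e S1 aS by simp
    ultimately have "S1 = S"
      using 1 2 F_eq_Un[of S] F_eq_Un[of S1] by (auto simp: special_def)
    then show False using half_turn_of_fixed_neq[OF e(1,2)] S1 aS by simp
  next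
    case False
    let ?\<pi> = "transpose b0 b1"
    have single: "S \<inter> B = {b0} \<or> S \<inter> B = {b1}" if "a \<in> A" "S \<in> special a" "S \<inter> A = {a}" for a S
    proof -
      have "2 * card (S \<inter> B) = card B" using special_cases[OF that(1,2)] that disj by auto
      then have "card (S \<inter> B) = 1" using assms by simp
      then obtain b where "S \<inter> B = {b}" by (auto simp: card_1_singleton_iff)
      then show ?thesis using B by auto
    qed
    have "snd (half_turn (a, S)) \<inter> B = ?\<pi> ` (S \<inter> B)" if aS: "a \<in> A" "S \<in> special a" "S \<inter> A = {a}" for a S
    proof -
      have d: "(a, S) \<in> darts" "switch_point (a, S) = (a, S)"
        using aS by (auto simp: darts_def switch_point_pendant)
      obtain a1 S1 where h: "half_turn (a, S) = (a1, S1)" by force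
      have "a1 \<in> A" "S1 \<in> special a1" using half_turn_in[OF d(1)] h by (auto simp: darts_def)
      moreover from this have "S1 \<inter> A = {a1}" using fixed_iff_pendant half_fixed[OF d] h by simp
      ultimately have "S1 \<inter> B = {b0} \<or> S1 \<inter> B = {b1}" by (rule single)
      moreover have "snd (half_turn (a, S)) \<inter> B \<noteq> snd (a, S) \<inter> B" using False d by blast
      then have "S1 \<inter> B \<noteq> S \<inter> B" using h by simp
      moreover have "S \<inter> B = {b0} \<or> S \<inter> B = {b1}" using aS by (rule single)
      ultimately show ?thesis using h by (elim disjE) simp_all
    qed
    then have "?\<pi> = id"
      using equivariant_imp_trivial(1)[OF rigid equivariant_half_turn permutes_swap_id[of b0 B b1]] B by blast
    then show False using B by (metis id_apply transpose_apply_first)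
  qed
qed

end

section \<open>Automorphisms of disjoint paths\<close>

definition path_points :: "nat \<Rightarrow> (nat \<Rightarrow> nat) \<Rightarrow> (nat \<times> nat) set" where
  "path_points q L = {(i, t). i < q \<and> t < L i}"

definition path_links :: "nat \<Rightarrow> (nat \<Rightarrow> nat) \<Rightarrow> (nat \<times> nat) set set" where
  "path_links q L = {{(i, t), (i, Suc t)} | i t. i < q \<and> Suc t < L i}"

text \<open>Degree at least two, an invariant that separates the inner points of a path from its
  ends.\<close>

definition on_two :: "'v set set \<Rightarrow> 'v \<Rightarrow> bool" where
  "on_two E x \<longleftrightarrow> (\<exists>e\<in>E. \<exists>e'\<in>E. e \<noteq> e' \<and> x \<in> e \<and> x \<in> e')"

lemma finite_path_points [simp]: "finite (path_points q L)"
proof -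
  have "path_points q L = (SIGMA i:{..<q}. {..<L i})" by (auto simp: path_points_def)
  then show ?thesis by simp
qed

lemma card_path_points: "card (path_points q L) = (\<Sum>i<q. L i)"
proof -
  have "path_points q L = (SIGMA i:{..<q}. {..<L i})" by (auto simp: path_points_def)
  then show ?thesis by simp
qed

lemma path_linkI: "i < q \<Longrightarrow> Suc t < L i \<Longrightarrow> {(i, t), (i, Suc t)} \<in> path_links q L"
  unfolding path_links_def by blast

lemma on_two_image:
  assumes "inj \<sigma>" "(`) \<sigma> ` E = E"
  shows "on_two E (\<sigma> x) \<longleftrightarrow> on_two E x"
proof
  assume "on_two E x"
  then obtain e e' where e: "e \<in> E" "e' \<in> E" "e \<noteq> e'" "x \<in> e" "x \<in> e'" by (auto simp: on_two_def)
  then have "\<sigma> ` e \<in> E" "\<sigma> ` e' \<in> E" "\<sigma> ` e \<noteq> \<sigma> ` e'"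
    using assms by (auto simp: inj_image_eq_iff)
  then show "on_two E (\<sigma> x)" using e unfolding on_two_def by blast
next
  assume "on_two E (\<sigma> x)"
  then obtain e e' where e: "e \<in> E" "e' \<in> E" "e \<noteq> e'" "\<sigma> x \<in> e" "\<sigma> x \<in> e'" by (auto simp: on_two_def)
  then obtain d d' where "d \<in> E" "d' \<in> E" "e = \<sigma> ` d" "e' = \<sigma> ` d'" using assms(2) by (metis imageE)
  then show "on_two E x" using e assms(1) unfolding on_two_def by (metis inj_image_mem_iff)
qed

lemma on_two_path_links:
  assumes "i < q" "t < L i"
  shows "on_two (path_links q L) (i, t) \<longleftrightarrow> 0 < t \<and> Suc t < L i"
proof
  assume "on_two (path_links q L) (i, t)"
  then obtain e e' where e: "e \<in> path_links q L" "e' \<in> path_links q L" "e \<noteq> e'" "(i, t) \<in> e" "(i, t) \<in> e'"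
    by (auto simp: on_two_def)
  have "(Suc t < L i \<and> e = {(i, t), (i, Suc t)}) \<or> (\<exists>u. t = Suc u \<and> e = {(i, u), (i, Suc u)})"
    if "e \<in> path_links q L" "(i, t) \<in> e" for e
    using that by (auto simp: path_links_def)
  from this[OF e(1,4)] this[OF e(2,5)] show "0 < t \<and> Suc t < L i" using e(3) by auto
next
  assume t: "0 < t \<and> Suc t < L i"
  then obtain u where u: "t = Suc u" by (cases t) auto
  have "{(i, t), (i, Suc t)} \<in> path_links q L" "{(i, u), (i, Suc u)} \<in> path_links q L"
    using t u assms by (auto intro: path_linkI)
  moreover have "{(i, t), (i, Suc t)} \<noteq> {(i, u), (i, Suc u)}" using u by (auto simp: doubleton_eq_iff)
  moreover have "(i, t) \<in> {(i, t), (i, Suc t)}" "(i, t) \<in> {(i, u), (i, Suc u)}" using u by auto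
  ultimately show "on_two (path_links q L) (i, t)" unfolding on_two_def by meson
qed

text \<open>Along the path each point must go to the next one, since the previous one is already an
  image. The last point does not lie on two links, nor does its image; so the two paths have the
  same length and hence coincide.\<close>

lemma path_automorphism_start:
  assumes inj: "inj_on L {..<q}" and L2: "\<And>i. i < q \<Longrightarrow> 2 \<le> L i"
    and \<sigma>: "\<sigma> permutes path_points q L" and E: "(`) \<sigma> ` path_links q L = path_links q L"
    and i: "i < q" "i' < q" "\<sigma> (i, 0) = (i', 0)"
  shows "i' = i" "t < L i \<Longrightarrow> \<sigma> (i, t) = (i, t)"
proof -
  have *: "t < L i \<Longrightarrow> t < L i' \<and> \<sigma> (i, t) = (i', t)" for t
  proof (induction t rule: less_induct)
    case (less t)
    show ?case
    proof (cases t)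
      case 0
      then show ?thesis using i L2[OF i(2)] by simp
    next
      case (Suc u)
      have IH: "\<sigma> (i, u) = (i', u)" using less.IH[of u] less.prems Suc by simp
      have "{(i, u), (i, t)} \<in> path_links q L" using Suc less.prems i by (auto intro: path_linkI)
      then have "\<sigma> ` {(i, u), (i, t)} \<in> path_links q L" using E by blast
      then have "{(i', u), \<sigma> (i, t)} \<in> path_links q L" using IH by simp
      then obtain k v where kv: "{(i', u), \<sigma> (i, t)} = {(k, v), (k, Suc v)}" "Suc v < L k"
        by (auto simp: path_links_def)
      then have "(u = v \<and> k = i' \<and> \<sigma> (i, t) = (i', Suc u)) \<or> (u = Suc v \<and> k = i' \<and> \<sigma> (i, t) = (i', v))"
        by (auto simp: doubleton_eq_iff)
      then show ?thesis
      proof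
        assume "u = Suc v \<and> k = i' \<and> \<sigma> (i, t) = (i', v)"
        moreover from this have "\<sigma> (i, v) = (i', v)" using less.IH[of v] less.prems Suc by simp
        ultimately have "(i, v) = (i, t)" using permutes_inj[OF \<sigma>] by (metis injD)
        with \<open>u = Suc v \<and> _\<close> Suc show ?thesis by simp
      next
        assume "u = v \<and> k = i' \<and> \<sigma> (i, t) = (i', Suc u)"
        then show ?thesis using kv(2) Suc by auto
      qed
    qed
  qed
  let ?l = "L i - 1"
  have l: "?l < L i" "Suc ?l = L i" using L2[OF i(1)] by auto
  have "\<not> on_two (path_links q L) (i, ?l)" using on_two_path_links[of i q "L i - 1" L] i(1) l by simp
  then have "\<not> on_two (path_links q L) (i', ?l)"
    using on_two_image[OF permutes_inj[OF \<sigma>] E, of "(i, ?l)"] *[OF l(1)] by simp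
  then have "\<not> (0 < ?l \<and> Suc ?l < L i')" using on_two_path_links[of i' q ?l L] i(2) *[OF l(1)] by blast
  then have "L i = L i'" using *[OF l(1)] L2[OF i(1)] by auto
  then show "i' = i" using inj i by (auto simp: inj_on_def)
  then show "t < L i \<Longrightarrow> \<sigma> (i, t) = (i, t)" using * by simp
qed

text \<open>Ends go to ends. If the first point goes to a last point, composing with the reversal of
  all paths leads back to the case where it goes to a first point.\<close>

lemma path_automorphism:
  assumes inj: "inj_on L {..<q}" and L2: "\<And>i. i < q \<Longrightarrow> 2 \<le> L i"
    and \<sigma>: "\<sigma> permutes path_points q L" and E: "(`) \<sigma> ` path_links q L = path_links q L"
    and i: "i < q"
  shows "(\<forall>t<L i. \<sigma> (i, t) = (i, t)) \<or> (\<forall>t<L i. \<sigma> (i, t) = (i, L i - 1 - t))"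
proof -
  have L0: "0 < L i" if "i < q" for i using L2[OF that] by simp
  define rev where "rev = (\<lambda>(i, t). if i < q \<and> t < L i then (i, L i - 1 - t) else (i, t))"
  have rev_rev: "rev (rev x) = x" for x by (cases x) (auto simp: rev_def)
  have rev: "rev permutes path_points q L"
  proof (rule bij_imp_permutes)
    show "bij_betw rev (path_points q L) (path_points q L)"
      by (rule bij_betw_byWitness[where f' = rev])
        (use rev_rev in \<open>auto simp: rev_def path_points_def\<close>)
  qed (auto simp: rev_def path_points_def split: if_splits)
  have rev_sub: "(`) rev ` path_links q L \<subseteq> path_links q L"
  proof (rule image_subsetI)
    fix e assume "e \<in> path_links q L"
    then obtain i t where e: "e = {(i, t), (i, Suc t)}" "i < q" "Suc t < L i"
      by (auto simp: path_links_def)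
    then have "rev ` e = {(i, L i - 2 - t), (i, Suc (L i - 2 - t))}" by (auto simp: rev_def)
    moreover have "Suc (L i - 2 - t) < L i" using e by linarith
    ultimately show "rev ` e \<in> path_links q L" using e unfolding path_links_def by blast
  qed
  have revE: "(`) rev ` path_links q L = path_links q L"
  proof
    show "path_links q L \<subseteq> (`) rev ` path_links q L"
    proof
      fix e assume "e \<in> path_links q L"
      then have "rev ` e \<in> path_links q L" using rev_sub by auto
      moreover have "e = rev ` rev ` e" by (simp add: image_image rev_rev)
      ultimately show "e \<in> (`) rev ` path_links q L" by (rule rev_image_eqI)
    qed
  qed (rule rev_sub)
  have "(i, 0) \<in> path_points q L" using i L0 by (simp add: path_points_def)
  then have "\<sigma> (i, 0) \<in> path_points q L" using permutes_in_image[OF \<sigma>] by simp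
  then obtain i' t' where i't': "\<sigma> (i, 0) = (i', t')" "i' < q" "t' < L i'" by (auto simp: path_points_def)
  have "\<not> on_two (path_links q L) (i, 0)" using on_two_path_links[of i q 0 L] L0[OF i] i by simp
  then have "\<not> on_two (path_links q L) (i', t')"
    using on_two_image[OF permutes_inj[OF \<sigma>] E, of "(i, 0)"] i't' by simp
  then consider "t' = 0" | "t' = L i' - 1" using on_two_path_links[of i' q t' L] i't' by linarith
  then show ?thesis
  proof cases
    case 1
    then show ?thesis using path_automorphism_start[OF inj L2 \<sigma> E i i't'(2)] i't' by metis
  next
    case 2
    let ?\<sigma> = "rev \<circ> \<sigma>"
    have "?\<sigma> permutes path_points q L" using \<sigma> rev by (rule permutes_compose)
    moreover have "(`) ?\<sigma> ` path_links q L = path_links q L"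
      unfolding image_comp[symmetric] comp_def using E revE by (simp add: image_image[symmetric])
    moreover have "?\<sigma> (i, 0) = (i', 0)" using 2 i't' by (simp add: rev_def)
    ultimately have *: "i' = i" "t < L i \<Longrightarrow> ?\<sigma> (i, t) = (i, t)" for t
      using path_automorphism_start[of L q ?\<sigma> i i'] inj L2 i i't' by auto
    have "\<sigma> (i, t) = (i, L i - 1 - t)" if "t < L i" for t
    proof -
      have "\<sigma> (i, t) = rev (rev (\<sigma> (i, t)))" by (simp add: rev_rev)
      also have "\<dots> = rev (i, t)" using *(2)[OF that] by simp
      also have "\<dots> = (i, L i - 1 - t)" using that i by (simp add: rev_def)
      finally show ?thesis .
    qed
    then show ?thesis by blast
  qed
qed

text \<open>The case of one path, transported from pairs to numbers.\<close>

lemma single_path_automorphism: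
  assumes m: "2 \<le> m" and \<sigma>: "\<sigma> permutes {..<m}"
    and E: "(`) \<sigma> ` {{t, Suc t} | t. Suc t < m} = {{t, Suc t} | t. Suc t < m}"
  shows "\<sigma> = id \<or> (\<forall>t<m. \<sigma> t = m - 1 - t)"
proof -
  let ?E = "{{t, Suc t} | t. Suc t < m}"
  define \<tau> where "\<tau> = (\<lambda>(i::nat, t). if i = 0 then (i, \<sigma> t) else (i, t))"
  have pts: "path_points 1 (\<lambda>_. m) = Pair 0 ` {..<m}" by (auto simp: path_points_def)
  have lnk: "path_links 1 (\<lambda>_. m) = (`) (Pair 0) ` ?E"
    by (auto simp: path_links_def image_iff) blast+
  have \<tau>P: "\<tau> ` Pair 0 ` X = Pair 0 ` \<sigma> ` X" for X by (auto simp: \<tau>_def image_iff)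
  have "\<tau> permutes path_points 1 (\<lambda>_. m)"
  proof (rule bij_imp_permutes)
    have "inj_on \<tau> (path_points 1 (\<lambda>_. m))"
      using permutes_inj[OF \<sigma>] by (auto simp: inj_on_def \<tau>_def path_points_def dest: injD)
    then show "bij_betw \<tau> (path_points 1 (\<lambda>_. m)) (path_points 1 (\<lambda>_. m))"
      unfolding bij_betw_def pts \<tau>P using permutes_image[OF \<sigma>] by simp
    show "\<tau> x = x" if "x \<notin> path_points 1 (\<lambda>_. m)" for x
      using that permutes_not_in[OF \<sigma>, of "snd x"] by (cases x) (auto simp: \<tau>_def path_points_def)
  qed
  moreover have "(`) \<tau> ` path_links 1 (\<lambda>_. m) = path_links 1 (\<lambda>_. m)"
  proof -
    have "(`) \<tau> ` path_links 1 (\<lambda>_. m) = (\<lambda>X. \<tau> ` Pair 0 ` X) ` ?E" unfolding lnk by (rule image_image)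
    also have "\<dots> = (`) (Pair 0) ` (`) \<sigma> ` ?E" unfolding \<tau>P by (rule image_image[symmetric])
    finally show ?thesis by (simp only: E lnk)
  qed
  ultimately have "(\<forall>t<m. \<tau> (0, t) = (0, t)) \<or> (\<forall>t<m. \<tau> (0, t) = (0, m - 1 - t))"
    using path_automorphism[of "\<lambda>_. m" 1 \<tau> 0] m by (auto simp: inj_on_def)
  then have "(\<forall>t<m. \<sigma> t = t) \<or> (\<forall>t<m. \<sigma> t = m - 1 - t)" by (simp add: \<tau>_def)
  then show ?thesis using \<sigma> by (metis eq_id_iff lessThan_iff permutes_not_in)
qed

text \<open>Serves to isolate the links of a family, which are its sets of two elements.\<close>

lemma image_filter_card:
  assumes "inj \<sigma>" "(`) \<sigma> ` H = H"
  shows "(`) \<sigma> ` {X \<in> H. Q (card X)} = {X \<in> H. Q (card X)}"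
proof -
  have c: "card (\<sigma> ` X) = card X" for X using assms(1) by (simp add: card_image inj_on_subset)
  show ?thesis
  proof
    show "(`) \<sigma> ` {X \<in> H. Q (card X)} \<subseteq> {X \<in> H. Q (card X)}" using assms(2) c by auto
    show "{X \<in> H. Q (card X)} \<subseteq> (`) \<sigma> ` {X \<in> H. Q (card X)}"
    proof
      fix X assume X: "X \<in> {X \<in> H. Q (card X)}"
      then have "X \<in> (`) \<sigma> ` H" using assms(2) by simp
      then obtain Z where "Z \<in> H" "X = \<sigma> ` Z" by blast
      then show "X \<in> (`) \<sigma> ` {X \<in> H. Q (card X)}" using X c by auto
    qed
  qed
qed

text \<open>If \<^term>\<open>n1 \<noteq> n2\<close>, an automorphism cannot mix the parts of the two sizes, so that the sets of a
  rigid family may be split into their traces on the two kinds of parts.\<close>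

lemma distinguishing_partition_of_pairs:
  fixes A :: "'a set" and B :: "'b set" and G :: "('a set \<times> 'b set) set"
  assumes fin: "finite A" "finite B" and G: "G \<subseteq> Pow A \<times> Pow B" "({}, {}) \<notin> G"
    and degA: "\<And>a. a \<in> A \<Longrightarrow> card {p \<in> G. a \<in> fst p} = n1"
    and degB: "\<And>b. b \<in> B \<Longrightarrow> card {p \<in> G. b \<in> snd p} = n2"
    and n: "n1 \<noteq> n2" "0 < n1" "0 < n2"
    and rigid: "\<And>\<sigma> \<pi>. \<sigma> permutes A \<Longrightarrow> \<pi> permutes B \<Longrightarrow> (\<lambda>(X, T). (\<sigma> ` X, \<pi> ` T)) ` G = G \<Longrightarrow> \<sigma> = id \<and> \<pi> = id"
  shows "\<exists>P. distinguishing_partition (K (card A) n1 (card B) n2) P"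
proof -
  define m1 m2 where "m1 = card A" and "m2 = card B"
  have "\<exists>f. bij_betw f A {..<m1}" "\<exists>g. bij_betw g B {m1..<m1 + m2}"
    by (rule finite_same_card_bij; simp add: fin m1_def m2_def)+
  then obtain f g where f: "bij_betw f A {..<m1}" and g: "bij_betw g B {m1..<m1 + m2}" by blast
  let ?I = "{..<m1 + m2}"
  \<comment> \<open>Merges the two traces into one set of parts, with the indices for
    \<open>A\<close> before those for \<open>B\<close>.\<close>
  define \<phi> where "\<phi> = (\<lambda>(X, T). f ` X \<union> g ` T)"
  have fA: "f x < m1" if "x \<in> A" for x using f that by (auto simp: bij_betw_def)
  have gB: "m1 \<le> g y \<and> g y < m1 + m2" if "y \<in> B" for y using g that by (auto simp: bij_betw_def)
  have f_inj: "f x = f x' \<longleftrightarrow> x = x'" if "x \<in> A" "x' \<in> A" for x x'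
    using inj_on_eq_iff[OF bij_betw_imp_inj_on[OF f] that] .
  have g_inj: "g x = g x' \<longleftrightarrow> x = x'" if "x \<in> B" "x' \<in> B" for x x'
    using inj_on_eq_iff[OF bij_betw_imp_inj_on[OF g] that] .
  have fmem: "f x \<in> \<phi> (X, T) \<longleftrightarrow> x \<in> X" if "x \<in> A" "X \<subseteq> A" "T \<subseteq> B" for x X T
  proof -
    have "f x \<notin> g ` T" using fA[OF that(1)] gB subsetD[OF that(3)] by (metis imageE leD)
    then show ?thesis using inj_on_image_mem_iff[OF bij_betw_imp_inj_on[OF f] that(1,2)] by (simp add: \<phi>_def)
  qed
  have gmem: "g y \<in> \<phi> (X, T) \<longleftrightarrow> y \<in> T" if "y \<in> B" "X \<subseteq> A" "T \<subseteq> B" for y X T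
  proof -
    have "g y \<notin> f ` X" using gB[OF that(1)] fA subsetD[OF that(2)] by (metis imageE leD)
    then show ?thesis using inj_on_image_mem_iff[OF bij_betw_imp_inj_on[OF g] that(1,3)] by (simp add: \<phi>_def)
  qed
  have \<phi>_inj: "X = X' \<and> T = T'" if "\<phi> (X, T) = \<phi> (X', T')" "X \<subseteq> A" "X' \<subseteq> A" "T \<subseteq> B" "T' \<subseteq> B" for X X' T T'
  proof -
    have "X = {x \<in> A. f x \<in> \<phi> (X, T)} \<and> T = {y \<in> B. g y \<in> \<phi> (X, T)}" if "X \<subseteq> A" "T \<subseteq> B" for X T
      using fmem gmem that by blast
    from this[OF that(2,4)] this[OF that(3,5)] show ?thesis using that(1) by simp
  qed
  have inj: "inj_on \<phi> G"
  proof (rule inj_onI)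
    fix p p' assume p: "p \<in> G" "p' \<in> G" "\<phi> p = \<phi> p'"
    then have "p \<in> Pow A \<times> Pow B" "p' \<in> Pow A \<times> Pow B" using G(1) by auto
    then show "p = p'" using \<phi>_inj[of "fst p" "snd p" "fst p'" "snd p'"] p(3)
      by (simp add: prod_eq_iff mem_Times_iff)
  qed
  define F where "F = \<phi> ` G"
  let ?ns = "replicate m1 n1 @ replicate m2 n2"
  have deg: "card {S \<in> F. i \<in> S} = ?ns ! i" if i: "i < m1 + m2" for i
  proof (cases "i < m1")
    case True
    then obtain a where a: "a \<in> A" "i = f a" using f by (auto simp: bij_betw_def)
    have "i \<in> \<phi> p \<longleftrightarrow> a \<in> fst p" if "p \<in> G" for p
      using fmem[OF a(1), of "fst p" "snd p"] G(1) a(2) that by auto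
    then have "{S \<in> F. i \<in> S} = \<phi> ` {p \<in> G. a \<in> fst p}" by (auto simp: F_def)
    then have "card {S \<in> F. i \<in> S} = n1"
      using degA[OF a(1)] card_image[OF inj_on_subset[OF inj]] by fastforce
    then show ?thesis using True by (simp add: nth_append)
  next
    case False
    then have "i \<in> g ` B" using g i by (auto simp: bij_betw_def)
    then obtain b where b: "b \<in> B" "i = g b" by blast
    have "i \<in> \<phi> p \<longleftrightarrow> b \<in> snd p" if "p \<in> G" for p
      using gmem[OF b(1), of "fst p" "snd p"] G(1) b(2) that by auto
    then have "{S \<in> F. i \<in> S} = \<phi> ` {p \<in> G. b \<in> snd p}" by (auto simp: F_def)
    then have "card {S \<in> F. i \<in> S} = n2"
      using degB[OF b(1)] card_image[OF inj_on_subset[OF inj]] by fastforce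
    then show ?thesis using False i by (simp add: nth_append)
  qed
  have FI: "F \<subseteq> Pow ?I - {{}}"
  proof
    fix S assume "S \<in> F"
    then obtain X T where XT: "(X, T) \<in> G" "S = f ` X \<union> g ` T" by (auto simp: F_def \<phi>_def)
    then have "X \<subseteq> A" "T \<subseteq> B" "X \<noteq> {} \<or> T \<noteq> {}" using G by auto
    moreover have "f ` X \<subseteq> ?I" "g ` T \<subseteq> ?I" using \<open>X \<subseteq> A\<close> \<open>T \<subseteq> B\<close> fA gB by fastforce+
    ultimately show "S \<in> Pow ?I - {{}}" using XT by auto
  qed
  have "rigid_family ?I F"
    unfolding rigid_family_def
  proof (intro conjI allI impI FI)
    fix \<sigma> assume "\<sigma> permutes ?I \<and> (`) \<sigma> ` F = F"
    then have \<sigma>: "\<sigma> permutes ?I" and \<sigma>F: "(`) \<sigma> ` F = F" by auto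
    have inv: "card {S \<in> F. \<sigma> i \<in> S} = card {S \<in> F. i \<in> S}" for i
    proof -
      have "{S \<in> F. \<sigma> i \<in> S} = {S \<in> (`) \<sigma> ` F. \<sigma> i \<in> S}" using \<sigma>F by simp
      also have "\<dots> = (`) \<sigma> ` {S \<in> F. i \<in> S}"
        by (auto simp: inj_eq[OF permutes_inj[OF \<sigma>]])
      finally have "{S \<in> F. \<sigma> i \<in> S} = (`) \<sigma> ` {S \<in> F. i \<in> S}" .
      moreover have "inj_on ((`) \<sigma>) {S \<in> F. i \<in> S}"
        using permutes_inj[OF \<sigma>] by (auto simp: inj_on_def inj_image_eq_iff)
      ultimately show ?thesis by (simp add: card_image)
    qed
    have lt: "\<sigma> i < m1 \<longleftrightarrow> i < m1" if "i < m1 + m2" for i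
    proof -
      have "\<sigma> i < m1 + m2" using permutes_in_image[OF \<sigma>] that by blast
      then have "?ns ! (\<sigma> i) = ?ns ! i" using inv[of i] deg that by metis
      then show ?thesis using n(1) that \<open>\<sigma> i < m1 + m2\<close> by (auto simp: nth_append split: if_splits)
    qed
    define \<sigma>A where "\<sigma>A x = (if x \<in> A then inv_into A f (\<sigma> (f x)) else x)" for x
    define \<sigma>B where "\<sigma>B y = (if y \<in> B then inv_into B g (\<sigma> (g y)) else y)" for y
    have \<sigma>A: "\<sigma>A x \<in> A \<and> f (\<sigma>A x) = \<sigma> (f x)" if "x \<in> A" for x
    proof -
      have "\<sigma> (f x) \<in> f ` A" using f lt[of "f x"] fA[OF that] by (auto simp: bij_betw_def)
      then show ?thesis using that by (simp add: \<sigma>A_def inv_into_into f_inv_into_f)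
    qed
    have \<sigma>B: "\<sigma>B y \<in> B \<and> g (\<sigma>B y) = \<sigma> (g y)" if "y \<in> B" for y
    proof -
      have "\<sigma> (g y) < m1 + m2" using permutes_in_image[OF \<sigma>] gB[OF that] by blast
      then have "\<sigma> (g y) \<in> g ` B" using g lt[of "g y"] gB[OF that] by (auto simp: bij_betw_def)
      then show ?thesis using that by (simp add: \<sigma>B_def inv_into_into f_inv_into_f)
    qed
    have inj\<sigma>: "\<sigma> i = \<sigma> j \<longleftrightarrow> i = j" for i j using permutes_inj[OF \<sigma>] by (auto dest: injD)
    have pA: "\<sigma>A permutes A"
    proof (rule bij_imp_permutes)
      have "inj_on \<sigma>A A" using \<sigma>A inj\<sigma> f_inj by (intro inj_onI) metis
      then show "bij_betw \<sigma>A A A" using \<sigma>A fin by (simp add: bij_betw_def endo_inj_surj image_subsetI)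
    qed (simp add: \<sigma>A_def)
    have pB: "\<sigma>B permutes B"
    proof (rule bij_imp_permutes)
      have "inj_on \<sigma>B B" using \<sigma>B inj\<sigma> g_inj by (intro inj_onI) metis
      then show "bij_betw \<sigma>B B B" using \<sigma>B fin by (simp add: bij_betw_def endo_inj_surj image_subsetI)
    qed (simp add: \<sigma>B_def)
    have \<phi>\<sigma>: "\<phi> (\<sigma>A ` X, \<sigma>B ` T) = \<sigma> ` \<phi> (X, T)" if "X \<subseteq> A" "T \<subseteq> B" for X T
    proof -
      have "f ` \<sigma>A ` X = \<sigma> ` f ` X" unfolding image_image using \<sigma>A that by (intro image_cong) auto
      moreover have "g ` \<sigma>B ` T = \<sigma> ` g ` T" unfolding image_image using \<sigma>B that by (intro image_cong) auto
      ultimately show ?thesis by (simp add: \<phi>_def image_Un)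
    qed
    have "(\<lambda>(X, T). (\<sigma>A ` X, \<sigma>B ` T)) ` G = G"
    proof (rule endo_inj_surj)
      show "finite G" using G fin by (meson finite_Pow_iff finite_SigmaI finite_subset)
      show "(\<lambda>(X, T). (\<sigma>A ` X, \<sigma>B ` T)) ` G \<subseteq> G"
      proof (rule image_subsetI, clarify)
        fix X T assume XT: "(X, T) \<in> G"
        then have sub: "X \<subseteq> A" "T \<subseteq> B" using G by auto
        have "\<sigma> ` \<phi> (X, T) \<in> (`) \<sigma> ` F" using XT by (simp add: F_def)
        then have "\<sigma> ` \<phi> (X, T) \<in> F" using \<sigma>F by simp
        then obtain X' T' where X'T': "(X', T') \<in> G" "\<sigma> ` \<phi> (X, T) = \<phi> (X', T')" by (auto simp: F_def)
        then have "\<phi> (\<sigma>A ` X, \<sigma>B ` T) = \<phi> (X', T')" using \<phi>\<sigma>[OF sub] by simp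
        moreover have "\<sigma>A ` X \<subseteq> A" "\<sigma>B ` T \<subseteq> B" using sub \<sigma>A \<sigma>B by auto
        ultimately have "\<sigma>A ` X = X' \<and> \<sigma>B ` T = T'" using X'T' G by (intro \<phi>_inj) auto
        then show "(\<sigma>A ` X, \<sigma>B ` T) \<in> G" using X'T' by simp
      qed
      show "inj_on (\<lambda>(X, T). (\<sigma>A ` X, \<sigma>B ` T)) G"
        using permutes_inj[OF pA] permutes_inj[OF pB] by (auto simp: inj_on_def inj_image_eq_iff)
    qed
    then have id: "\<sigma>A = id" "\<sigma>B = id" using rigid[OF pA pB] by auto
    show "\<sigma> = id"
    proof
      fix i show "\<sigma> i = id i"
      proof (cases "i < m1 + m2")
        case True
        then have "i \<in> f ` A \<or> i \<in> g ` B" using f g by (auto simp: bij_betw_def)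
        then show ?thesis using \<sigma>A \<sigma>B id by auto
      qed (use \<sigma> in \<open>simp add: permutes_not_in\<close>)
    qed
  qed
  moreover have "length ?ns = m1 + m2" by simp
  moreover have "\<forall>i<m1 + m2. ?ns ! i > 0" using n by (simp add: nth_append)
  ultimately show ?thesis
    unfolding K_def m1_def[symmetric] m2_def[symmetric]
    using distinguishing_partition_of_rigid_family[of ?ns F] deg by simp
qed

text \<open>For \<open>n1 = n2\<close> the two kinds of parts may be exchanged, so rigidity has to
  hold on all parts at once.\<close>

lemma distinguishing_partition_equal_sizes:
  assumes "rigid_family {..<m1 + m2} F" "\<And>i. i < m1 + m2 \<Longrightarrow> card {S \<in> F. i \<in> S} = n" "0 < n"
  shows "\<exists>P. distinguishing_partition (K m1 n m2 n) P"
  using distinguishing_partition_of_rigid_family[of "replicate (m1 + m2) n" F] assms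
  by (simp add: K_def flip: replicate_add)

section \<open>Rigid families on the parts of size n1\<close>

text \<open>The pair \<open>{t - 1, t}\<close> cut down to points below \<open>m\<close>: a link of
  the path for \<open>0 < t < m\<close>, and an end as a singleton for \<open>t = 0\<close> and
  \<open>t = m\<close>.\<close>

definition seg :: "nat \<Rightarrow> nat \<Rightarrow> nat set" where
  "seg m t = {u. u < m \<and> (u = t \<or> Suc u = t)}"

lemma seg_0: "0 < m \<Longrightarrow> seg m 0 = {0}"
  by (auto simp: seg_def)

lemma seg_Suc: "Suc t < m \<Longrightarrow> seg m (Suc t) = {t, Suc t}"
  by (auto simp: seg_def)

lemma seg_last: "0 < m \<Longrightarrow> seg m m = {m - 1}"
  by (auto simp: seg_def)

lemma inj_on_seg:
  assumes "2 \<le> m" shows "inj_on (seg m) {..m}"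
proof (rule inj_onI)
  have "s = t" if "s \<le> t" "t \<le> m" "seg m s = seg m t" for s t
  proof (rule ccontr)
    assume "s \<noteq> t"
    then have st: "s < t" using that by simp
    then have "s \<in> seg m s" using that(2) by (simp add: seg_def)
    then have "s \<in> seg m t" using that by simp
    then have t: "t = Suc s" using st by (auto simp: seg_def)
    show False
    proof (cases "t = m")
      case True
      then have "s - 1 \<in> seg m s" "s - 1 \<notin> seg m t" using t assms by (auto simp: seg_def)
      then show False using that by simp
    next
      case False
      then have "t \<in> seg m t" "t \<notin> seg m s" using t that(2) by (simp_all add: seg_def)
      then show False using that by simp
    qed
  qed
  then show "s = t" if "s \<in> {..m}" "t \<in> {..m}" "seg m s = seg m t" for s t
    using that by (metis atMost_iff nat_le_linear)
qed

lemma card_seg_eq_2_iff: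
  assumes "t \<le> m" "0 < m"
  shows "card (seg m t) = 2 \<longleftrightarrow> 0 < t \<and> t < m"
proof (cases t)
  case 0
  then show ?thesis using assms by (simp add: seg_0)
next
  case (Suc s)
  show ?thesis
  proof (cases "t = m")
    case True
    then show ?thesis using assms by (simp add: seg_last)
  next
    case False
    then show ?thesis using assms Suc by (simp add: seg_Suc)
  qed
qed

lemma card_seg_le: "card (seg m t) \<le> 2"
proof -
  have "seg m t \<subseteq> {t, t - 1}" by (auto simp: seg_def)
  then have "card (seg m t) \<le> card {t, t - 1}" by (intro card_mono) auto
  also have "\<dots> \<le> 2" by (simp add: card_insert_if)
  finally show ?thesis .
qed

lemma segs_card_2:
  assumes "0 < m" "T \<subseteq> {..m}" "{1..<m} \<subseteq> T"
  shows "{X \<in> seg m ` T. card X = 2} = {{t, Suc t} | t. Suc t < m}"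
proof
  show "{X \<in> seg m ` T. card X = 2} \<subseteq> {{t, Suc t} | t. Suc t < m}"
  proof
    fix X assume "X \<in> {X \<in> seg m ` T. card X = 2}"
    then obtain t where t: "t \<in> T" "X = seg m t" "card (seg m t) = 2" by auto
    then have "0 < t \<and> t < m" using assms card_seg_eq_2_iff[of t m] by auto
    then obtain s where s: "t = Suc s" "Suc s < m" by (cases t) auto
    then show "X \<in> {{t, Suc t} | t. Suc t < m}" using t seg_Suc[of s m] by auto
  qed
  show "{{t, Suc t} | t. Suc t < m} \<subseteq> {X \<in> seg m ` T. card X = 2}"
  proof
    fix X assume "X \<in> {{t, Suc t} | t. Suc t < m}"
    then obtain t where t: "X = {t, Suc t}" "Suc t < m" by auto
    moreover have "Suc t \<in> T" using t assms by auto
    ultimately show "X \<in> {X \<in> seg m ` T. card X = 2}" using seg_Suc[of t m] by auto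
  qed
qed

lemma segs_containing: "a < m \<Longrightarrow> {t \<in> {..m}. a \<in> seg m t} = {a, Suc a}"
  by (auto simp: seg_def)

text \<open>Every point lies in two of the sets \<open>seg m t\<close>, and a cut at
  \<open>k\<close> adds one more set through it, the initial or the final piece. With
  \<open>n - 2\<close> cuts all degrees are \<open>n\<close>. The cuts lie near the start of the
  path, which excludes its reversal.\<close>

definition split_path_family :: "nat \<Rightarrow> nat \<Rightarrow> nat set set" where
  "split_path_family m n = seg m ` {..m} \<union> (\<lambda>k. {..<k}) ` {3..n} \<union> (\<lambda>k. {k..<m}) ` {3..n}"

lemma split_path_family:
  assumes n: "3 \<le> n" and m: "2 * n + 4 \<le> m"
  shows "split_path_family m n \<subseteq> Pow {..<m} - {{}}"
    and "a < m \<Longrightarrow> card {X \<in> split_path_family m n. a \<in> X} = n"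
    and "m < card (split_path_family m n)"
    and "rigid_family {..<m} (split_path_family m n)"
proof -
  let ?H = "split_path_family m n"
  have "t - 1 \<in> seg m t" if "t \<le> m" for t using that m by (auto simp: seg_def)
  then have 1: "seg m t \<in> Pow {..<m} - {{}}" if "t \<le> m" for t using that by (fastforce simp: seg_def)
  have 2: "{..<k} \<in> Pow {..<m} - {{}}" "{k..<m} \<in> Pow {..<m} - {{}}" if "k \<in> {3..n}" for k
    using that m by (auto simp: lessThan_empty_iff)
  show sub: "?H \<subseteq> Pow {..<m} - {{}}"
    unfolding split_path_family_def using 1 2 by (intro Un_least image_subsetI) auto
  show "m < card ?H"
  proof -
    have "card (seg m ` {..m}) \<le> card ?H"
      using sub by (intro card_mono) (auto simp: split_path_family_def)
    then show ?thesis using inj_on_seg[of m] m by (simp add: card_image)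
  qed
  show "card {X \<in> ?H. a \<in> X} = n" if a: "a < m"
  proof -
    \<comment> \<open>The piece of the cut at \<open>k\<close> that contains
      \<open>a\<close>.\<close>
    let ?c = "\<lambda>k. if a < k then {..<k} else {k..<m}"
    have "{X \<in> ?H. a \<in> X} = seg m ` {t \<in> {..m}. a \<in> seg m t} \<union> ?c ` {3..n}"
      using a by (auto simp: split_path_family_def image_iff split: if_splits)
    also have "\<dots> = seg m ` {a, Suc a} \<union> ?c ` {3..n}" using segs_containing[OF a] by simp
    also have "card \<dots> = card (seg m ` {a, Suc a}) + card (?c ` {3..n})"
    proof (rule card_Un_disjoint)
      have c3: "3 \<le> card (?c k)" if "k \<in> {3..n}" for k using that m by auto
      show "seg m ` {a, Suc a} \<inter> ?c ` {3..n} = {}"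
      proof (rule equals0I)
        fix X assume X: "X \<in> seg m ` {a, Suc a} \<inter> ?c ` {3..n}"
        then obtain t k where "X = seg m t" "k \<in> {3..n}" "X = ?c k" by blast
        then show False using card_seg_le[of m t] c3[of k] by simp
      qed
    qed auto
    also have "card (seg m ` {a, Suc a}) = 2"
    proof -
      have "seg m a \<noteq> seg m (Suc a)" using inj_onD[OF inj_on_seg, of m a "Suc a"] a m by auto
      then show ?thesis by simp
    qed
    also have "card (?c ` {3..n}) = n - 2"
    proof (subst card_image)
      show "inj_on ?c {3..n}"
      proof (rule inj_onI)
        fix k l assume kl: "k \<in> {3..n}" "l \<in> {3..n}" "?c k = ?c l"
        have "0 \<in> ?c k \<longleftrightarrow> a < k" "0 \<in> ?c l \<longleftrightarrow> a < l" using kl(1,2) by auto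
        then have iff: "a < k \<longleftrightarrow> a < l" using kl(3) by metis
        show "k = l"
        proof (cases "a < k")
          case True
          then have "{..<k} = {..<l}" using kl(3) iff by simp
          then show ?thesis by simp
        next
          case False
          then have "{k..<m} = {l..<m}" using kl(3) iff by simp
          then show ?thesis using kl(1,2) m atLeastLessThan_eq_iff[of k m l m] by auto
        qed
      qed
    qed (use n in simp)
    finally show ?thesis using n by simp
  qed
  show "rigid_family {..<m} ?H"
    unfolding rigid_family_def
  proof (intro conjI allI impI sub)
    fix \<sigma> assume "\<sigma> permutes {..<m} \<and> (`) \<sigma> ` ?H = ?H"
    then have \<sigma>: "\<sigma> permutes {..<m}" and \<sigma>H: "(`) \<sigma> ` ?H = ?H" by auto
    have "{X \<in> ?H. card X = 2} = {X \<in> seg m ` {..m}. card X = 2}"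
      using n m by (auto simp: split_path_family_def)
    also have "\<dots> = {{t, Suc t} | t. Suc t < m}" by (rule segs_card_2) (use m in auto)
    finally have "(`) \<sigma> ` {{t, Suc t} | t. Suc t < m} = {{t, Suc t} | t. Suc t < m}"
      using image_filter_card[OF permutes_inj[OF \<sigma>] \<sigma>H, of "\<lambda>x. x = 2"] by simp
    then have "\<sigma> = id \<or> (\<forall>t<m. \<sigma> t = m - 1 - t)"
      using single_path_automorphism[of m \<sigma>] \<sigma> m by simp
    moreover have "\<not> (\<forall>t<m. \<sigma> t = m - 1 - t)"
    proof
      assume rev: "\<forall>t<m. \<sigma> t = m - 1 - t"
      \<comment> \<open>The reversal would send it to a set of three elements containing
        \<open>m - 1\<close>. The sets \<open>seg m t\<close> are smaller, initial pieces omit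
        \<open>m - 1\<close>, and final pieces are larger.\<close>
      have "{..<3} \<in> ?H" using n by (auto simp: split_path_family_def)
      then have mem: "\<sigma> ` {..<3} \<in> ?H" using \<sigma>H by blast
      have last: "m - 1 \<in> \<sigma> ` {..<3}" using rev m by (intro rev_image_eqI[of 0]) auto
      have card: "card (\<sigma> ` {..<3}) = 3"
        using card_image[OF permutes_inj_on[OF \<sigma>], of "{..<3}"] by simp
      from mem consider t where "\<sigma> ` {..<3} = seg m t"
        | k where "k \<in> {3..n}" "\<sigma> ` {..<3} = {..<k}" | k where "k \<in> {3..n}" "\<sigma> ` {..<3} = {k..<m}"
        by (auto simp: split_path_family_def)
      then show False
      proof cases
        case 1
        then show False using card card_seg_le[of m t] by simp
      next
        case 2
        then show False using last m by auto
      next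
        case 3
        then show False using card m by auto
      qed
    qed
    ultimately show "\<sigma> = id" by blast
  qed
qed

text \<open>The incidence graph is a theta with pendant vertices attached. Its branch vertices, the
  point \<^term>\<open>1\<close> and the set \<^term>\<open>{0, 1, m - 1}\<close>, lie on different sides of the bipartition.\<close>

definition theta_family :: "nat \<Rightarrow> nat set set" where
  "theta_family m = seg m ` {1..<m} \<union> (\<lambda>i. {i}) ` ({..<m} - {1}) \<union> {{0, 1, m - 1}}"

text \<open>The reversal of the path is excluded by the only set of three elements, as it sends
  \<open>1\<close> to \<open>m - 2\<close>. The size \<open>2 * m - 1\<close> is what allows large
  values of \<open>n2\<close> for \<open>m2 = 1\<close>.\<close>

lemma theta_family:
  assumes m: "5 \<le> m"
  shows "theta_family m \<subseteq> Pow {..<m} - {{}}"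
    and "a < m \<Longrightarrow> card {X \<in> theta_family m. a \<in> X} = 3"
    and "card (theta_family m) = 2 * m - 1"
    and "\<sigma> permutes {..<m} \<Longrightarrow> (`) \<sigma> ` theta_family m = theta_family m \<Longrightarrow> \<sigma> = id"
proof -
  let ?H = "theta_family m"
  have seg_c: "card (seg m t) = 2" if "t \<in> {1..<m}" for t using that card_seg_eq_2_iff[of t m] by auto
  have c3: "card {0, 1, m - 1} = 3" using m by (simp add: card_insert_if)
  have seg_ne: "seg m t \<noteq> {}" if "t \<in> {1..<m}" for t using seg_c[OF that] by auto
  show "?H \<subseteq> Pow {..<m} - {{}}"
    using seg_ne m by (auto simp: theta_family_def seg_def)
  have inj: "inj_on (seg m) {1..<m}" by (rule inj_on_subset[OF inj_on_seg]) (use m in auto)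
  have d1: "seg m ` T \<inter> (\<lambda>i. {i}) ` S = {}" if "T \<subseteq> {1..<m}" for T S
    using seg_c that by (force simp: subset_iff)
  have d2: "{0, 1, m - 1} \<notin> seg m ` T \<union> (\<lambda>i. {i}) ` S" if "T \<subseteq> {1..<m}" for T S
    using seg_c c3 that by (force simp: subset_iff)
  show "card ?H = 2 * m - 1"
  proof -
    have "card ?H = Suc (card (seg m ` {1..<m} \<union> (\<lambda>i. {i}) ` ({..<m} - {1})))"
      using d2[of "{1..<m}"] by (simp add: theta_family_def)
    also have "card (seg m ` {1..<m} \<union> (\<lambda>i. {i}) ` ({..<m} - {1})) = (m - 1) + (m - 1)"
      using d1[of "{1..<m}"] inj m by (subst card_Un_disjoint) (auto simp: card_image)
    finally show ?thesis using m by simp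
  qed
  show "card {X \<in> ?H. a \<in> X} = 3" if a: "a < m"
  proof -
    define T where "T = {t \<in> {1..<m}. t = a \<or> t = Suc a}"
    have T: "T \<subseteq> {1..<m}" by (auto simp: T_def)
    have 1: "a \<in> seg m t \<longleftrightarrow> t = a \<or> t = Suc a" for t using a by (auto simp: seg_def)
    have "{X \<in> ?H. a \<in> X} = seg m ` T \<union> (\<lambda>i. {i}) ` ({a} - {1}) \<union> ({{0, 1, m - 1}} \<inter> {X. a \<in> X})"
      using a by (auto simp: theta_family_def T_def 1)
    moreover have "card (seg m ` T \<union> (\<lambda>i. {i}) ` ({a} - {1})) = card T + card ({a} - {1})"
      using d1[OF T, of "{a} - {1}"] inj_on_subset[OF inj T] finite_subset[OF T]
      by (subst card_Un_disjoint) (simp_all add: card_image)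
    moreover have "card (seg m ` T \<union> (\<lambda>i. {i}) ` ({a} - {1}) \<union> ({{0, 1, m - 1}} \<inter> {X. a \<in> X})) =
        card (seg m ` T \<union> (\<lambda>i. {i}) ` ({a} - {1})) + card ({{0, 1, m - 1}} \<inter> {X. a \<in> X})"
    proof (rule card_Un_disjoint)
      show "(seg m ` T \<union> (\<lambda>i. {i}) ` ({a} - {1})) \<inter> ({{0, 1, m - 1}} \<inter> {X. a \<in> X}) = {}"
        using d2[OF T, of "{a} - {1}"] by blast
    qed (use finite_subset[OF T] in auto)
    moreover have "T = (if a = 0 then {1} else if a = m - 1 then {a} else {a, Suc a})"
      using a m by (auto simp: T_def)
    moreover have "{{0, 1, m - 1}} \<inter> {X. a \<in> X} = (if a = 0 \<or> a = 1 \<or> a = m - 1 then {{0, 1, m - 1}} else {})"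
      by auto
    ultimately show ?thesis using m by (auto simp: card_insert_if)
  qed
  assume \<sigma>: "\<sigma> permutes {..<m}" and \<sigma>H: "(`) \<sigma> ` ?H = ?H"
  have "{X \<in> ?H. card X = 2} = {X \<in> seg m ` {1..<m}. card X = 2}"
    using c3 by (auto simp: theta_family_def)
  also have "\<dots> = {{t, Suc t} | t. Suc t < m}"
    by (rule segs_card_2) (use m in auto)
  finally have "(`) \<sigma> ` {{t, Suc t} | t. Suc t < m} = {{t, Suc t} | t. Suc t < m}"
    using image_filter_card[OF permutes_inj[OF \<sigma>] \<sigma>H, of "\<lambda>x. x = 2"] by simp
  then have "\<sigma> = id \<or> (\<forall>t<m. \<sigma> t = m - 1 - t)"
    using single_path_automorphism[of m \<sigma>] \<sigma> m by simp
  moreover have "\<not> (\<forall>t<m. \<sigma> t = m - 1 - t)"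
  proof
    assume rev: "\<forall>t<m. \<sigma> t = m - 1 - t"
    have "{X \<in> ?H. card X = 3} = {{0, 1, m - 1}}"
      using c3 seg_c by (auto simp: theta_family_def)
    then have "(`) \<sigma> ` {{0, 1, m - 1}} = {{0, 1, m - 1}}"
      using image_filter_card[OF permutes_inj[OF \<sigma>] \<sigma>H, of "\<lambda>x. x = 3"] by simp
    then have "\<sigma> 1 \<in> {0, 1, m - 1}" by blast
    then show False using rev m by auto
  qed
  ultimately show "\<sigma> = id" by blast
qed

section \<open>Attaching the parts of size n2 to a rigid base\<close>

lemma le_binomial:
  assumes "1 \<le> k" "k < n"
  shows "n \<le> n choose k"
  using assms
proof (induction n arbitrary: k)
  case (Suc n)
  obtain l where l: "k = Suc l" using Suc.prems by (cases k) auto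
  show ?case
  proof (cases "k = n")
    case True
    then show ?thesis by simp
  next
    case False
    then have "n \<le> n choose k" using Suc by simp
    moreover have "1 \<le> n choose l" using Suc.prems l by (simp add: Suc_leI)
    ultimately show ?thesis by (simp add: l)
  qed
qed simp

text \<open>As \<open>H\<close> is rigid, \<open>\<sigma>\<close> is trivial. Then
  \<open>\<pi>\<close> preserves the set of elements attached to each member of \<open>H\<close>,
  and since the families \<open>Y b\<close> are distinct, it fixes every \<open>b\<close>. An empty
  member of \<open>H\<close> must be attached to some \<open>b\<close>, because blocks are
  nonempty.\<close>

lemma distinguishing_partition_of_rigid_base:
  fixes H :: "nat set set" and Y :: "nat \<Rightarrow> nat set set"
  assumes H: "H \<subseteq> Pow {..<m1}" and degH: "\<And>a. a < m1 \<Longrightarrow> card {X \<in> H. a \<in> X} = n1"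
    and rigidH: "\<And>\<sigma>. \<sigma> permutes {..<m1} \<Longrightarrow> (`) \<sigma> ` H = H \<Longrightarrow> \<sigma> = id"
    and Y: "inj_on Y {..<m2}" "\<And>b. b < m2 \<Longrightarrow> Y b \<subseteq> H \<and> card (Y b) = n2"
    and empty: "{} \<in> H \<Longrightarrow> \<exists>b<m2. {} \<in> Y b"
    and n: "n1 \<noteq> n2" "0 < n1" "0 < n2"
  shows "\<exists>P. distinguishing_partition (K m1 n1 m2 n2) P"
proof -
  define f where "f X = (X, {b. b < m2 \<and> X \<in> Y b})" for X
  define G where "G = f ` H"
  have inj: "inj_on f S" for S by (auto simp: f_def inj_on_def)
  have "\<exists>P. distinguishing_partition (K (card {..<m1}) n1 (card {..<m2}) n2) P"
  proof (rule distinguishing_partition_of_pairs[where G = G])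
    show "G \<subseteq> Pow {..<m1} \<times> Pow {..<m2}" using H by (auto simp: G_def f_def)
    show "({}, {}) \<notin> G" using empty by (auto simp: G_def f_def)
    show "card {p \<in> G. a \<in> fst p} = n1" if "a \<in> {..<m1}" for a
    proof -
      have "fst (f X) = X" for X by (simp add: f_def)
      then have "{p \<in> G. a \<in> fst p} = f ` {X \<in> H. a \<in> X}" by (auto simp: G_def)
      then show ?thesis using degH that card_image[OF inj] by simp
    qed
    show "card {p \<in> G. b \<in> snd p} = n2" if "b \<in> {..<m2}" for b
    proof -
      have "{p \<in> G. b \<in> snd p} = f ` Y b" using Y(2) that by (auto simp: G_def f_def)
      then show ?thesis using Y(2) that card_image[OF inj] by simp
    qed
    fix \<sigma> \<pi> assume \<sigma>: "\<sigma> permutes {..<m1}" and \<pi>: "\<pi> permutes {..<m2}"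
      and G: "(\<lambda>(X, T). (\<sigma> ` X, \<pi> ` T)) ` G = G"
    have "(`) \<sigma> ` H = fst ` (\<lambda>(X, T). (\<sigma> ` X, \<pi> ` T)) ` G"
      by (auto simp: G_def f_def image_image)
    also have "\<dots> = H" unfolding G by (auto simp: G_def f_def image_image)
    finally have id: "\<sigma> = id" using rigidH[OF \<sigma>] by blast
    have fix_T: "\<pi> ` {b. b < m2 \<and> X \<in> Y b} = {b. b < m2 \<and> X \<in> Y b}" if "X \<in> H" for X
    proof -
      have "f X \<in> G" using that by (simp add: G_def)
      then have "(\<lambda>(X, T). (\<sigma> ` X, \<pi> ` T)) (f X) \<in> G" using G by blast
      then show ?thesis by (auto simp: G_def f_def id)
    qed
    have "\<pi> b = b" if b: "b < m2" for b
    proof -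
      have \<pi>b: "\<pi> b < m2" using permutes_in_image[OF \<pi>] b by blast
      have "X \<in> Y (\<pi> b) \<longleftrightarrow> X \<in> Y b" if "X \<in> H" for X
      proof -
        have "X \<in> Y b \<longleftrightarrow> \<pi> b \<in> \<pi> ` {b. b < m2 \<and> X \<in> Y b}"
          using b permutes_inj[OF \<pi>] by (simp add: inj_image_mem_iff)
        then show ?thesis using fix_T[OF that] \<pi>b by simp
      qed
      then have "Y (\<pi> b) = Y b" using Y(2)[OF b] Y(2)[OF \<pi>b] by blast
      then show ?thesis using Y(1) b \<pi>b by (auto simp: inj_on_def)
    qed
    then have "\<pi> = id" using \<pi> by (metis eq_id_iff lessThan_iff permutes_not_in)
    with id show "\<sigma> = id \<and> \<pi> = id" by blast
  qed (use n in auto)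
  then show ?thesis by simp
qed

text \<open>A base of more than \<open>m1\<close> sets has more than \<open>m1\<close> subfamilies
  of size \<open>n2\<close>, enough for \<open>m2\<close> different ones.\<close>

lemma distinguishing_partition_small:
  assumes n1: "3 \<le> n1" and m1: "2 * n1 + 4 \<le> m1" and n2: "1 \<le> n2" "n2 \<le> m1" "n2 \<noteq> n1" and m2: "m2 \<le> m1"
  shows "\<exists>P. distinguishing_partition (K m1 n1 m2 n2) P"
proof -
  let ?H = "split_path_family m1 n1"
  note H = split_path_family[OF n1 m1]
  have fin: "finite ?H" using H(1) finite_subset by blast
  let ?S = "{Y. Y \<subseteq> ?H \<and> card Y = n2}"
  have "m2 \<le> card ?H" using m2 H(3) by simp
  also have "\<dots> \<le> card ?H choose n2" using n2 H(3) by (intro le_binomial) auto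
  also have "\<dots> = card ?S" using n_subsets[OF fin] by simp
  finally have "card {..<m2} \<le> card ?S" by simp
  moreover have "finite ?S" using fin by simp
  ultimately obtain Y where Y: "Y ` {..<m2} \<subseteq> ?S" "inj_on Y {..<m2}"
    using card_le_inj[of "{..<m2}" ?S] by auto
  show ?thesis
  proof (rule distinguishing_partition_of_rigid_base[of ?H m1 n1 Y m2 n2])
    show "\<sigma> = id" if "\<sigma> permutes {..<m1}" "(`) \<sigma> ` ?H = ?H" for \<sigma>
      using H(4) that by (auto simp: rigid_family_def)
  qed (use H(1,2) Y n1 n2 in auto)
qed

text \<open>A single base on all \<open>m1 + m2\<close> parts suffices, since they have the same
  size.\<close>

lemma distinguishing_partition_same_size:
  assumes n1: "3 \<le> n1" and m1: "2 * n1 + 4 \<le> m1"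
  shows "\<exists>P. distinguishing_partition (K m1 n1 m2 n1) P"
  using split_path_family[of n1 "m1 + m2"] assms
  by (intro distinguishing_partition_equal_sizes[of m1 m2 "split_path_family (m1 + m2) n1"]) auto

lemma distinguishing_partition_one_part:
  assumes m1: "5 \<le> m1" and n2: "1 \<le> n2" "n2 \<le> 2 * m1" "n2 \<noteq> 3"
  shows "\<exists>P. distinguishing_partition (K m1 3 1 n2) P"
proof -
  let ?H = "theta_family m1"
  note H = theta_family[OF m1]
  have fin: "finite ?H" using H(1) finite_subset by blast
  have e: "{} \<notin> ?H" using H(1) by auto
  show ?thesis
  proof (cases "n2 = 2 * m1")
    case False
    then have "n2 \<le> card ?H" using H(3) n2 by simp
    then obtain Z where Z: "Z \<subseteq> ?H" "card Z = n2" by (rule obtain_subset_with_card_n)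
    show ?thesis
      by (rule distinguishing_partition_of_rigid_base[of ?H m1 3 "\<lambda>_. Z"])
        (use H(1,2,4) Z n2 e in \<open>auto simp: inj_on_def\<close>)
  next
    case True
    \<comment> \<open>This value exceeds the size of the base by one. The empty set stands for an
      extra block that consists of one vertex of the part of size \<open>n2\<close>.\<close>
    let ?H' = "insert {} ?H"
    have "card ?H' = n2" using True H(3) fin e m1 by simp
    moreover have "\<sigma> = id" if "\<sigma> permutes {..<m1}" "(`) \<sigma> ` ?H' = ?H'" for \<sigma>
    proof (rule H(4)[OF that(1)])
      have "{} \<notin> (`) \<sigma> ` ?H" using e by auto
      moreover have "insert {} ((`) \<sigma> ` ?H) = insert {} ?H" using that(2) by simp
      ultimately show "(`) \<sigma> ` ?H = ?H" using e by (metis Diff_insert_absorb)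
    qed
    moreover have "card {X \<in> ?H'. a \<in> X} = 3" if "a < m1" for a
    proof -
      have "{X \<in> ?H'. a \<in> X} = {X \<in> ?H. a \<in> X}" by auto
      then show ?thesis using H(2)[OF that] by simp
    qed
    ultimately show ?thesis
      using H(1) n2 by (intro distinguishing_partition_of_rigid_base[of ?H' m1 3 "\<lambda>_. ?H'"])
        (auto simp: inj_on_def)
  qed
qed

section \<open>Families built from paths\<close>

text \<open>Types are traces on \<open>B\<close>. End types are not large, so they are not confused
  with those of the classes; \<open>U i\<close> and \<open>U' i\<close> differ, so no path can be
  reversed while \<open>B\<close> is fixed; \<open>Y\<close> does not have two elements, so it is
  not mistaken for a link.\<close>

locale typed_paths =
  fixes q :: nat and L :: "nat \<Rightarrow> nat" and B :: "'b set" and U U' :: "nat \<Rightarrow> 'b set"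
    and V :: "nat \<Rightarrow> nat \<Rightarrow> 'b set" and I :: "'b set set" and Y :: "(nat \<times> nat) set"
  assumes inj_L: "inj_on L {..<q}" and L2: "\<And>i. i < q \<Longrightarrow> 2 \<le> L i"
    and finite_B: "finite B"
    and U: "\<And>i. i < q \<Longrightarrow> U i \<subseteq> B \<and> 2 * card (U i) \<le> card B"
    and U': "\<And>i. i < q \<Longrightarrow> U' i \<subseteq> B \<and> 2 * card (U' i) \<le> card B"
    and U_neq: "\<And>i. i < q \<Longrightarrow> U i \<noteq> U' i"
    and V: "\<And>i t. V i t \<subseteq> B"
    and I: "I \<subseteq> Pow B - {{}}"
    and Y: "Y \<subseteq> path_points q L" "Y = {} \<or> 3 \<le> card Y"
begin

definition A :: "(nat \<times> nat) set" where "A = path_points q L"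

text \<open>Numbered like \<open>seg\<close>: on a path of the family, \<open>t = 0\<close> and
  \<open>t = L i\<close> give the ends, the values between them the links.\<close>

definition node :: "nat \<Rightarrow> nat \<Rightarrow> (nat \<times> nat) set" where
  "node i t = {(i, u) | u. u < L i \<and> (u = t \<or> Suc u = t)}"

definition node_type :: "nat \<Rightarrow> nat \<Rightarrow> 'b set" where
  "node_type i t = (if t = 0 then U i else if t = L i then U' i else V i t)"

definition nodes :: "(nat \<times> nat) set" where
  "nodes = {(i, t). i < q \<and> t \<le> L i}"

definition classes :: "(nat \<times> nat) set set" where
  "classes = (\<lambda>a. {a}) ` (A - Y) \<union> (if Y = {} then {} else {Y})"

text \<open>The nodes of a path are its links and its two ends. Each point moreover lies in one set of
  every large type, and the points of \<^term>\<open>Y\<close> share these sets; enlarging \<^term>\<open>Y\<close> thus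
  decreases the degrees of the elements of \<^term>\<open>B\<close>.\<close>

definition family :: "((nat \<times> nat) set \<times> 'b set) set" where
  "family = {{}} \<times> I \<union> classes \<times> large_sets B \<union> (\<lambda>(i, t). (node i t, node_type i t)) ` nodes"

lemma typed_node_in_family: "(i, t) \<in> nodes \<Longrightarrow> (node i t, node_type i t) \<in> family"
  unfolding family_def by force

lemma finite_A: "finite A" by (simp add: A_def)

lemma finite_I: "finite I"
proof (rule finite_subset)
  show "I \<subseteq> Pow B" using I by auto
qed (simp add: finite_B)

lemma node_0: "i < q \<Longrightarrow> node i 0 = {(i, 0)}"
  using L2 by (force simp: node_def)

lemma node_Suc: "Suc t < L i \<Longrightarrow> node i (Suc t) = {(i, t), (i, Suc t)}"
  by (auto simp: node_def)

lemma node_last: "i < q \<Longrightarrow> node i (L i) = {(i, L i - 1)}"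
  using L2[of i] by (auto simp: node_def)

lemma node_cases:
  assumes "(i, t) \<in> nodes"
  obtains "t = 0" "node i t = {(i, 0)}" "node_type i t = U i"
    | "t = L i" "node i t = {(i, L i - 1)}" "node_type i t = U' i"
    | s where "t = Suc s" "Suc s < L i" "node i t = {(i, s), (i, Suc s)}" "node_type i t = V i t"
proof -
  have i: "i < q" "t \<le> L i" "2 \<le> L i" using assms L2 by (auto simp: nodes_def)
  consider "t = 0" | "t = L i" | s where "t = Suc s" "Suc s < L i"
    using i by (cases t) (auto simp: le_less)
  then show thesis
    using that i node_0[of i] node_last[of i] node_Suc[of _ i] by cases (auto simp: node_type_def)
qed

lemma node_sub: "(i, t) \<in> nodes \<Longrightarrow> node i t \<subseteq> A"
  by (auto simp: nodes_def node_def A_def path_points_def)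

lemma node_ne: "(i, t) \<in> nodes \<Longrightarrow> node i t \<noteq> {}"
  by (erule node_cases) auto

lemma node_type_sub: "(i, t) \<in> nodes \<Longrightarrow> node_type i t \<subseteq> B"
  using U U' V by (auto simp: node_type_def nodes_def)

lemma inj_node: "inj_on (\<lambda>(i, t). node i t) nodes"
proof -
  have mem: "(j, u) \<in> node i t \<longleftrightarrow> j = i \<and> u < L i \<and> (u = t \<or> Suc u = t)" for i j t u
    by (auto simp: node_def)
  have *: "\<not> t < t'" if i: "i < q" "t' \<le> L i" "node i t = node i t'" for i t t'
  proof
    assume t: "t < t'"
    then have "(i, t) \<in> node i t" using i(2) mem by simp
    then have "(i, t) \<in> node i t'" using i(3) by simp
    then have t': "t' = Suc t" using t mem by simp
    show False
    proof (cases "t' = L i")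
      case True
      then have "(i, t - 1) \<in> node i t" "(i, t - 1) \<notin> node i t'" using t' mem L2[OF i(1)] by auto
      then show False using i(3) by simp
    next
      case False
      then have "(i, t') \<in> node i t'" "(i, t') \<notin> node i t" using t' mem i(2) by auto
      then show False using i(3) by simp
    qed
  qed
  show ?thesis
  proof (rule inj_onI, clarify)
    fix i t i' t' assume n: "(i, t) \<in> nodes" "(i', t') \<in> nodes" "node i t = node i' t'"
    obtain j u where "(j, u) \<in> node i t" using node_ne[OF n(1)] by auto
    then have "i = i'" using n(3) mem by metis
    then show "i = i' \<and> t = t'" using *[of i t' t] *[of i t t'] n by (auto simp: nodes_def)
  qed
qed

lemma inj_typed_node: "inj_on (\<lambda>(i, t). (node i t, node_type i t)) S" if "S \<subseteq> nodes"
  using inj_on_subset[OF inj_node that] by (auto simp: inj_on_def)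

lemma end_types_not_large: "i < q \<Longrightarrow> U i \<notin> large_sets B" "i < q \<Longrightarrow> U' i \<notin> large_sets B"
  using U[of i] U'[of i] by (auto simp: large_sets_def)

lemma class_ne: "X \<in> classes \<Longrightarrow> X \<noteq> {}"
  by (auto simp: classes_def split: if_splits)

lemma class_sub: "X \<in> classes \<Longrightarrow> X \<subseteq> A"
  using Y by (auto simp: classes_def A_def split: if_splits)

lemma class_card: "X \<in> classes \<Longrightarrow> card X = 1 \<or> 3 \<le> card X"
  using Y by (auto simp: classes_def split: if_splits)

lemma finite_nodes: "finite nodes"
proof -
  have "nodes = (SIGMA i:{..<q}. {..L i})" by (auto simp: nodes_def)
  then show ?thesis by simp
qed

lemma finite_classes: "finite classes"
  using finite_A by (auto simp: classes_def)

lemma card_classes: "card classes = card A - card Y + (if Y = {} then 0 else 1)"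
proof -
  have 1: "card ((\<lambda>a. {a}) ` (A - Y)) = card A - card Y"
    using Y(1) finite_A by (simp add: card_image A_def card_Diff_subset finite_subset)
  show ?thesis
  proof (cases "Y = {}")
    case True
    then show ?thesis unfolding classes_def by (simp add: card_image)
  next
    case False
    then have "Y \<notin> (\<lambda>a. {a}) ` (A - Y)" by auto
    then show ?thesis unfolding classes_def using 1 False finite_A by simp
  qed
qed

lemma class_containing:
  assumes "a \<in> A" shows "\<exists>C. {X \<in> classes. a \<in> X} = {C}"
proof (cases "a \<in> Y")
  case True
  then have "{X \<in> classes. a \<in> X} = {Y}" by (auto simp: classes_def)
  then show ?thesis by blast
next
  case False
  then have "{X \<in> classes. a \<in> X} = {{a}}" using assms by (auto simp: classes_def split: if_splits)
  then show ?thesis by blast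
qed

text \<open>A link has two points, which no class has, and the type of an end is not large. This
  keeps the sets distinct in the degree counts.\<close>

lemma typed_node_not_in_classes:
  assumes "(i, t) \<in> nodes"
  shows "(node i t, node_type i t) \<notin> classes \<times> large_sets B"
  using assms
proof (cases rule: node_cases)
  case (3 s)
  then have "card (node i t) = 2" by simp
  then show ?thesis using class_card by fastforce
qed (use assms end_types_not_large in \<open>auto simp: nodes_def\<close>)

section \<open>Degrees in a path family\<close>

lemma card_point:
  assumes a: "a \<in> A"
  shows "card {p \<in> family. a \<in> fst p} = 2 + card (large_sets B)"
proof -
  obtain i u where iu: "a = (i, u)" "i < q" "u < L i" using a by (auto simp: A_def path_points_def)
  obtain C where C: "{X \<in> classes. a \<in> X} = {C}" using class_containing[OF a] by blast
  let ?g = "\<lambda>(i, t). (node i t, node_type i t)" and ?N = "{(i, u), (i, Suc u)}"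
  have N: "?N \<subseteq> nodes" using iu by (auto simp: nodes_def)
  have mem: "a \<in> node j t \<longleftrightarrow> (j, t) \<in> ?N" for j t using iu by (auto simp: node_def)
  have "{p \<in> family. a \<in> fst p} = {C} \<times> large_sets B \<union> ?g ` ?N"
  proof -
    have "{p \<in> {{}} \<times> I. a \<in> fst p} = {}" by auto
    moreover have "{p \<in> classes \<times> large_sets B. a \<in> fst p} = {X \<in> classes. a \<in> X} \<times> large_sets B" by auto
    moreover have "{p \<in> ?g ` nodes. a \<in> fst p} = ?g ` {x \<in> nodes. a \<in> fst (?g x)}" by blast
    moreover have "{x \<in> nodes. a \<in> fst (?g x)} = ?N" using mem N by auto
    moreover have "{p \<in> family. a \<in> fst p} = {p \<in> {{}} \<times> I. a \<in> fst p} \<union>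
        {p \<in> classes \<times> large_sets B. a \<in> fst p} \<union> {p \<in> ?g ` nodes. a \<in> fst p}"
      unfolding family_def by blast
    ultimately show ?thesis using C by (simp only: Un_empty_left)
  qed
  also have "card \<dots> = card ({C} \<times> large_sets B) + card (?g ` ?N)"
  proof (rule card_Un_disjoint)
    have "C \<in> classes" using C by auto
    then show "({C} \<times> large_sets B) \<inter> ?g ` ?N = {}" using typed_node_not_in_classes N by fastforce
  qed (use finite_large_sets[OF finite_B] in auto)
  also have "card (?g ` ?N) = 2" using card_image[OF inj_typed_node[OF N]] by simp
  finally show ?thesis by (simp add: card_cartesian_product)
qed

lemma card_type_element:
  assumes b: "b \<in> B"
  shows "card {p \<in> family. b \<in> snd p} = card {T \<in> I. b \<in> T} +
    card classes * card {T \<in> large_sets B. b \<in> T} + card {(i, t) \<in> nodes. b \<in> node_type i t}"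
proof -
  let ?g = "\<lambda>(i, t). (node i t, node_type i t)"
  define N where "N = {(i, t) \<in> nodes. b \<in> node_type i t}"
  define I' where "I' = {T \<in> I. b \<in> T}"
  define E where "E = {{} :: (nat \<times> nat) set} \<times> I'"
  define M where "M = {T \<in> large_sets B. b \<in> T}"
  have N: "N \<subseteq> nodes" and fin: "finite N" "finite I'" "finite M"
    using finite_I finite_large_sets[OF finite_B] finite_subset[OF _ finite_nodes, of N]
    by (auto simp: N_def I'_def M_def)
  have eq: "{p \<in> family. b \<in> snd p} = (E \<union> classes \<times> M) \<union> ?g ` N"
    by (auto simp: family_def N_def I'_def M_def E_def)
  have disj1: "(E) \<inter> (classes \<times> M) = {}" using class_ne by (auto simp: E_def)
  have disj2: "(E \<union> classes \<times> M) \<inter> ?g ` N = {}"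
    using typed_node_not_in_classes node_ne N by (fastforce simp: M_def E_def)
  have "card {p \<in> family. b \<in> snd p} = card (E \<union> classes \<times> M) + card (?g ` N)"
    unfolding eq by (rule card_Un_disjoint) (use fin finite_classes disj2 in \<open>auto simp: E_def\<close>)
  moreover have "card (E \<union> classes \<times> M) = card (E) + card (classes \<times> M)"
    by (rule card_Un_disjoint) (use fin finite_classes disj1 in \<open>auto simp: E_def\<close>)
  moreover have "card (?g ` N) = card N" using card_image[OF inj_typed_node[OF N]] .
  ultimately show ?thesis by (simp add: card_cartesian_product N_def I'_def M_def E_def)
qed

lemma card_nodes_of_type:
  "card {(i, t) \<in> nodes. b \<in> node_type i t} = card {i. i < q \<and> b \<in> U i} + card {i. i < q \<and> b \<in> U' i} +
    card {(i, t). i < q \<and> 0 < t \<and> t < L i \<and> b \<in> V i t}"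
proof -
  define X X' Z where "X = {i. i < q \<and> b \<in> U i}" and "X' = {i. i < q \<and> b \<in> U' i}"
    and "Z = {(i, t). i < q \<and> 0 < t \<and> t < L i \<and> b \<in> V i t}"
  have L0: "0 < L i" if "i < q" for i using L2[OF that] by simp
  have fin: "finite X" "finite X'" "finite Z"
    by (auto simp: X_def X'_def Z_def nodes_def intro: finite_subset[OF _ finite_nodes])
  have eq: "{(i, t) \<in> nodes. b \<in> node_type i t} = ((\<lambda>i. (i, 0 :: nat)) ` X \<union> (\<lambda>i. (i, L i)) ` X') \<union> Z"
    unfolding X_def X'_def Z_def by (auto simp: nodes_def node_type_def dest: L0 split: if_splits)
  have disj1: "(\<lambda>i. (i, 0 :: nat)) ` X \<inter> (\<lambda>i. (i, L i)) ` X' = {}"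
    using L0 by (fastforce simp: X_def)
  have disj2: "((\<lambda>i. (i, 0 :: nat)) ` X \<union> (\<lambda>i. (i, L i)) ` X') \<inter> Z = {}" by (auto simp: Z_def)
  have "card {(i, t) \<in> nodes. b \<in> node_type i t} = card ((\<lambda>i. (i, 0 :: nat)) ` X \<union> (\<lambda>i. (i, L i)) ` X') + card Z"
    unfolding eq by (rule card_Un_disjoint) (use fin disj2 in auto)
  moreover have "card ((\<lambda>i. (i, 0 :: nat)) ` X \<union> (\<lambda>i. (i, L i)) ` X') = card ((\<lambda>i. (i, 0 :: nat)) ` X) + card ((\<lambda>i. (i, L i)) ` X')"
    by (rule card_Un_disjoint) (use fin disj1 in auto)
  moreover have "card ((\<lambda>i. (i, 0 :: nat)) ` X) = card X" "card ((\<lambda>i. (i, L i)) ` X') = card X'"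
    by (simp_all add: card_image inj_on_def)
  ultimately show ?thesis by (simp add: X_def X'_def Z_def)
qed

text \<open>The traces of two elements on \<open>A\<close> are the links, so every path is kept or
  reversed, and its end types are fixed or exchanged accordingly. By assumption this makes
  \<open>\<pi>\<close> trivial, and then \<open>U i \<noteq> U' i\<close> excludes
  reversals.\<close>

lemma family_automorphism_trivial:
  assumes \<sigma>: "\<sigma> permutes A" and \<pi>: "\<pi> permutes B" and G: "(\<lambda>(X, T). (\<sigma> ` X, \<pi> ` T)) ` family = family"
    and rigid: "(`) \<pi> ` I = I \<Longrightarrow>
      \<forall>i<q. (\<pi> ` U i = U i \<and> \<pi> ` U' i = U' i) \<or> (\<pi> ` U i = U' i \<and> \<pi> ` U' i = U i) \<Longrightarrow> \<pi> = id"
  shows "\<sigma> = id \<and> \<pi> = id"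
proof -
  have inj\<sigma>: "inj \<sigma>" using \<sigma> by (rule permutes_inj)
  have inj\<pi>: "inj \<pi>" using \<pi> by (rule permutes_inj)
  have c\<pi>: "card (\<pi> ` T) = card T" for T using inj\<pi> by (simp add: card_image inj_on_subset)
  have mem: "(\<sigma> ` X, \<pi> ` T) \<in> family" if "(X, T) \<in> family" for X T
  proof -
    have "(\<lambda>(X, T). (\<sigma> ` X, \<pi> ` T)) (X, T) \<in> family" using G that by blast
    then show ?thesis by simp
  qed
  have \<pi>I: "(`) \<pi> ` I = I"
  proof (rule endo_inj_surj[OF finite_I])
    show "inj_on ((`) \<pi>) I" using inj\<pi> by (auto simp: inj_on_def inj_image_eq_iff)
    show "(`) \<pi> ` I \<subseteq> I"
    proof (rule image_subsetI)
      fix T assume "T \<in> I"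
      then have "({}, \<pi> ` T) \<in> family" using mem[of "{}" T] by (simp add: family_def)
      then show "\<pi> ` T \<in> I" using class_ne node_ne by (auto simp: family_def)
    qed
  qed
  have ends: "(\<forall>t<L i. \<sigma> (i, t) = (i, t)) \<and> \<pi> ` U i = U i \<and> \<pi> ` U' i = U' i \<or>
      (\<forall>t<L i. \<sigma> (i, t) = (i, L i - 1 - t)) \<and> \<pi> ` U i = U' i \<and> \<pi> ` U' i = U i" if i: "i < q" for i
  proof -
    have links: "{X \<in> fst ` family. card X = 2} = path_links q L"
    proof
      show "{X \<in> fst ` family. card X = 2} \<subseteq> path_links q L"
      proof
        fix X assume "X \<in> {X \<in> fst ` family. card X = 2}"
        then obtain T where "(X, T) \<in> family" "card X = 2" by auto
        then obtain j t where jt: "(j, t) \<in> nodes" "X = node j t"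
          using class_card by (fastforce simp: family_def)
        from jt(1) show "X \<in> path_links q L"
        proof (cases rule: node_cases)
          case (3 s)
          then show ?thesis using jt path_linkI[of j q s L] by (simp add: nodes_def)
        qed (use jt \<open>card X = 2\<close> in simp_all)
      qed
      show "path_links q L \<subseteq> {X \<in> fst ` family. card X = 2}"
      proof
        fix X assume "X \<in> path_links q L"
        then obtain j t where jt: "X = {(j, t), (j, Suc t)}" "j < q" "Suc t < L j"
          by (auto simp: path_links_def)
        then have "(j, Suc t) \<in> nodes" "node j (Suc t) = X"
          using node_Suc[of t j] by (auto simp: nodes_def)
        then have "(X, node_type j (Suc t)) \<in> family" using typed_node_in_family by metis
        then have "X \<in> fst ` family" by force
        then show "X \<in> {X \<in> fst ` family. card X = 2}" using jt by simp
      qed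
    qed
    have "(`) \<sigma> ` fst ` family = fst ` (\<lambda>(X, T). (\<sigma> ` X, \<pi> ` T)) ` family"
      by (simp add: image_image case_prod_beta)
    then have "(`) \<sigma> ` fst ` family = fst ` family" unfolding G .
    then have "(`) \<sigma> ` path_links q L = path_links q L"
      using image_filter_card[OF inj\<sigma>, of "fst ` family" "\<lambda>x. x = 2"] links by simp
    then have dichotomy: "(\<forall>t<L i. \<sigma> (i, t) = (i, t)) \<or> (\<forall>t<L i. \<sigma> (i, t) = (i, L i - 1 - t))"
      using path_automorphism[of L q \<sigma> i] inj_L L2 \<sigma> i by (simp add: A_def)
    \<comment> \<open>The only sets that meet \<open>A\<close> in this end alone are the end node
      and sets of large type.\<close>
    have first: "T = U i" if T: "({(i, 0)}, T) \<in> family" "T \<notin> large_sets B" for T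
    proof -
      obtain j t where jt: "(j, t) \<in> nodes" "{(i, 0)} = node j t" "T = node_type j t"
        using T by (auto simp: family_def)
      have "j < q" "2 \<le> L j" using jt(1) L2 by (auto simp: nodes_def)
      with jt(1) show ?thesis by (cases rule: node_cases) (use jt(2,3) in auto)
    qed
    have last: "T = U' i" if T: "({(i, L i - 1)}, T) \<in> family" "T \<notin> large_sets B" for T
    proof -
      obtain j t where jt: "(j, t) \<in> nodes" "{(i, L i - 1)} = node j t" "T = node_type j t"
        using T by (auto simp: family_def)
      have "j < q" "2 \<le> L j" using jt(1) L2 by (auto simp: nodes_def)
      with jt(1) show ?thesis by (cases rule: node_cases) (use jt(2,3) in auto)
    qed
    have "(i, 0) \<in> nodes" "(i, L i) \<in> nodes" using i by (auto simp: nodes_def)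
    then have "({(i, 0)}, U i) \<in> family" "({(i, L i - 1)}, U' i) \<in> family"
      using typed_node_in_family[of i 0] typed_node_in_family[of i "L i"] node_0[OF i] node_last[OF i] L2[OF i]
      by (auto simp: node_type_def)
    then have imgs: "({\<sigma> (i, 0)}, \<pi> ` U i) \<in> family" "({\<sigma> (i, L i - 1)}, \<pi> ` U' i) \<in> family"
      using mem by force+
    have nl: "\<pi> ` U i \<notin> large_sets B" "\<pi> ` U' i \<notin> large_sets B"
      using U[OF i] U'[OF i] c\<pi> by (auto simp: large_sets_def)
    have l: "0 < L i" "L i - 1 < L i" using L2[OF i] by auto
    from dichotomy show ?thesis
    proof
      assume id: "\<forall>t<L i. \<sigma> (i, t) = (i, t)"
      then have "\<sigma> (i, 0) = (i, 0)" "\<sigma> (i, L i - 1) = (i, L i - 1)" using l by blast+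
      then have "\<pi> ` U i = U i" "\<pi> ` U' i = U' i"
        using first[of "\<pi> ` U i"] last[of "\<pi> ` U' i"] imgs nl by simp_all
      with id show ?thesis by blast
    next
      assume rev: "\<forall>t<L i. \<sigma> (i, t) = (i, L i - 1 - t)"
      have s: "\<sigma> (i, 0) = (i, L i - 1)" "\<sigma> (i, L i - 1) = (i, 0)"
        using rev[rule_format, OF l(1)] rev[rule_format, OF l(2)] by simp_all
      have "\<pi> ` U i = U' i" by (rule last[OF imgs(1)[unfolded s(1)] nl(1)])
      moreover have "\<pi> ` U' i = U i" by (rule first[OF imgs(2)[unfolded s(2)] nl(2)])
      ultimately have "\<pi> ` U i = U' i" "\<pi> ` U' i = U i" by blast+
      with rev show ?thesis by blast
    qed
  qed
  have \<pi>_id: "\<pi> = id"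
  proof (rule rigid[OF \<pi>I])
    show "\<forall>i<q. \<pi> ` U i = U i \<and> \<pi> ` U' i = U' i \<or> \<pi> ` U i = U' i \<and> \<pi> ` U' i = U i"
    proof (intro allI impI)
      fix i assume "i < q"
      from ends[OF this] show "\<pi> ` U i = U i \<and> \<pi> ` U' i = U' i \<or> \<pi> ` U i = U' i \<and> \<pi> ` U' i = U i"
        by blast
    qed
  qed
  have "\<sigma> x = x" for x
  proof (cases "x \<in> A")
    case True
    then obtain i t where x: "x = (i, t)" "i < q" "t < L i" by (auto simp: A_def path_points_def)
    have "\<not> (\<pi> ` U i = U' i)" using U_neq[OF x(2)] by (simp add: \<pi>_id)
    then show ?thesis using ends[OF x(2)] x by blast
  next
    case False
    then show ?thesis using permutes_not_in[OF \<sigma>] by blast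
  qed
  then show ?thesis using \<pi>_id by auto
qed

lemma distinguishing_partition_exists:
  assumes degB: "\<And>b. b \<in> B \<Longrightarrow> n2 = card {T \<in> I. b \<in> T} + card classes * card {T \<in> large_sets B. b \<in> T} +
      card {i. i < q \<and> b \<in> U i} + card {i. i < q \<and> b \<in> U' i} +
      card {(i, t). i < q \<and> 0 < t \<and> t < L i \<and> b \<in> V i t}"
    and n: "2 + card (large_sets B) \<noteq> n2" "0 < n2"
    and rigid: "\<And>\<pi>. \<pi> permutes B \<Longrightarrow> (`) \<pi> ` I = I \<Longrightarrow>
      \<forall>i<q. (\<pi> ` U i = U i \<and> \<pi> ` U' i = U' i) \<or> (\<pi> ` U i = U' i \<and> \<pi> ` U' i = U i) \<Longrightarrow> \<pi> = id"
  shows "\<exists>P. distinguishing_partition (K (\<Sum>i<q. L i) (2 + card (large_sets B)) (card B) n2) P"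
proof -
  have "\<exists>P. distinguishing_partition (K (card A) (2 + card (large_sets B)) (card B) n2) P"
  proof (rule distinguishing_partition_of_pairs[where G = family])
    show "family \<subseteq> Pow A \<times> Pow B"
      using I class_sub node_sub node_type_sub by (fastforce simp: family_def large_sets_def)
    show "({}, {}) \<notin> family" using I class_ne node_ne[THEN not_sym] by (auto simp: family_def)
    show "card {p \<in> family. a \<in> fst p} = 2 + card (large_sets B)" if "a \<in> A" for a
      using card_point[OF that] .
    show "card {p \<in> family. b \<in> snd p} = n2" if "b \<in> B" for b
      using card_type_element[OF that] card_nodes_of_type[of b] degB[OF that] by simp
    show "\<sigma> = id \<and> \<pi> = id" if "\<sigma> permutes A" "\<pi> permutes B" "(\<lambda>(X, T). (\<sigma> ` X, \<pi> ` T)) ` family = family" for \<sigma> \<pi>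
      using family_automorphism_trivial[OF that] rigid[OF that(2)] by blast
  qed (use finite_A finite_B n in auto)
  then show ?thesis by (simp add: A_def card_path_points)
qed

end

text \<open>The degree of \<open>b\<close> is tuned by two numbers: \<open>g\<close> counts the
  classes, and \<open>l b\<close> counts the links whose type contains \<open>b\<close>.\<close>

lemma distinguishing_partition_of_paths:
  fixes B :: "'b set" and U U' :: "nat \<Rightarrow> 'b set" and l :: "'b \<Rightarrow> nat"
  assumes q: "1 \<le> q" and m1: "(\<Sum>i<q - 1. i + 2) + q + 2 \<le> m1" and B: "finite B"
    and U: "\<And>i. i < q \<Longrightarrow> U i \<subseteq> B \<and> 2 * card (U i) \<le> card B"
    and U': "\<And>i. i < q \<Longrightarrow> U' i \<subseteq> B \<and> 2 * card (U' i) \<le> card B"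
    and U_neq: "\<And>i. i < q \<Longrightarrow> U i \<noteq> U' i"
    and I: "I \<subseteq> Pow B - {{}}"
    and g: "1 \<le> g \<and> g \<le> m1 - 2 \<or> g = m1" and l: "\<And>b. b \<in> B \<Longrightarrow> l b \<le> m1 - q"
    and degB: "\<And>b. b \<in> B \<Longrightarrow> n2 = card {T \<in> I. b \<in> T} + g * card {T \<in> large_sets B. b \<in> T} +
      card {i. i < q \<and> b \<in> U i} + card {i. i < q \<and> b \<in> U' i} + l b"
    and n: "2 + card (large_sets B) \<noteq> n2" "0 < n2"
    and rigid: "\<And>\<pi>. \<pi> permutes B \<Longrightarrow> (`) \<pi> ` I = I \<Longrightarrow>
      \<forall>i<q. (\<pi> ` U i = U i \<and> \<pi> ` U' i = U' i) \<or> (\<pi> ` U i = U' i \<and> \<pi> ` U' i = U i) \<Longrightarrow> \<pi> = id"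
  shows "\<exists>P. distinguishing_partition (K m1 (2 + card (large_sets B)) (card B) n2) P"
proof -
  define s where "s = (\<Sum>i<q - 1. i + 2)"
  \<comment> \<open>The first \<open>q - 1\<close> paths have the lengths from \<open>2\<close> to
    \<open>q\<close>; the last one takes all remaining points and is longer because
    \<open>m1\<close> is large.\<close>
  define L where "L i = (if i < q - 1 then i + 2 else m1 - s)" for i
  have big: "q + 2 \<le> m1 - s" "s \<le> m1" using m1 by (auto simp: s_def)
  have L2: "2 \<le> L i" for i using big by (auto simp: L_def)
  have inj_L: "inj_on L {..<q}"
    using big by (auto simp: inj_on_def L_def split: if_splits)
  have sum_L: "(\<Sum>i<q. L i) = m1"
  proof -
    have "{..<q} = insert (q - 1) {..<q - 1}" using q by auto
    then have "(\<Sum>i<q. L i) = L (q - 1) + (\<Sum>i<q - 1. L i)" by simp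
    also have "(\<Sum>i<q - 1. L i) = s" unfolding s_def by (intro sum.cong) (auto simp: L_def)
    finally show ?thesis using big by (simp add: L_def)
  qed
  have card_pts: "card (path_points q L) = m1" by (simp add: card_path_points sum_L)
  define J where "J = {(i, t). i < q \<and> 0 < t \<and> t < L i}"
  have J: "finite J \<and> card J = m1 - q"
  proof -
    have "J = (SIGMA i:{..<q}. {0<..<L i})" by (auto simp: J_def)
    moreover have "(\<Sum>i<q. L i - 1) + q = m1"
    proof -
      have "(\<Sum>i<q. L i - 1) + q = (\<Sum>i<q. (L i - 1) + 1)" by (simp only: sum.distrib) simp
      also have "\<dots> = (\<Sum>i<q. L i)" 
      proof (intro sum.cong refl)
        show "L i - 1 + 1 = L i" for i using L2[of i] by simp
      qed
      finally show ?thesis using sum_L by simp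
    qed
    ultimately show ?thesis by simp
  qed
  then obtain h where h: "bij_betw h J {..<m1 - q}"
    using finite_same_card_bij[of J "{..<m1 - q}"] by auto
  \<comment> \<open>The bijection \<open>h\<close> numbers the \<open>m1 - q\<close> links, and
    \<open>b\<close> belongs to the types of the first \<open>l b\<close> of them.\<close>
  define V where "V i t = {b \<in> B. (i, t) \<in> J \<and> h (i, t) < l b}" for i t
  \<comment> \<open>Merging \<open>m1 - g + 1\<close> points leaves \<open>g\<close> classes. For
    \<open>g = m1 - 1\<close> the merged points would form a pair, which could look like a
    link.\<close>
  define y where "y = (if g = m1 then 0 else m1 - g + 1)"
  have m12: "2 \<le> m1" using m1 by simp
  have "y \<le> card (path_points q L)" using g m12 by (auto simp: y_def card_pts)
  then obtain Y where sub: "Y \<subseteq> path_points q L" and card_Y: "card Y = y" and fin_Y: "finite Y"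
    by (rule obtain_subset_with_card_n)
  have Y_empty: "Y = {} \<longleftrightarrow> y = 0" using card_Y fin_Y by auto
  interpret typed_paths q L B U U' V I Y
  proof
    show "Y = {} \<or> 3 \<le> card Y" 
      using Y_empty card_Y g m12 by (auto simp: y_def split: if_splits)
  qed (use inj_L L2 B U U' U_neq I sub in \<open>auto simp: V_def\<close>)
  have g_eq: "card classes = g"
  proof -
    have "card classes = m1 - y + (if y = 0 then 0 else 1)"
      using card_classes by (simp only: A_def card_pts card_Y Y_empty)
    then show ?thesis using g m12 by (auto simp: y_def)
  qed
  have "card {(i, t). i < q \<and> 0 < t \<and> t < L i \<and> b \<in> V i t} = l b" if "b \<in> B" for b
  proof -
    have "{(i, t). i < q \<and> 0 < t \<and> t < L i \<and> b \<in> V i t} = {x \<in> J. h x < l b}"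
      using that by (auto simp: V_def J_def)
    moreover have "bij_betw h {x \<in> J. h x < l b} {..<l b}"
    proof (rule bij_betw_imageI)
      show "inj_on h {x \<in> J. h x < l b}" using h by (auto simp: bij_betw_def inj_on_def)
      show "h ` {x \<in> J. h x < l b} = {..<l b}"
      proof
        show "{..<l b} \<subseteq> h ` {x \<in> J. h x < l b}"
        proof
          fix u assume "u \<in> {..<l b}"
          moreover from this have "u \<in> h ` J" using l[OF that] h by (auto simp: bij_betw_def)
          ultimately show "u \<in> h ` {x \<in> J. h x < l b}" by auto
        qed
      qed auto
    qed
    ultimately show ?thesis using bij_betw_same_card by fastforce
  qed
  then show ?thesis
    using distinguishing_partition_exists[of n2] degB n rigid g_eq sum_L by simp
qed

section \<open>Cyclic windows and the theorem\<close>

text \<open>The cyclic interval of \<open>s\<close> residues starting at \<open>i\<close>, for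
  \<open>s\<close> up to \<open>m\<close>, with \<open>i\<close> read modulo
  \<open>m\<close>.\<close>

definition window :: "nat \<Rightarrow> nat \<Rightarrow> nat \<Rightarrow> nat set" where
  "window m s i = {b. b < m \<and> (int b - int i) mod int m < int s}"

text \<open>Translations and reflections permute the residues. The sign \<open>1\<close> counts the
  points of a given window, the sign \<open>-1\<close> the windows through a given point.\<close>

lemma card_shift_mod:
  assumes m: "0 < m" and s: "s \<le> m" and c: "c = 1 \<or> c = -1"
  shows "card {b. b < m \<and> (c * int b + k) mod int m < int s} = s"
proof -
  have "bij_betw (\<lambda>b. nat ((c * int b + k) mod int m)) {b. b < m \<and> (c * int b + k) mod int m < int s} {..<s}"
  proof (rule bij_betw_byWitness[where f' = "\<lambda>u. nat ((c * (int u - k)) mod int m)"])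
    have cc: "c * (c * x) = x" for x using c by auto
    have "(c * ((c * int b + k) mod int m - k)) mod int m = int b" if "b < m" for b
    proof -
      have "(c * ((c * int b + k) mod int m - k)) mod int m = (c * (c * int b + k - k)) mod int m"
        by (metis mod_diff_left_eq mod_mult_right_eq)
      then show ?thesis using that cc by simp
    qed
    then show "\<forall>b\<in>{b. b < m \<and> (c * int b + k) mod int m < int s}.
        nat ((c * (int (nat ((c * int b + k) mod int m)) - k)) mod int m) = b"
      using m by simp
    have "(c * ((c * (int u - k)) mod int m) + k) mod int m = int u" if "u < s" for u
    proof -
      have "(c * ((c * (int u - k)) mod int m) + k) mod int m = (c * (c * (int u - k)) + k) mod int m"
        by (metis mod_add_left_eq mod_mult_right_eq)
      then show ?thesis using that s cc by simp
    qed
    note inv = this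
    then show "\<forall>u\<in>{..<s}. nat ((c * int (nat ((c * (int u - k)) mod int m)) + k) mod int m) = u"
      using m by simp
    show "(\<lambda>b. nat ((c * int b + k) mod int m)) ` {b. b < m \<and> (c * int b + k) mod int m < int s} \<subseteq> {..<s}"
      by (auto simp: nat_less_iff m)
    show "(\<lambda>u. nat ((c * (int u - k)) mod int m)) ` {..<s} \<subseteq> {b. b < m \<and> (c * int b + k) mod int m < int s}"
    proof (rule image_subsetI)
      fix u assume "u \<in> {..<s}"
      then show "nat ((c * (int u - k)) mod int m) \<in> {b. b < m \<and> (c * int b + k) mod int m < int s}"
        using inv[of u] m by (simp add: nat_less_iff)
    qed
  qed
  then show ?thesis using bij_betw_same_card by fastforce
qed

lemma card_window: "0 < m \<Longrightarrow> s \<le> m \<Longrightarrow> card (window m s i) = s"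
  using card_shift_mod[of m s 1 "- int i"] by (simp add: window_def)

text \<open>All elements of \<open>B\<close> thus receive the same contribution from the end
  types.\<close>

lemma card_windows_containing:
  assumes "s \<le> m" "b < m"
  shows "card {i. i < m \<and> b \<in> window m s i} = s" "card {i. i < m \<and> b \<in> window m s (Suc i)} = s"
  using card_shift_mod[of m s "-1" "int b"] card_shift_mod[of m s "-1" "int b - 1"] assms
  by (simp_all add: window_def algebra_simps)

lemma window_mod: "window m s (i mod m) = window m s i"
  by (simp add: window_def zmod_int mod_diff_right_eq)

lemma window_Suc_mod: "window m s (Suc (i mod m)) = window m s (Suc i)"
  using window_mod[of m s "Suc (i mod m)"] window_mod[of m s "Suc i"] by (simp add: mod_Suc_eq)

text \<open>Relative to the starts of the two later windows, \<open>i\<close> has the residues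
  \<open>m - 1\<close> and \<open>m - 2\<close>, which are at least \<open>m div 2\<close> for
  \<open>m \<ge> 3\<close>.\<close>

lemma self_in_windows:
  assumes m: "3 \<le> m" and i: "i < m"
  shows "i \<in> window m (m div 2) i" "i \<notin> window m (m div 2) (Suc i)"
    "i \<notin> window m (m div 2) (Suc (Suc i))"
proof -
  show "i \<in> window m (m div 2) i" using m i by (simp add: window_def)
  have "m div 2 + 2 \<le> m" using m by linarith
  then have le: "int (m div 2) \<le> int m - 2" by linarith
  have "(int i - int (Suc i)) mod int m = int m - 1" using m by (simp add: zmod_minus1)
  then show "i \<notin> window m (m div 2) (Suc i)" using le by (simp add: window_def)
  have "(int i - int (Suc (Suc i))) mod int m = (int m - 2) mod int m"
    by (simp add: mod_diff_left_eq)
  also have "\<dots> = int m - 2" by (rule mod_pos_pos_trivial) (use m in auto)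
  finally show "i \<notin> window m (m div 2) (Suc (Suc i))" using le by (auto simp: window_def)
qed

lemma window_diff:
  assumes m: "3 \<le> m" and i: "i < m"
  shows "window m (m div 2) i - window m (m div 2) (Suc i) = {i}"
proof
  show "{i} \<subseteq> window m (m div 2) i - window m (m div 2) (Suc i)"
    using self_in_windows[OF assms] by simp
  show "window m (m div 2) i - window m (m div 2) (Suc i) \<subseteq> {i}"
  proof
    fix b assume b: "b \<in> window m (m div 2) i - window m (m div 2) (Suc i)"
    let ?d = "(int b - int i) mod int m"
    have d: "0 \<le> ?d" "?d < int m" using m by auto
    have "(int b - int (Suc i)) mod int m = (?d - 1) mod int m"
      by (simp add: mod_diff_left_eq algebra_simps)
    moreover have "(?d - 1) mod int m = ?d - 1" if "0 < ?d" using d that by simp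
    moreover have "?d < int (m div 2)" "\<not> (int b - int (Suc i)) mod int m < int (m div 2)"
      using b unfolding window_def by blast+
    ultimately have "?d = 0" using d(1) by linarith
    then have "int b mod int m = int i mod int m" by (simp add: mod_eq_dvd_iff mod_eq_0_iff_dvd)
    then show "b \<in> {i}" using b i by (simp add: window_def)
  qed
qed

text \<open>Being an end type of the next path as well, window \<open>i + 1\<close> goes to itself
  or to window \<open>i + 2\<close>. Neither contains \<open>i\<close>, so neither is window
  \<open>i\<close>. Hence no two windows are exchanged, all are fixed, and so are the differences
  \<open>{i}\<close> of consecutive ones.\<close>

lemma windows_rigid:
  assumes m: "3 \<le> m" and \<pi>: "\<pi> permutes {..<m}"
    and pres: "\<forall>i<m. (\<pi> ` window m (m div 2) i = window m (m div 2) i \<and>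
        \<pi> ` window m (m div 2) (Suc i) = window m (m div 2) (Suc i)) \<or>
      (\<pi> ` window m (m div 2) i = window m (m div 2) (Suc i) \<and>
        \<pi> ` window m (m div 2) (Suc i) = window m (m div 2) i)"
  shows "\<pi> = id"
proof -
  let ?W = "window m (m div 2)"
  have "\<pi> i = i" if i: "i < m" for i
  proof -
    have Suc_mod: "?W (Suc i mod m) = ?W (Suc i)" "?W (Suc (Suc i mod m)) = ?W (Suc (Suc i))"
      using window_mod window_Suc_mod[of m _ "Suc i"] by auto
    have "Suc i mod m < m" using m by simp
    then have "\<pi> ` ?W (Suc i) = ?W (Suc i) \<or> \<pi> ` ?W (Suc i) = ?W (Suc (Suc i))"
      using pres Suc_mod by metis
    then have "\<pi> ` ?W (Suc i) \<noteq> ?W i" using self_in_windows[OF m i] by metis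
    then have "\<pi> ` ?W i = ?W i" "\<pi> ` ?W (Suc i) = ?W (Suc i)" using pres i by blast+
    then have "\<pi> ` (?W i - ?W (Suc i)) = ?W i - ?W (Suc i)"
      using image_set_diff[OF permutes_inj[OF \<pi>]] by metis
    then show ?thesis unfolding window_diff[OF m i] by simp
  qed
  then show ?thesis using \<pi> by (metis eq_id_iff lessThan_iff permutes_not_in)
qed

text \<open>Here \<open>g\<close> will be the number of classes and \<open>l\<close> that of links.
  From \<open>c * m\<close> on, \<open>g = m\<close> is taken. Below, the quotient of
  \<open>z\<close> by \<open>c\<close> serves unless it is \<open>m - 1\<close>, which is no
  possible number of classes; then \<open>g = m - 2\<close> leaves \<open>l < 2 * c\<close>, still
  within the number of links.\<close>

lemma decompose_range:
  fixes c m q z :: nat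
  assumes c: "1 \<le> c" and z: "c \<le> z" "z \<le> c * m + (m - q)" and m: "2 * c + q + 2 \<le> m"
  obtains g l where "1 \<le> g \<and> g \<le> m - 2 \<or> g = m" "l \<le> m - q" "z = g * c + l"
proof (cases "c * m \<le> z")
  case True
  then show thesis using that[of m "z - c * m"] z by (simp add: mult.commute)
next
  case False
  show thesis
  proof (cases "z div c \<le> m - 2")
    case True
    have "1 \<le> z div c" using c z by (simp add: div_greater_zero_iff Suc_le_eq)
    moreover have "z mod c < c" using c by simp
    moreover have "z = z div c * c + z mod c" by simp
    ultimately show thesis using that[of "z div c" "z mod c"] True m by linarith
  next
    case gt: False
    have "(m - 2) * c \<le> z" using gt by (metis le_trans mult_le_mono1 nat_le_linear div_times_less_eq_dividend)
    moreover have "c * m = (m - 2) * c + 2 * c"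
    proof -
      have "m - 2 + 2 = m" using m by simp
      then show ?thesis by (metis distrib_right mult.commute)
    qed
    ultimately show thesis using that[of "m - 2" "z - (m - 2) * c"] False m by linarith
  qed
qed

section \<open>The bounds on n2, with \<open>c\<close> for \<open>r - 1\<close>\<close>

locale parameters =
  fixes n1 m2 c :: nat
  assumes m2: "1 \<le> m2"
    and n1: "n1 = 2 + (\<Sum>i=0..(m2 - 1) div 2. m2 choose i)"
    and c: "c = (\<Sum>i=0..(m2 - 1) div 2. (m2 - 1) choose i)"
begin

lemma c_pos: "1 \<le> c"
proof -
  have "(m2 - 1) choose 0 \<le> c" unfolding c by (rule member_le_sum) auto
  then show ?thesis by simp
qed

lemma n1_ge: "3 \<le> n1"
proof -
  have "m2 choose 0 \<le> (\<Sum>i=0..(m2 - 1) div 2. m2 choose i)" by (rule member_le_sum) auto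
  then show ?thesis by (simp add: n1)
qed

lemma n1_eq: "finite B \<Longrightarrow> card B = m2 \<Longrightarrow> 2 + card (large_sets B) = n1"
  using card_large_sets[of B] m2 by (cases "B = {}") (auto simp: n1)

lemma c_eq: "finite B \<Longrightarrow> card B = m2 \<Longrightarrow> b \<in> B \<Longrightarrow> card {T \<in> large_sets B. b \<in> T} = c"
  using card_large_sets_containing[of B b] by (simp add: c)

text \<open>The double count bounds \<open>m2 * n2\<close>, and \<open>m2\<close> can be cancelled.
  Equality would give a tight family, which is not rigid for odd \<open>m2\<close> and for
  \<open>m2 = 2\<close>.\<close>

lemma upper_bound:
  assumes dp: "distinguishing_partition (K m1 n1 m2 n2) P" and m1: "1 \<le> m1" and n2: "1 \<le> n2"
  shows "n2 \<le> (1 + c) * m1 + 2 ^ (m2 - 1)"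
    and "odd m2 \<or> m2 = 2 \<Longrightarrow> n2 \<noteq> (1 + c) * m1 + 2 ^ (m2 - 1)"
proof -
  let ?ns = "replicate m1 n1 @ replicate m2 n2"
  define A B where "A = {..<m1}" and "B = {m1..<m1 + m2}"
  have AB: "A \<union> B = {..<length ?ns}" by (auto simp: A_def B_def)
  have cards: "card A = m1" "card B = m2" by (auto simp: A_def B_def)
  have "\<forall>i<length ?ns. 0 < ?ns ! i" using n1_ge n2 by (auto simp: nth_append)
  then obtain F where F: "rigid_family (A \<union> B) F" "\<forall>i<length ?ns. card {S \<in> F. i \<in> S} = ?ns ! i"
    using rigid_family_of_distinguishing_partition[of ?ns P] dp unfolding K_def AB by blast
  interpret extremal_family A B F n2
  proof
    show "card {S \<in> F. a \<in> S} = 2 + card (large_sets B)" if "a \<in> A" for a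
      using F(2)[rule_format, of a] that n1_eq[of B] cards by (simp add: A_def B_def nth_append)
    show "card {S \<in> F. b \<in> S} = n2" if "b \<in> B" for b
      using F(2)[rule_format, of b] that by (auto simp: B_def nth_append)
    show "F \<subseteq> Pow (A \<union> B) - {{}}" using F(1) by (simp add: rigid_family_def)
  qed (use m2 in \<open>auto simp: A_def B_def\<close>)
  have sum_L: "(\<Sum>T\<in>large_sets B. card T) = m2 * c"
    using sum_card_large_sets[OF finite_B] cards c by simp
  have sum_P: "(\<Sum>T\<in>Pow B. card T) = m2 * 2 ^ (m2 - 1)"
    using sum_card_Pow[OF finite_B] cards by simp
  have eq: "(\<Sum>T\<in>Pow B. card T) + card A * (card B + (\<Sum>T\<in>large_sets B. card T)) =
      m2 * ((1 + c) * m1 + 2 ^ (m2 - 1))"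
    unfolding sum_L sum_P cards by (simp add: algebra_simps)
  then have "m2 * n2 \<le> m2 * ((1 + c) * m1 + 2 ^ (m2 - 1))" using incidences_le cards by simp
  then show "n2 \<le> (1 + c) * m1 + 2 ^ (m2 - 1)" using m2 by simp
  show "n2 \<noteq> (1 + c) * m1 + 2 ^ (m2 - 1)" if "odd m2 \<or> m2 = 2"
  proof
    assume "n2 = (1 + c) * m1 + 2 ^ (m2 - 1)"
    then have "card B * n2 = (\<Sum>T\<in>Pow B. card T) + card A * (card B + (\<Sum>T\<in>large_sets B. card T))"
      unfolding eq by (simp add: cards)
    then interpret tight_family A B F n2 by unfold_locales
    have "A \<noteq> {}" using m1 by (simp add: A_def lessThan_empty_iff)
    then show False using odd_not_rigid card_2_not_rigid that F(1) cards by metis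
  qed
qed

text \<open>Each element of \<open>B\<close> lies in \<open>2 ^ (m2 - 1)\<close> sets inside
  \<open>B\<close>, in \<open>2 * (m2 div 2)\<close> end types, in \<open>g * c\<close> sets of
  large type and in \<open>l\<close> link types. The largest choice \<open>g = m1\<close>,
  \<open>l = m1 - m2\<close> attains the bound, the rounding in \<open>m2 div 2\<close> accounting
  for the loss of one when \<open>m2\<close> is odd.\<close>

lemma existence_three:
  assumes m2: "3 \<le> m2" and m1: "(\<Sum>i<m2 - 1. i + 2) + 2 * c + m2 + 2 \<le> m1"
    and n2: "2 ^ (m2 - 1) + 2 * (m2 div 2) + c \<le> n2" "n2 \<noteq> n1"
      "n2 \<le> (1 + c) * m1 + 2 ^ (m2 - 1) - (if even m2 then 0 else 1)"
  shows "\<exists>P. distinguishing_partition (K m1 n1 m2 n2) P"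
proof -
  let ?B = "{..<m2}" and ?W = "window m2 (m2 div 2)"
  define z where "z = n2 - 2 ^ (m2 - 1) - 2 * (m2 div 2)"
  have m2_eq: "m2 = 2 * (m2 div 2) + (if even m2 then 0 else 1)"
    by (cases "even m2") auto
  have z: "c \<le> z" "z \<le> c * m1 + (m1 - m2)" "n2 = 2 ^ (m2 - 1) + 2 * (m2 div 2) + z"
    using n2 m1 m2_eq unfolding z_def by (auto simp: algebra_simps split: if_splits)
  obtain g l where gl: "1 \<le> g \<and> g \<le> m1 - 2 \<or> g = m1" "l \<le> m1 - m2" "z = g * c + l"
    by (rule decompose_range[OF c_pos z(1,2)]) (use m1 in auto)
  have W: "?W i \<subseteq> ?B \<and> 2 * card (?W i) \<le> card ?B" for i
    using card_window[of m2 "m2 div 2" i] m2 by (auto simp: window_def)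
  have "\<exists>P. distinguishing_partition (K m1 (2 + card (large_sets ?B)) (card ?B) n2) P"
  proof (rule distinguishing_partition_of_paths[where q = m2 and U = ?W and U' = "\<lambda>i. ?W (Suc i)"
        and I = "Pow ?B - {{}}" and g = g and l = "\<lambda>_. l"])
    show "?W i \<noteq> ?W (Suc i)" if "i < m2" for i using self_in_windows[OF m2 that] by metis
    show "n2 = card {T \<in> Pow ?B - {{}}. b \<in> T} + g * card {T \<in> large_sets ?B. b \<in> T} +
        card {i. i < m2 \<and> b \<in> ?W i} + card {i. i < m2 \<and> b \<in> ?W (Suc i)} + l" if "b \<in> ?B" for b
    proof -
      have "{T \<in> Pow ?B - {{}}. b \<in> T} = {T. T \<subseteq> ?B \<and> b \<in> T}" by auto
      then have "card {T \<in> Pow ?B - {{}}. b \<in> T} = 2 ^ (m2 - 1)"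
        using card_subsets_containing[of ?B b] that by simp
      moreover have "card {T \<in> large_sets ?B. b \<in> T} = c" using c_eq[of ?B b] that by simp
      moreover have "m2 div 2 \<le> m2" by simp
      ultimately show ?thesis
        using card_windows_containing[of "m2 div 2" m2 b] that z gl(3) by simp
    qed
    show "\<pi> = id" if "\<pi> permutes ?B" "\<forall>i<m2. (\<pi> ` ?W i = ?W i \<and> \<pi> ` ?W (Suc i) = ?W (Suc i)) \<or>
        (\<pi> ` ?W i = ?W (Suc i) \<and> \<pi> ` ?W (Suc i) = ?W i)" for \<pi>
      using windows_rigid[OF m2 that] .
    show "2 + card (large_sets ?B) \<noteq> n2" using n1_eq[of ?B] n2 by simp
  qed (use W m1 m2 gl n2 in auto)
  then show ?thesis using n1_eq[of ?B] by simp
qed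

lemma existence_two:
  assumes m2: "m2 = 2" and m1: "2 * c + 4 \<le> m1"
    and n2: "3 + c \<le> n2" "n2 \<noteq> n1" "n2 \<le> (1 + c) * m1 + 1"
  shows "\<exists>P. distinguishing_partition (K m1 n1 m2 n2) P"
proof -
  let ?B = "{0, 1 :: nat}" and ?I = "{{1}, {0, 1 :: nat}}"
  have z: "c \<le> n2 - 3" "n2 - 3 \<le> c * m1 + (m1 - 2)" "n2 = 3 + (n2 - 3)"
    using n2 m1 by auto
  obtain g l where gl: "1 \<le> g \<and> g \<le> m1 - 2 \<or> g = m1" "l \<le> m1 - 2" "n2 - 3 = g * c + l"
    by (rule decompose_range[OF c_pos z(1,2)]) (use m1 in auto)
  have cB: "card ?B = m2" using m2 by simp
  have nB: "2 + card (large_sets ?B) = n1" by (rule n1_eq[OF _ cB]) simp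
  have "\<exists>P. distinguishing_partition (K m1 (2 + card (large_sets ?B)) (card ?B) n2) P"
  \<comment> \<open>The element \<open>0\<close> gets one more link, to make up for the missing set
    \<open>{0}\<close>; as the path has \<open>m1 - 1\<close> links and
    \<open>l \<le> m1 - 2\<close>, there is room for it.\<close>
  proof (rule distinguishing_partition_of_paths[where q = 1 and U = "\<lambda>_. {0}" and U' = "\<lambda>_. {1}"
        and I = ?I and g = g and l = "\<lambda>b. if b = 0 then Suc l else l"])
    show "n2 = card {T \<in> ?I. b \<in> T} + g * card {T \<in> large_sets ?B. b \<in> T} +
        card {i :: nat. i < 1 \<and> b \<in> {0}} + card {i :: nat. i < 1 \<and> b \<in> {1}} + (if b = 0 then Suc l else l)"
      if b: "b \<in> ?B" for b
    proof -
      have cb: "card {T \<in> large_sets ?B. b \<in> T} = c" by (rule c_eq[OF _ cB b]) simp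
      consider "b = 0" | "b = 1" using b by auto
      then show ?thesis
      proof cases
        case 1
        have "{T \<in> ?I. b \<in> T} = {{0, 1}}" using 1 by auto
        then have "card {T \<in> ?I. b \<in> T} = 1" by simp
        then show ?thesis unfolding cb using z gl(3) 1 by simp
      next
        case 2
        have "{T \<in> ?I. b \<in> T} = ?I" using 2 by auto
        then have "card {T \<in> ?I. b \<in> T} = 2" by (simp add: doubleton_eq_iff)
        then show ?thesis unfolding cb using z gl(3) 2 by simp
      qed
    qed
    show "\<pi> = id" if \<pi>: "\<pi> permutes ?B" and I: "(`) \<pi> ` ?I = ?I" for \<pi>
    proof
      have "\<pi> ` {1} \<in> (`) \<pi> ` ?I" by (rule imageI) simp
      then have "\<pi> ` {1} \<in> ?I" unfolding I .
      moreover have "1 \<in> X" if "X \<in> ?I" for X using that by auto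
      ultimately have "1 \<in> \<pi> ` {1}" by blast
      then have 1: "\<pi> 1 = 1" by auto
      have "\<pi> 0 \<in> ?B" using permutes_in_image[OF \<pi>] by blast
      moreover have "\<pi> 0 \<noteq> \<pi> 1" using permutes_inj[OF \<pi>] by (metis injD zero_neq_one)
      ultimately have 0: "\<pi> 0 = 0" using 1 by auto
      show "\<pi> b = id b" for b
        using 0 1 permutes_not_in[OF \<pi>, of b] by (cases "b \<in> ?B") auto
    qed
    show "2 + card (large_sets ?B) \<noteq> n2" unfolding nB using n2 by simp
    show "1 \<le> g \<and> g \<le> m1 - 2 \<or> g = m1" by (rule gl(1))
    show "(if b = 0 then Suc l else l) \<le> m1 - 1" for b :: nat using gl(2) m1 by auto
    show "(\<Sum>i<1 - 1. i + 2) + 1 + 2 \<le> m1" using m1 by simp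
    show "0 < n2" using n2(1) by simp
  qed auto
  then show ?thesis unfolding nB cB .
qed

text \<open>The condition on \<open>m1\<close> meets the needs of all constructions; in particular,
  values of \<open>n2\<close> too small for the paths are at most \<open>m1\<close>, where a rigid
  base applies. The case \<open>n2 = n1\<close> is separate because the other constructions tell the
  two kinds of parts apart by their degrees.\<close>

lemma existence:
  assumes m1: "(\<Sum>i<m2 - 1. i + 2) + 2 * c + m2 + 2 * n1 + 2 ^ (m2 - 1) + 4 \<le> m1"
    and n2: "1 \<le> n2" "n2 \<le> (1 + c) * m1 + 2 ^ (m2 - 1) - (if even m2 \<and> 4 \<le> m2 then 0 else 1)"
  shows "\<exists>P. distinguishing_partition (K m1 n1 m2 n2) P"
proof (cases "n2 = n1")
  case True
  then show ?thesis using distinguishing_partition_same_size[of n1 m1 m2] n1_ge m1 by simp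
next
  case False
  consider "m2 = 1" | "m2 = 2" | "3 \<le> m2" using m2 by linarith
  then show ?thesis
  proof cases
    case 1
    then have "n1 = 3" "c = 1" by (auto simp: n1 c)
    then show ?thesis
      using distinguishing_partition_one_part[of m1 n2] 1 n2 m1 False by simp
  next
    case 2
    show ?thesis
    proof (cases "3 + c \<le> n2")
      case True
      then show ?thesis using existence_two[of m1 n2] 2 n2 m1 False by simp
    next
      case False
      then show ?thesis
        using distinguishing_partition_small[of n1 m1 n2 m2] n1_ge n2 m1 \<open>n2 \<noteq> n1\<close> 2 by simp
    qed
  next
    case 3
    have "2 * (m2 div 2) \<le> m2" by simp
    moreover have "(if even m2 \<and> 4 \<le> m2 then 0 else 1) = (if even m2 then 0 else 1 :: nat)"
      using 3 by (cases "m2 = 3") auto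
    ultimately show ?thesis
    proof (cases "2 ^ (m2 - 1) + 2 * (m2 div 2) + c \<le> n2")
      case True
      then show ?thesis
        using existence_three[of m1 n2] 3 n2 m1 False
          \<open>(if even m2 \<and> 4 \<le> m2 then 0 else 1) = (if even m2 then 0 else 1 :: nat)\<close> by simp
    next
      case False
      then have "n2 \<le> m1" using m1 \<open>2 * (m2 div 2) \<le> m2\<close> by linarith
      then show ?thesis
        using distinguishing_partition_small[of n1 m1 n2 m2] n1_ge n2 m1 \<open>n2 \<noteq> n1\<close> by simp
    qed
  qed
qed

end

theorem theorem1p5:
  fixes n1 m2 j k :: nat
  assumes "n1 \<ge> 3" and "m2 \<ge> 1"
    and "is_jk n1 m2 j k"
    and "k = 0" and "j = (m2 - 1) div 2"
  shows "\<exists>M. \<forall>m1\<ge>M. \<forall>n2\<ge>1.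
    (\<exists>P. distinguishing_partition (K m1 n1 m2 n2) P) \<longleftrightarrow>
    real n2 \<le> r_param m2 j k * real m1 + epsilon m2"
proof -
  define c where "c = (\<Sum>i=0..(m2 - 1) div 2. (m2 - 1) choose i)"
  interpret parameters n1 m2 c
    by unfold_locales (use assms in \<open>auto simp: is_jk_def c_def\<close>)
  \<comment> \<open>The truncated subtraction is exact, since \<open>2 ^ (m2 - 1)\<close> is at
    least \<open>1\<close>.\<close>
  define e :: nat where "e = 2 ^ (m2 - 1) - (if even m2 \<and> 4 \<le> m2 then 0 else 1)"
  have r: "r_param m2 j k = real (1 + c)" using r_param_eq[OF assms(2)] assms(4,5) by (simp add: c_def)
  have pow: "1 \<le> (2 :: nat) ^ (m2 - 1)" by simp
  have e: "epsilon m2 = real e" by (auto simp: epsilon_def e_def of_nat_diff)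
  have rhs: "real n2 \<le> r_param m2 j k * real m1 + epsilon m2 \<longleftrightarrow> n2 \<le> (1 + c) * m1 + e" for n2 m1
  proof -
    have "r_param m2 j k * real m1 + epsilon m2 = real ((1 + c) * m1 + e)" by (simp add: r e algebra_simps)
    then show ?thesis by (simp only: of_nat_le_iff)
  qed
  define M where "M = (\<Sum>i<m2 - 1. i + 2) + 2 * c + m2 + 2 * n1 + 2 ^ (m2 - 1) + 4"
  have "(\<exists>P. distinguishing_partition (K m1 n1 m2 n2) P) \<longleftrightarrow> n2 \<le> (1 + c) * m1 + e"
    if "M \<le> m1" "1 \<le> n2" for m1 n2
  proof
    assume "\<exists>P. distinguishing_partition (K m1 n1 m2 n2) P"
    then obtain P where P: "distinguishing_partition (K m1 n1 m2 n2) P" ..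
    have "1 \<le> m1" using that by (simp add: M_def)
    note ub = upper_bound[OF P this that(2)]
    show "n2 \<le> (1 + c) * m1 + e"
    proof (cases "even m2 \<and> 4 \<le> m2")
      case True
      then show ?thesis using ub(1) by (simp add: e_def)
    next
      case False
      then have "odd m2 \<or> m2 = 2" using assms(2) by (auto elim!: evenE)
      then show ?thesis using ub False pow by (simp add: e_def)
    qed
  next
    assume "n2 \<le> (1 + c) * m1 + e"
    then have "n2 \<le> (1 + c) * m1 + 2 ^ (m2 - 1) - (if even m2 \<and> 4 \<le> m2 then 0 else 1)"
      using pow by (auto simp: e_def)
    then show "\<exists>P. distinguishing_partition (K m1 n1 m2 n2) P"
      using existence that by (simp add: M_def)
  qed
  then show ?thesis unfolding rhs by blast
qed

end
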